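(* Let $d,m\ge 1$ be integers, let $1\le q<\infty$, and let $U\subseteq\mathbb{R}^m$ be open and bounded. Then the characteristic map $$\mathcal{E}: W^{1,q}(U,\mathrm{Herm}(d))\to W^{1,q}(U,\mathbb{R}^d),\qquad A\mapsto \lambda^{\uparrow}\circ A,$$ is continuous.
   Context: $M_d(\mathbb{C})$ is the space of complex $d\times d$ matrices with the Frobenius norm $\|A\|_2=(\sum_{i,j}|a_{ij}|^2)^{1/2}$, and $\mathrm{Herm}(d)=\{A\in M_d(\mathbb{C}):A^*=A\}$ is the real vector space of Hermitian matrices. The map $\lambda^{\uparrow}=(\lambda_1^\uparrow,\dots,\lambda_d^\uparrow):\mathrm{Herm}(d)\to\mathbb{R}^d$ assigns to $A$ its eigenvalues (with multiplicity) in increasing order $\lambda_1^\uparrow(A)\le\dots\le\lambda_d^\uparrow(A)$; it is $1$-Lipschitz for the $2$-norms, so $\mathcal{E}$ is well-defined. $W^{1,q}(U,V)$ for a finite-dimensional real vector space $V$ with Euclidean norm $\|\cdot\|_2$ carries the norm $\|f\|_{W^{1,q}}=\|f\|_{L^q}+\sum_{i=1}^m\|\partial_i f\|_{L^q}$, where $\|f\|_{L^q(U,V)}=\big\|\,\|f\|_2\,\big\|_{L^q(U)}$ and $\partial_i f$ are distributional derivatives. *)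

theory Defs
  imports "HOL-Analysis.Analysis" "HOL-Computational_Algebra.Polynomial"
begin

section \<open>Hermitian matrices and their ordered eigenvalues\<close>

text \<open>The norm of \<open>complex^'d^'d\<close> as an iterated Cartesian product is the Frobenius norm.\<close>

definition Herm :: "(complex^'d^'d) set" where
  "Herm = {A. (\<chi> i j. cnj (A $ j $ i)) = A}"

definition charpoly :: "complex^'d^'d \<Rightarrow> complex poly" where
  "charpoly A = det (mat [:0, 1:] - (\<chi> i j. [:A $ i $ j:]))"

text \<open>The index type is linearly ordered so that increasing order makes sense; it is
  order-isomorphic to \<open>{1..CARD('d)}\<close>. For non-Hermitian arguments the value is unspecified.\<close>

definition eigvals_incr :: "complex^'d::{finite,linorder}^'d::{finite,linorder} \<Rightarrow> real^'d::{finite,linorder}" where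
  "eigvals_incr A = (THE l. mono (\<lambda>i. l $ i) \<and>
     (\<forall>t. card {i. l $ i = t} = order (complex_of_real t) (charpoly A)))"

section \<open>Sobolev spaces\<close>

definition partial_deriv :: "'m \<Rightarrow> (real^'m \<Rightarrow> real) \<Rightarrow> real^'m \<Rightarrow> real" where
  "partial_deriv i \<phi> x = frechet_derivative \<phi> (at x) (axis i 1)"

text \<open>\<open>foldr partial_deriv is \<phi>\<close> is the iterated partial derivative along the list \<open>is\<close>.\<close>

definition test_functions :: "(real^'m) set \<Rightarrow> (real^'m \<Rightarrow> real) set" where
  "test_functions U = {\<phi>. (\<forall>is x. foldr partial_deriv is \<phi> differentiable (at x)) \<and>
     compact (closure {x. \<phi> x \<noteq> 0}) \<and> closure {x. \<phi> x \<noteq> 0} \<subseteq> U}"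

definition locally_integrable :: "(real^'m) set \<Rightarrow> (real^'m \<Rightarrow> 'v::euclidean_space) \<Rightarrow> bool" where
  "locally_integrable U f \<longleftrightarrow> (\<forall>K. compact K \<and> K \<subseteq> U \<longrightarrow> f absolutely_integrable_on K)"

definition has_weak_partial ::
    "(real^'m) set \<Rightarrow> 'm \<Rightarrow> (real^'m \<Rightarrow> 'v::euclidean_space) \<Rightarrow> (real^'m \<Rightarrow> 'v) \<Rightarrow> bool" where
  "has_weak_partial U i f g \<longleftrightarrow> locally_integrable U f \<and> locally_integrable U g \<and>
     (\<forall>\<phi>\<in>test_functions U.
        (LINT x|lebesgue_on U. partial_deriv i \<phi> x *\<^sub>R f x)
          = - (LINT x|lebesgue_on U. \<phi> x *\<^sub>R g x))"

text \<open>Weak derivatives are unique only almost everywhere on \<open>U\<close>; one representative is chosen.\<close>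

definition weak_partial ::
    "(real^'m) set \<Rightarrow> 'm \<Rightarrow> (real^'m \<Rightarrow> 'v::euclidean_space) \<Rightarrow> real^'m \<Rightarrow> 'v" where
  "weak_partial U i f = (SOME g. has_weak_partial U i f g)"

text \<open>Elements of the function spaces are represented by functions rather than by classes modulo
  almost-everywhere equality, so \<open>Lq_norm\<close> and \<open>sobolev_norm\<close> are seminorms whose null space
  consists of the functions vanishing almost everywhere on \<open>U\<close>. Values outside \<open>U\<close> are
  irrelevant. The target \<open>V\<close> is a linear subspace of an ambient Euclidean space.\<close>

definition Lq_space ::
    "real \<Rightarrow> (real^'m) set \<Rightarrow> 'v::euclidean_space set \<Rightarrow> (real^'m \<Rightarrow> 'v) set" where
  "Lq_space q U V = {f. f \<in> borel_measurable (lebesgue_on U) \<and> f ` U \<subseteq> V \<and>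
     integrable (lebesgue_on U) (\<lambda>x. norm (f x) powr q)}"

definition Lq_norm :: "real \<Rightarrow> (real^'m) set \<Rightarrow> (real^'m \<Rightarrow> 'v::euclidean_space) \<Rightarrow> real" where
  "Lq_norm q U f = (LINT x|lebesgue_on U. norm (f x) powr q) powr (1 / q)"

definition sobolev_space ::
    "real \<Rightarrow> (real^'m) set \<Rightarrow> 'v::euclidean_space set \<Rightarrow> (real^'m \<Rightarrow> 'v) set" where
  "sobolev_space q U V =
     {f \<in> Lq_space q U V. \<forall>i. \<exists>g \<in> Lq_space q U V. has_weak_partial U i f g}"

definition sobolev_norm :: "real \<Rightarrow> (real^'m) set \<Rightarrow> (real^'m \<Rightarrow> 'v::euclidean_space) \<Rightarrow> real" where
  "sobolev_norm q U f = Lq_norm q U f + (\<Sum>i\<in>UNIV. Lq_norm q U (weak_partial U i f))"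

definition char_map ::
    "(real^'m \<Rightarrow> complex^'d::{finite,linorder}^'d::{finite,linorder})
      \<Rightarrow> real^'m \<Rightarrow> real^'d::{finite,linorder}" where
  "char_map A = eigvals_incr \<circ> A"

end

theory Submission
  imports Defs
begin

text \<open>
  The sums of the \<open>k\<close> smallest eigenvalues are concave and Lipschitz, being minima of linear
  functionals (Ky Fan), so the ordered eigenvalues are differences of convex Lipschitz functions
  \<open>f\<close> and it suffices to study \<open>A \<mapsto> f \<circ> A\<close>. Write \<open>f'(a; b)\<close> for the one-sided directional
  derivative. Convexity gives \<open>f (A (x + t e)) - f (A x) \<ge> t f'(A x; (A (x + t e) - A x) / t)\<close>, and the
  difference quotients of \<open>A\<close> converge to \<open>\<partial>A\<close> in \<open>L\<^sup>1\<close> locally; for \<open>t \<down> 0\<close> and \<open>t \<up> 0\<close> this yields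
  \<open>f'(A; \<partial>A) \<le> \<partial>(f \<circ> A) \<le> -f'(A; -\<partial>A)\<close> in the sense of distributions. Since \<open>-f'(a; -b) \<le> f'(a; b)\<close>
  always, both inequalities are equalities almost everywhere.

  Because \<open>f'\<close> is upper semicontinuous in both arguments, the identity \<open>f'(A; \<partial>A) = -f'(A; -\<partial>A)\<close>
  makes \<open>\<partial>(f \<circ> B)\<close> converge to \<open>\<partial>(f \<circ> A)\<close> almost everywhere along every sequence of \<open>B\<close> that converges to
  \<open>A\<close> sufficiently fast in the Sobolev norm, with an integrable majorant.
\<close>

section \<open>Smooth test functions\<close>

text \<open>The obstacle: \<open>A\<close> may spend positive measure among matrices with multiple
  eigenvalues, where \<open>f\<close> may have no gradient, so a chain rule through a gradient is
  meaningless there. One-sided directional derivatives exist everywhere but can jump: for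
  \<open>f a = \<bar>a\<bar>\<close> on the line, the derivative in direction \<open>b\<close> is
  \<open>b\<close> times the sign of \<open>a\<close> if \<open>a \<noteq> 0\<close>, but
  \<open>\<bar>b\<bar>\<close> at 0. Equality of the two one-sided derivatives excludes this jump,
  since at \<open>a = 0\<close> it forces \<open>b = 0\<close>. It is needed for the limit and for
  each member of the sequence: semicontinuity in direction \<open>b\<close> bounds the derivatives
  from above, in direction \<open>- b\<close> from below.

  Neither restriction to lines nor mollification occurs. Mean convergence of difference quotients is
  obtained by duality: a bound for the integrals against all test functions with values in [0, 1]
  bounds the integral of the positive part. Test functions therefore only have to approximate
  indicators of open sets, which sums and products of flat exponentials achieve.

  A failure of continuity at \<open>A\<close>, taken with \<delta> = 2^-n for every n, supplies a
  sequence of the required speed.\<close>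

definition smooth_fun :: "(real^'m \<Rightarrow> real) \<Rightarrow> bool" where
  "smooth_fun \<phi> \<longleftrightarrow> (\<forall>is x. foldr partial_deriv is \<phi> differentiable (at x))"

lemma partial_deriv_eq:
  assumes "(f has_derivative F) (at x)"
  shows "partial_deriv i f x = F (axis i 1)"
  unfolding partial_deriv_def using frechet_derivative_at[OF assms] by simp

lemma partial_deriv_const: "partial_deriv i (\<lambda>_. c) = (\<lambda>_. 0)"
  by (rule ext, subst partial_deriv_eq[where F = "\<lambda>_. 0"]) auto

text \<open>Smoothness is the largest property that implies differentiability and passes to partial
  derivatives. An invariant set of functions thus replaces formulas for iterated
  derivatives.\<close>

lemma smooth_fun_coinduct:
  assumes "\<phi> \<in> S" and diff: "\<And>f x. f \<in> S \<Longrightarrow> f differentiable (at x)"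
    and closed: "\<And>f i. f \<in> S \<Longrightarrow> partial_deriv i f \<in> S"
  shows "smooth_fun \<phi>"
proof -
  have "foldr partial_deriv is \<phi> \<in> S" for "is"
    by (induction "is") (auto simp: assms)
  then show ?thesis
    unfolding smooth_fun_def using diff by blast
qed

lemma smooth_fun_differentiable: "smooth_fun \<phi> \<Longrightarrow> \<phi> differentiable (at x)"
  unfolding smooth_fun_def by (metis foldr.simps(1) id_apply)

lemma smooth_fun_partial_deriv: "smooth_fun \<phi> \<Longrightarrow> smooth_fun (partial_deriv i \<phi>)"
  unfolding smooth_fun_def
proof (intro allI)
  fix "is" x assume *: "\<forall>is x. foldr partial_deriv is \<phi> differentiable at x"
  show "foldr partial_deriv is (partial_deriv i \<phi>) differentiable at x"
    using *[rule_format, of "is @ [i]" x] by simp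
qed

lemma smooth_fun_has_derivative:
  "smooth_fun \<phi> \<Longrightarrow> (\<phi> has_derivative frechet_derivative \<phi> (at x)) (at x)"
  using smooth_fun_differentiable frechet_derivative_works by blast

lemma smooth_fun_continuous: "smooth_fun \<phi> \<Longrightarrow> continuous_on S \<phi>"
  using smooth_fun_differentiable differentiable_imp_continuous_within
  by (metis continuous_at_imp_continuous_on)

section \<open>Flat exponentials, bump functions and cut-offs\<close>

text \<open>On the positive axis this is x^-k exp(-1/x). The power makes the family closed under
  differentiation up to linear combinations.\<close>

definition flat_exp :: "nat \<Rightarrow> real \<Rightarrow> real" where
  "flat_exp k x = (if x > 0 then exp (- inverse x) * inverse x ^ k else 0)"

text \<open>From the right, the substitution y = 1/x turns the claim into the decay of y^k exp(-y)
  at infinity.\<close>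

lemma flat_exp_tendsto_0: "(flat_exp k \<longlongrightarrow> 0) (at 0)"
proof -
  have "((\<lambda>x. exp (- inverse x) * inverse x ^ k) \<longlongrightarrow> (0::real)) (at_right 0)"
  proof -
    have "((\<lambda>y::real. exp (- y) * y ^ k) \<longlongrightarrow> 0) at_top"
      using tendsto_power_div_exp_0[of k] by (simp add: exp_minus field_simps)
    from filterlim_compose[OF this filterlim_inverse_at_top_right] show ?thesis .
  qed
  then have r: "(flat_exp k \<longlongrightarrow> 0) (at_right 0)"
    by (rule Lim_transform_eventually) (auto simp: eventually_at_right_field flat_exp_def intro: exI[of _ 1])
  have l: "(flat_exp k \<longlongrightarrow> 0) (at_left 0)"
    by (rule Lim_transform_eventually[OF tendsto_const])
       (auto simp: eventually_at_left_field flat_exp_def intro: exI[of _ "-1"])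
  show ?thesis using l r by (simp add: filterlim_at_split)
qed

lemma flat_exp_has_field_derivative:
  "(flat_exp k has_field_derivative (flat_exp (k + 2) x - real k * flat_exp (k + 1) x)) (at x)"
proof (cases "x = 0")
  case True
  \<comment> \<open>At the origin the difference quotient of \<open>flat_exp k\<close> is
    \<open>flat_exp (k + 1)\<close> itself.\<close>
  have "((\<lambda>h. (flat_exp k (0 + h) - flat_exp k 0) / h) \<longlongrightarrow> 0) (at 0)"
  proof (rule Lim_transform_eventually[OF flat_exp_tendsto_0[of "k + 1"]])
    show "\<forall>\<^sub>F h in at 0. flat_exp (k + 1) h = (flat_exp k (0 + h) - flat_exp k 0) / h"
      by (rule always_eventually) (auto simp: flat_exp_def field_simps)
  qed
  then show ?thesis
    unfolding DERIV_def using True by (simp add: flat_exp_def)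
next
  case False
  show ?thesis
  proof (cases "x > 0")
    case True
    have "((\<lambda>x. exp (- inverse x) * inverse x ^ k) has_field_derivative
       (flat_exp (k + 2) x - real k * flat_exp (k + 1) x)) (at x)"
    proof -
      have *: "((\<lambda>x. exp (- inverse x) * inverse x ^ k) has_field_derivative
       (exp (- inverse x) * (inverse x)^2 * inverse x ^ k
          + exp (- inverse x) * (real k * inverse x ^ (k - 1) * (- (inverse x ^ 2))))) (at x)"
        using True by (auto intro!: derivative_eq_intros simp: power2_eq_square)
      \<comment> \<open>For \<open>k = 0\<close> the truncated exponent \<open>k - 1\<close> does no
        harm, because the factor \<open>real k\<close> vanishes.\<close>
      have "real k * inverse x ^ (k - 1) * inverse x ^ 2 = real k * inverse x ^ (k + 1)"
        by (cases k) (simp_all add: power2_eq_square)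
      then have "exp (- inverse x) * (inverse x)^2 * inverse x ^ k
          + exp (- inverse x) * (real k * inverse x ^ (k - 1) * (- (inverse x ^ 2))) =
          flat_exp (k + 2) x - real k * flat_exp (k + 1) x"
        using True by (cases k) (simp_all add: flat_exp_def power_add power2_eq_square algebra_simps)
      with * show ?thesis by simp
    qed
    then show ?thesis
      by (rule DERIV_cong_ev[THEN iffD1, rotated 3])
         (use True eventually_nhds_in_open[of "{0<..}" x] in \<open>auto simp: flat_exp_def elim!: eventually_mono\<close>)
  next
    case neg: False
    have "((\<lambda>_. 0) has_field_derivative 0) (at x)" by simp
    then show ?thesis
      by (rule DERIV_cong_ev[THEN iffD1, rotated 3])
         (use neg False eventually_nhds_in_open[of "{..<0}" x] in \<open>auto simp: flat_exp_def elim!: eventually_mono\<close>)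
  qed
qed

text \<open>All smooth functions are generators. Once the algebra is known to be closed under
  partial derivatives, coinduction shows that it contains only smooth functions, so its closure
  under sums and products becomes a fact about \<open>smooth_fun\<close>; the flat clause
  contributes the bumps.\<close>

inductive_set smooth_algebra :: "(real^'m \<Rightarrow> real) set" where
  base: "smooth_fun f \<Longrightarrow> f \<in> smooth_algebra"
| const: "(\<lambda>x. c) \<in> smooth_algebra"
| flat: "(\<lambda>x. flat_exp k (c * x $ i + d)) \<in> smooth_algebra"
| add: "f \<in> smooth_algebra \<Longrightarrow> g \<in> smooth_algebra \<Longrightarrow> (\<lambda>x. f x + g x) \<in> smooth_algebra"
| mult: "f \<in> smooth_algebra \<Longrightarrow> g \<in> smooth_algebra \<Longrightarrow> (\<lambda>x. f x * g x) \<in> smooth_algebra"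

lemma smooth_algebra_derivative:
  fixes f :: "real^'m \<Rightarrow> real"
  assumes "f \<in> smooth_algebra"
  shows "(\<forall>x. f differentiable (at x)) \<and> (\<forall>j. partial_deriv j f \<in> smooth_algebra)"
  using assms
proof induction
  case (base f)
  then show ?case
    using smooth_fun_differentiable smooth_fun_partial_deriv smooth_algebra.base by blast
next
  case (const c)
  show ?case by (auto simp: partial_deriv_const intro: smooth_algebra.const)
next
  case (flat k c i d)
  have *: "((\<lambda>x. flat_exp k (c * x $ i + d)) has_derivative
     (\<lambda>h. (flat_exp (k + 2) (c * x $ i + d) - real k * flat_exp (k + 1) (c * x $ i + d)) * (c * h $ i)))
     (at x)" for x :: "real^'m"
  proof -
    have "((\<lambda>x. c * x $ i + d) has_derivative (\<lambda>h. c * h $ i)) (at x)"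
      by (auto intro!: derivative_eq_intros bounded_linear_imp_has_derivative bounded_linear_vec_nth)
    from has_derivative_compose[OF this flat_exp_has_field_derivative[of k, unfolded has_field_derivative_def]]
    show ?thesis by simp
  qed
  have "partial_deriv j (\<lambda>x. flat_exp k (c * x $ i + d)) =
    (\<lambda>x. (flat_exp (k + 2) (c * x $ i + d) + (- real k) * flat_exp (k + 1) (c * x $ i + d)) * (c * axis j 1 $ i))" for j
    by (rule ext, subst partial_deriv_eq[OF *]) simp
  moreover have "(\<lambda>x::real^'m. (flat_exp (k + 2) (c * x $ i + d) + (- real k) * flat_exp (k + 1) (c * x $ i + d)) * (c * axis j 1 $ i))
      \<in> smooth_algebra" for j
    by (intro smooth_algebra.intros)
  ultimately show ?case using * by (auto simp: differentiable_def)
next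
  case (add f g)
  have *: "((\<lambda>x. f x + g x) has_derivative
      (\<lambda>h. frechet_derivative f (at x) h + frechet_derivative g (at x) h)) (at x)" for x
    using add frechet_derivative_works by (intro has_derivative_add) blast+
  have "partial_deriv j (\<lambda>x. f x + g x) = (\<lambda>x. partial_deriv j f x + partial_deriv j g x)" for j
    by (rule ext, subst partial_deriv_eq[OF *]) (simp add: partial_deriv_def)
  then show ?case using * add by (auto simp: differentiable_def intro: smooth_algebra.add)
next
  case (mult f g)
  have *: "((\<lambda>x. f x * g x) has_derivative
      (\<lambda>h. f x * frechet_derivative g (at x) h + frechet_derivative f (at x) h * g x)) (at x)" for x
    using mult frechet_derivative_works by (intro has_derivative_mult) blast+
  have "partial_deriv j (\<lambda>x. f x * g x) = (\<lambda>x. f x * partial_deriv j g x + partial_deriv j f x * g x)" for j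
    by (rule ext, subst partial_deriv_eq[OF *]) (simp add: partial_deriv_def)
  moreover have "(\<lambda>x. f x * partial_deriv j g x + partial_deriv j f x * g x) \<in> smooth_algebra" for j
    using mult by (intro smooth_algebra.add smooth_algebra.mult) auto
  ultimately show ?case using * by (auto simp: differentiable_def)
qed

lemma smooth_fun_iff_smooth_algebra: "smooth_fun f \<longleftrightarrow> f \<in> smooth_algebra"
  using smooth_algebra_derivative smooth_algebra.base smooth_fun_coinduct[of f smooth_algebra] by blast

lemma smooth_fun_const: "smooth_fun (\<lambda>x. c)"
  and smooth_fun_flat_exp: "smooth_fun (\<lambda>x. flat_exp k (c * x $ i + d))"
  and smooth_fun_add: "smooth_fun f \<Longrightarrow> smooth_fun g \<Longrightarrow> smooth_fun (\<lambda>x. f x + g x)"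
  and smooth_fun_mult: "smooth_fun f \<Longrightarrow> smooth_fun g \<Longrightarrow> smooth_fun (\<lambda>x. f x * g x)"
  by (auto simp: smooth_fun_iff_smooth_algebra intro: smooth_algebra.intros)

lemma smooth_fun_diff: "smooth_fun f \<Longrightarrow> smooth_fun g \<Longrightarrow> smooth_fun (\<lambda>x. f x - g x)"
  using smooth_fun_add[of f "\<lambda>x. -1 * g x"] smooth_fun_mult[OF smooth_fun_const, of g "-1"] by simp

lemma smooth_fun_prod:
  "(\<And>i. i \<in> I \<Longrightarrow> smooth_fun (f i)) \<Longrightarrow> smooth_fun (\<lambda>x. \<Prod>i\<in>I. f i x)"
  by (induction I rule: infinite_finite_induct) (auto intro: smooth_fun_const smooth_fun_mult)

lemma partial_deriv_translate:
  assumes "f differentiable (at (x - v))"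
  shows "((\<lambda>x. f (x - v)) has_derivative frechet_derivative f (at (x - v))) (at x)"
    and "partial_deriv i (\<lambda>x. f (x - v)) x = partial_deriv i f (x - v)"
proof -
  have "(f has_derivative frechet_derivative f (at (x - v))) (at (x - v))"
    using assms frechet_derivative_works by blast
  moreover have "((\<lambda>x. x - v) has_derivative (\<lambda>h. h)) (at x)"
    by (auto intro!: derivative_eq_intros)
  ultimately show *: "((\<lambda>x. f (x - v)) has_derivative frechet_derivative f (at (x - v))) (at x)"
    using has_derivative_compose[of "\<lambda>x. x - v" "\<lambda>h. h" x UNIV f] by simp
  show "partial_deriv i (\<lambda>x. f (x - v)) x = partial_deriv i f (x - v)"
    by (subst partial_deriv_eq[OF *]) (simp add: partial_deriv_def)
qed

lemma smooth_fun_translate: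
  assumes "smooth_fun f"
  shows "smooth_fun (\<lambda>x. f (x - v))"
proof (rule smooth_fun_coinduct[where S = "{\<lambda>x. g (x - v) | g. smooth_fun g}"])
  show "(\<lambda>x. f (x - v)) \<in> {\<lambda>x. g (x - v) | g. smooth_fun g}" using assms by blast
next
  fix f x assume "f \<in> {\<lambda>x. g (x - v) | g. smooth_fun g}"
  then obtain g where g: "f = (\<lambda>x. g (x - v))" "smooth_fun g" by blast
  then show "f differentiable (at x)"
    using partial_deriv_translate(1)[OF smooth_fun_differentiable[OF g(2)]] differentiableI by blast
next
  fix f i assume "f \<in> {\<lambda>x. g (x - v) | g. smooth_fun g}"
  then obtain g where g: "f = (\<lambda>x. g (x - v))" "smooth_fun g" by blast
  then have "partial_deriv i f = (\<lambda>x. partial_deriv i g (x - v))"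
    using partial_deriv_translate(2) smooth_fun_differentiable by blast
  then show "partial_deriv i f \<in> {\<lambda>x. g (x - v) | g. smooth_fun g}"
    using smooth_fun_partial_deriv g(2) by blast
qed

text \<open>Any compact set outside which \<open>\<phi>\<close> vanishes can replace the closed
  support, which is easier to supply for sums, translates and derivatives.\<close>

lemma test_functions_iff:
  "\<phi> \<in> test_functions U \<longleftrightarrow> smooth_fun \<phi> \<and> (\<exists>K. compact K \<and> K \<subseteq> U \<and> (\<forall>x. x \<notin> K \<longrightarrow> \<phi> x = 0))"
proof
  assume "\<phi> \<in> test_functions U"
  then show "smooth_fun \<phi> \<and> (\<exists>K. compact K \<and> K \<subseteq> U \<and> (\<forall>x. x \<notin> K \<longrightarrow> \<phi> x = 0))"
    unfolding test_functions_def smooth_fun_def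
    using closure_subset[of "{x. \<phi> x \<noteq> 0}"]
    by (intro conjI exI[of _ "closure {x. \<phi> x \<noteq> 0}"]) auto
next
  assume "smooth_fun \<phi> \<and> (\<exists>K. compact K \<and> K \<subseteq> U \<and> (\<forall>x. x \<notin> K \<longrightarrow> \<phi> x = 0))"
  then obtain K where K: "smooth_fun \<phi>" "compact K" "K \<subseteq> U" "\<And>x. x \<notin> K \<Longrightarrow> \<phi> x = 0" by blast
  then have "closure {x. \<phi> x \<noteq> 0} \<subseteq> K"
    by (intro closure_minimal) (auto intro: compact_imp_closed)
  then show "\<phi> \<in> test_functions U"
    using K unfolding test_functions_def smooth_fun_def
    by (auto dest: compact_Int_closed[OF _ closed_closure, of K "{x. \<phi> x \<noteq> 0}"] simp: Int_absorb1)
qed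

lemma test_functions_mono: "U \<subseteq> V \<Longrightarrow> test_functions U \<subseteq> test_functions V"
  unfolding test_functions_def by auto

lemma test_functions_lincomb:
  assumes "\<phi> \<in> test_functions U" "\<psi> \<in> test_functions U"
  shows "(\<lambda>x. \<phi> x + c * \<psi> x) \<in> test_functions U"
proof -
  obtain K L where *: "smooth_fun \<phi>" "compact K" "K \<subseteq> U" "\<And>x. x \<notin> K \<Longrightarrow> \<phi> x = 0"
    "smooth_fun \<psi>" "compact L" "L \<subseteq> U" "\<And>x. x \<notin> L \<Longrightarrow> \<psi> x = 0"
    using assms unfolding test_functions_iff by blast
  then show ?thesis unfolding test_functions_iff
    by (intro conjI smooth_fun_add smooth_fun_mult[OF smooth_fun_const] exI[of _ "K \<union> L"]) auto
qed

lemma partial_deriv_lincomb: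
  assumes "smooth_fun \<phi>" "smooth_fun \<psi>"
  shows "partial_deriv i (\<lambda>x. \<phi> x + c * \<psi> x) x = partial_deriv i \<phi> x + c * partial_deriv i \<psi> x"
proof -
  have "((\<lambda>x. \<phi> x + c * \<psi> x) has_derivative
     (\<lambda>h. frechet_derivative \<phi> (at x) h + c * frechet_derivative \<psi> (at x) h)) (at x)"
    by (intro has_derivative_add has_derivative_mult_right smooth_fun_has_derivative assms)
  from partial_deriv_eq[OF this] show ?thesis by (simp add: partial_deriv_def)
qed

lemma test_functions_translate:
  assumes "\<phi> \<in> test_functions V" "\<And>x. x \<in> V \<Longrightarrow> x + v \<in> U"
  shows "(\<lambda>x. \<phi> (x - v)) \<in> test_functions U"
proof -
  obtain K where K: "smooth_fun \<phi>" "compact K" "K \<subseteq> V" "\<And>x. x \<notin> K \<Longrightarrow> \<phi> x = 0"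
    using assms unfolding test_functions_iff by blast
  have "compact ((+) v ` K)" "(+) v ` K \<subseteq> U"
    using compact_translation[OF K(2), of v] K(3) assms(2) by (auto simp: add.commute[of v])
  moreover have "\<phi> (x - v) = 0" if "x \<notin> (+) v ` K" for x
    using that K(4)[of "x - v"] by (force simp: image_iff)
  ultimately show ?thesis unfolding test_functions_iff
    using smooth_fun_translate K(1) by blast
qed

lemma test_functions_partial_deriv:
  assumes "\<phi> \<in> test_functions U"
  shows "partial_deriv i \<phi> \<in> test_functions U"
proof -
  obtain K where K: "smooth_fun \<phi>" "compact K" "K \<subseteq> U" "\<And>x. x \<notin> K \<Longrightarrow> \<phi> x = 0"
    using assms unfolding test_functions_iff by blast
  have "partial_deriv i \<phi> x = 0" if "x \<notin> K" for x
  proof -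
    have "((\<lambda>_. 0) has_derivative (\<lambda>_. 0)) (at x)" by simp
    then have "(\<phi> has_derivative (\<lambda>_. 0)) (at x)"
      by (rule has_derivative_transform_within_open[where s = "- K"])
         (use K that in \<open>auto simp: compact_imp_closed\<close>)
    from partial_deriv_eq[OF this] show ?thesis .
  qed
  then show ?thesis unfolding test_functions_iff
    using smooth_fun_partial_deriv K by blast
qed

lemma test_functions_bounded:
  assumes "\<phi> \<in> test_functions U"
  obtains M where "M > 0" "\<And>x. \<bar>\<phi> x\<bar> \<le> M"
proof -
  obtain K where K: "smooth_fun \<phi>" "compact K" "\<And>x. x \<notin> K \<Longrightarrow> \<phi> x = 0"
    using assms unfolding test_functions_iff by blast
  then have "bounded (\<phi> ` K)"
    by (intro compact_imp_bounded compact_continuous_image smooth_fun_continuous)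
  then obtain M where "M > 0" "\<And>x. x \<in> K \<Longrightarrow> \<bar>\<phi> x\<bar> \<le> M"
    unfolding bounded_pos by auto
  with K(3) that show thesis by (metis abs_zero less_imp_le)
qed

lemma test_functions_measurable:
  "\<phi> \<in> test_functions U \<Longrightarrow> \<phi> \<in> borel_measurable borel"
  unfolding test_functions_iff using borel_measurable_continuous_onI smooth_fun_continuous by blast

text \<open>Each face of the box contributes \<open>flat_exp 0\<close> of the signed distance to it,
  a factor that is positive exactly on the inner side.\<close>

lemma smooth_fun_box_bump:
  fixes a b :: "real^'m"
  obtains \<psi> where "smooth_fun \<psi>" "\<And>x. 0 \<le> \<psi> x" "\<And>x. \<psi> x \<le> 1" "\<And>x. \<psi> x > 0 \<longleftrightarrow> x \<in> box a b"
proof -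
  define \<psi> where "\<psi> x = (\<Prod>i\<in>UNIV. flat_exp 0 (1 * x $ i + - a $ i) * flat_exp 0 (-1 * x $ i + b $ i))"
    for x :: "real^'m"
  have nn: "0 \<le> flat_exp 0 t" and le1: "flat_exp 0 t \<le> 1" and pos: "flat_exp 0 t > 0 \<longleftrightarrow> t > 0" for t
    by (auto simp: flat_exp_def)
  show thesis
  proof
    show "smooth_fun \<psi>" unfolding \<psi>_def
      by (intro smooth_fun_prod smooth_fun_mult smooth_fun_flat_exp)
    show "0 \<le> \<psi> x" "\<psi> x \<le> 1" for x
      unfolding \<psi>_def by (auto intro!: prod_nonneg prod_le_1 mult_le_one simp: nn le1)
    show "\<psi> x > 0 \<longleftrightarrow> x \<in> box a b" for x
    proof
      assume "x \<in> box a b"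
      then show "\<psi> x > 0" unfolding \<psi>_def
        by (intro prod_pos) (auto simp: pos mem_box_cart)
    next
      assume *: "\<psi> x > 0"
      show "x \<in> box a b" unfolding mem_box_cart
      proof (intro allI)
        fix i
        have "flat_exp 0 (1 * x $ i + - a $ i) * flat_exp 0 (-1 * x $ i + b $ i) \<noteq> 0"
          using * unfolding \<psi>_def by (metis (no_types, lifting) UNIV_I finite less_irrefl prod_zero)
        then show "a $ i < x $ i \<and> x $ i < b $ i"
          using nn pos by (smt (verit) mult_eq_0_iff)
      qed
    qed
  qed
qed

text \<open>Finitely many boxes cover \<open>K\<close>; the product \<open>P\<close> of the
  complements 1 - \<psi> is 1 off the closed boxes and less than 1 on \<open>K\<close>, so 1 - P^n
  is the cut-off for large \<open>n\<close>. Being near 1 instead of equal to 1 spares a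
  division.\<close>

lemma test_function_near_1_on_compact:
  fixes K U :: "(real^'m) set"
  assumes "compact K" "open U" "K \<subseteq> U" "e > 0"
  obtains \<phi> where "\<phi> \<in> test_functions U" "\<And>x. 0 \<le> \<phi> x" "\<And>x. \<phi> x \<le> 1" "\<And>x. x \<in> K \<Longrightarrow> 1 - e \<le> \<phi> x"
proof -
  have "\<exists>a b. x \<in> box a b \<and> cbox a b \<subseteq> U" if xK: "x \<in> K" for x
  proof -
    obtain r where r: "r > 0" "cball x r \<subseteq> U"
      using xK assms(2,3) unfolding open_contains_cball by (meson subsetD)
    obtain a b where ab: "x \<in> box a b" "box a b \<subseteq> ball x r"
      using rational_boxes[OF r(1), of x] by blast
    then have "closure (box a b) = cbox a b" by (intro closure_box) auto
    then have "cbox a b \<subseteq> cball x r"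
      using closure_mono[OF ab(2)] r(1) by (simp add: closure_ball)
    with r(2) ab(1) show ?thesis by blast
  qed
  then obtain a b where ab: "\<And>x. x \<in> K \<Longrightarrow> x \<in> box (a x) (b x) \<and> cbox (a x) (b x) \<subseteq> U"
    by metis
  obtain D where D: "D \<subseteq> K" "finite D" "K \<subseteq> (\<Union>x\<in>D. box (a x) (b x))"
    by (rule compactE_image[OF assms(1), of K "\<lambda>x. box (a x) (b x)"]) (use ab in auto)
  obtain \<psi> where \<psi>: "\<And>d. smooth_fun (\<psi> d)" "\<And>d x. 0 \<le> \<psi> d x" "\<And>d x. \<psi> d x \<le> 1"
      "\<And>d x. \<psi> d x > 0 \<longleftrightarrow> x \<in> box (a d) (b d)"
  proof -
    have "\<forall>d. \<exists>\<psi>. smooth_fun \<psi> \<and> (\<forall>x. 0 \<le> \<psi> x \<and> \<psi> x \<le> 1 \<and> (\<psi> x > 0 \<longleftrightarrow> x \<in> box (a d) (b d)))"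
      by (meson smooth_fun_box_bump)
    then show thesis using that by metis
  qed
  define P where "P x = (\<Prod>d\<in>D. 1 - \<psi> d x)" for x
  have P: "smooth_fun P" "0 \<le> P x" "P x \<le> 1" for x
    unfolding P_def using \<psi> by (auto intro!: smooth_fun_prod smooth_fun_diff smooth_fun_const prod_nonneg prod_le_1)
  have P1: "P x = 1" if "x \<notin> (\<Union>d\<in>D. cbox (a d) (b d))" for x
    unfolding P_def
  proof (rule prod.neutral, intro ballI)
    fix d assume "d \<in> D"
    then have "x \<notin> box (a d) (b d)" using that box_subset_cbox by fastforce
    then show "1 - \<psi> d x = 1" using \<psi>(2,4)[of d x] by auto
  qed
  \<comment> \<open>The maximum of \<open>P\<close> on the compact set is attained, hence less than
    1, and its powers control \<open>P\<close> uniformly.\<close>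
  have "\<exists>n. \<forall>x\<in>K. P x ^ n \<le> e"
  proof (cases "K = {}")
    case False
    obtain z where z: "z \<in> K" "\<And>x. x \<in> K \<Longrightarrow> P x \<le> P z"
      using continuous_attains_sup[OF assms(1) False smooth_fun_continuous[OF P(1)]] by blast
    obtain d where d: "d \<in> D" "z \<in> box (a d) (b d)" using z D(3) by blast
    have "P z = (1 - \<psi> d z) * (\<Prod>d\<in>D - {d}. 1 - \<psi> d z)"
      unfolding P_def using d D by (simp add: prod.remove)
    also have "\<dots> \<le> (1 - \<psi> d z) * 1"
      using \<psi> by (intro mult_left_mono prod_le_1) auto
    also have "\<dots> < 1" using \<psi>(4) d by auto
    finally obtain n where "P z ^ n < e"
      using real_arch_pow_inv assms(4) by blast
    then show ?thesis using z P by (meson dual_order.trans less_imp_le power_mono)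
  qed auto
  then obtain n where n: "\<And>x. x \<in> K \<Longrightarrow> P x ^ n \<le> e" by blast
  show thesis
  proof
    have "smooth_fun (\<lambda>x. 1 - (\<Prod>i<n. P x))"
      by (intro smooth_fun_diff smooth_fun_const smooth_fun_prod P)
    then show "(\<lambda>x. 1 - P x ^ n) \<in> test_functions U"
      unfolding test_functions_iff
      by (intro conjI exI[of _ "\<Union>d\<in>D. cbox (a d) (b d)"]) (use D ab P1 in \<open>auto intro!: compact_UN\<close>)
    show "0 \<le> 1 - P x ^ n" "1 - P x ^ n \<le> 1" for x using P by (auto simp: power_le_one)
    show "1 - e \<le> 1 - P x ^ n" if "x \<in> K" for x using n that by simp
  qed
qed

section \<open>Continuity of translations in the mean and duality with test functions\<close>

lemma lborel_integral_translate:
  fixes f :: "'n::euclidean_space \<Rightarrow> 'v::{banach, second_countable_topology}"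
  shows "(LINT x|lborel. f (x + v)) = (LINT x|lborel. f x)"
    and "integrable lborel (\<lambda>x. f (x + v)) \<longleftrightarrow> integrable lborel f"
proof -
  show **: "integrable lborel (\<lambda>x. f (x + v)) \<longleftrightarrow> integrable lborel f"
  proof -
    have *: "integrable lborel (\<lambda>x. g (x + w))" if "integrable lborel g" for g :: "'n \<Rightarrow> 'v" and w
    proof -
      have "integrable (distr lborel borel ((+) w)) g"
        using that by (simp add: lborel_distr_plus)
      then show ?thesis
        by (subst (asm) integrable_distr_eq) (use that in \<open>auto simp: add.commute\<close>)
    qed
    show ?thesis using *[of f v] *[of "\<lambda>x. f (x + v)" "- v"] by auto
  qed
  show "(LINT x|lborel. f (x + v)) = (LINT x|lborel. f x)"
  proof (cases "integrable lborel f")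
    case True
    then have "integral\<^sup>L (distr lborel borel ((+) v)) f = (LINT x|lborel. f (v + x))"
      by (intro integral_distr) auto
    then show ?thesis by (simp add: lborel_distr_plus add.commute)
  next
    case False
    with ** show ?thesis by (simp add: not_integrable_integral_eq)
  qed
qed

text \<open>Outer regularity replaces \<open>A\<close> by an open set \<open>G\<close>. For open
  \<open>G\<close>, a point of \<open>G\<close> remains in \<open>G\<close> under small
  translations, so the overlap of \<open>G\<close> with its translate fills \<open>G\<close> by
  dominated convergence.\<close>

lemma indicator_L1_translation:
  fixes A :: "'n::euclidean_space set"
  assumes A: "A \<in> sets borel" "emeasure lborel A < \<infinity>" and s: "s \<longlonglongrightarrow> 0"
  shows "(\<lambda>n. LINT x|lborel. \<bar>indicator A (x + s n) - indicator A x :: real\<bar>) \<longlonglongrightarrow> 0"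
proof (rule LIMSEQ_I)
  fix r :: real assume "r > 0"
  obtain G where G: "open G" "A \<subseteq> G" "emeasure lborel (G - A) < ennreal (r / 4)"
    using outer_regular_lborel[OF A(1), of "r / 4"] \<open>r > 0\<close> by auto
  have Gm: "emeasure lborel (G - A) < \<infinity>"
    using G(3) less_top order.strict_trans by fastforce
  have "emeasure lborel G = emeasure lborel A + emeasure lborel (G - A)"
    using A G by (subst plus_emeasure) (auto simp: Un_absorb1)
  then have Gf: "emeasure lborel G < \<infinity>" using A(2) Gm by (simp add: ennreal_add_eq_top less_top)
  have iA: "integrable lborel (indicator A :: _ \<Rightarrow> real)" using A by simp
  have iG: "integrable lborel (indicator G :: _ \<Rightarrow> real)" using G Gf by simp
  have trA: "integrable lborel (\<lambda>x. indicator A (x + w) :: real)"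
    and trG: "integrable lborel (\<lambda>x. indicator G (x + w) :: real)" for w
    using lborel_integral_translate(2)[of "indicator A :: _ \<Rightarrow> real" w]
      lborel_integral_translate(2)[of "indicator G :: _ \<Rightarrow> real" w] iA iG by auto
  have GA: "(LINT x|lborel. (indicator G x - indicator A x :: real)) < r / 4"
  proof -
    have "(LINT x|lborel. (indicator G x - indicator A x :: real)) = (LINT x|lborel. indicator (G - A) x)"
      using G(2) by (intro Bochner_Integration.integral_cong) (auto simp: indicator_def)
    also have "\<dots> = measure lborel (G - A)" by simp
    also have "\<dots> < r / 4" unfolding measure_def
      using G(3) Gm \<open>r > 0\<close> by (metis ennreal_enn2real enn2real_nonneg ennreal_less_iff infinity_ennreal_def)
    finally show ?thesis .
  qed
  have GG: "(\<lambda>n. LINT x|lborel. indicator G x * indicator G (x + s n) :: real) \<longlonglongrightarrow>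
      (LINT x|lborel. indicator G x)"
  proof (rule integral_dominated_convergence[where w = "indicator G"])
    show "AE x in lborel. (\<lambda>n. indicator G x * indicator G (x + s n) :: real) \<longlonglongrightarrow> indicator G x"
    proof (intro AE_I2)
      fix x :: 'n
      have "(\<lambda>n. x + s n) \<longlonglongrightarrow> x + 0" by (intro tendsto_intros s)
      then have *: "(\<lambda>n. x + s n) \<longlonglongrightarrow> x" by simp
      show "(\<lambda>n. indicator G x * indicator G (x + s n) :: real) \<longlonglongrightarrow> indicator G x"
      proof (cases "x \<in> G")
        case True
        then have "\<forall>\<^sub>F n in sequentially. x + s n \<in> G"
          using * G(1) topological_tendstoD by blast
        then have "\<forall>\<^sub>F n in sequentially. indicator G x * indicator G (x + s n) = (indicator G x :: real)"
          by eventually_elim (use True in auto)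
        then show ?thesis by (rule tendsto_eventually)
      qed auto
    qed
    show "(\<lambda>x. indicator G x * indicator G (x + s n) :: real) \<in> borel_measurable lborel" for n
      using iG trG[of "s n"] by (intro borel_measurable_times) auto
    show "AE x in lborel. norm (indicator G x * indicator G (x + s n) :: real) \<le> indicator G x" for n
      by (auto simp: indicator_def)
  qed (use iG G in auto)
  have iGG: "integrable lborel (\<lambda>x. indicator G x * indicator G (x + w) :: real)" for w
    by (rule Bochner_Integration.integrable_bound[OF iG])
       (use iG trG[of w] in \<open>auto intro!: borel_measurable_times AE_I2 simp: mult_le_one split: split_indicator\<close>)
  obtain N where N: "\<And>n. n \<ge> N \<Longrightarrow>
      \<bar>(LINT x|lborel. indicator G x * indicator G (x + s n)) - (LINT x|lborel. indicator G x)\<bar> < r / 4"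
    using LIMSEQ_D[OF GG, of "r / 4"] \<open>r > 0\<close> by auto
  have "\<bar>LINT x|lborel. \<bar>indicator A (x + s n) - indicator A x :: real\<bar>\<bar> < r" if "n \<ge> N" for n
  proof -
    \<comment> \<open>The first two brackets are the cost of replacing \<open>A\<close> by
      \<open>G\<close>; the third is the absolute difference of the indicators of \<open>G\<close>,
      written through their product. Each of them contributes at most two quarters of
      \<open>r\<close> after translation invariance is applied.\<close>
    have "(LINT x|lborel. \<bar>indicator A (x + s n) - indicator A x :: real\<bar>) \<le>
       (LINT x|lborel. (indicator G (x + s n) - indicator A (x + s n)) + (indicator G x - indicator A x)
          + (indicator G (x + s n) + indicator G x - 2 * (indicator G x * indicator G (x + s n))))"
      using G(2) trA trG iGG iA iG
      by (intro integral_mono Bochner_Integration.integrable_add Bochner_Integration.integrable_diff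
            integrable_abs integrable_mult_right) (auto split: split_indicator)
    also have "\<dots> = (LINT x|lborel. (indicator G (x + s n) - indicator A (x + s n)))
          + (LINT x|lborel. indicator G x - indicator A x)
          + ((LINT x|lborel. indicator G (x + s n)) + (LINT x|lborel. indicator G x)
              - 2 * (LINT x|lborel. indicator G x * indicator G (x + s n)))"
      using trA trG iGG iA iG by simp
    also have "\<dots> = 2 * (LINT x|lborel. indicator G x - indicator A x)
          + 2 * ((LINT x|lborel. indicator G x) - (LINT x|lborel. indicator G x * indicator G (x + s n)))"
      using lborel_integral_translate(1)[of "\<lambda>x. indicator G x - indicator A x :: real" "s n"]
        lborel_integral_translate(1)[of "\<lambda>x. indicator G x :: real" "s n"] by simp
    also have "\<dots> < r"
    proof -
      have "(LINT x|lborel. indicator G x) - (LINT x|lborel. indicator G x * indicator G (x + s n)) < r / 4"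
        using N[OF that] by (simp only: abs_less_iff) linarith
      moreover have "2 * a + 2 * b < r" if "a < r / 4" "b < r / 4" for a b
        using that by linarith
      ultimately show ?thesis using GA by blast
    qed
    finally have "(LINT x|lborel. \<bar>indicator A (x + s n) - indicator A x :: real\<bar>) < r" .
    moreover have "(LINT x|lborel. \<bar>indicator A (x + s n) - indicator A x :: real\<bar>) \<ge> 0"
      by (intro integral_nonneg_AE) auto
    ultimately show ?thesis by linarith
  qed
  then show "\<exists>no. \<forall>n\<ge>no. norm ((LINT x|lborel. \<bar>indicator A (x + s n) - indicator A x :: real\<bar>) - 0) < r"
    by auto
qed

text \<open>Multiples of indicators have the property, and it survives sums and limits in the mean;
  translation invariance makes the approximation error of the translate equal to that of the
  function.\<close>

lemma L1_translation_continuous: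
  fixes f :: "'n::euclidean_space \<Rightarrow> 'v::{banach, second_countable_topology}"
  assumes "integrable lborel f" and s: "s \<longlonglongrightarrow> 0"
  shows "(\<lambda>n. LINT x|lborel. norm (f (x + s n) - f x)) \<longlonglongrightarrow> 0"
  using assms(1)
proof (induction rule: integrable_induct)
  case (base A c)
  have "(\<lambda>n. (LINT x|lborel. \<bar>indicator A (x + s n) - indicator A x :: real\<bar>) * norm c) \<longlonglongrightarrow> 0 * norm c"
    using base by (intro tendsto_mult indicator_L1_translation s tendsto_const) auto
  moreover have "norm (indicator A (x + s n) *\<^sub>R c - indicator A x *\<^sub>R c) =
      \<bar>indicator A (x + s n) - indicator A x :: real\<bar> * norm c" for x n
    by (metis norm_scaleR scaleR_left_diff_distrib)
  ultimately show ?case by simp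
next
  case (add f g)
  have tr: "integrable lborel (\<lambda>x. f (x + w))" "integrable lborel (\<lambda>x. g (x + w))" for w
    using add lborel_integral_translate(2) by blast+
  show ?case
  proof (rule tendsto_sandwich[OF _ _ tendsto_const])
    show "(\<lambda>n. (LINT x|lborel. norm (f (x + s n) - f x)) + (LINT x|lborel. norm (g (x + s n) - g x))) \<longlonglongrightarrow> 0"
      using tendsto_add[OF add.IH] by simp
    show "\<forall>\<^sub>F n in sequentially. (LINT x|lborel. norm (f (x + s n) + g (x + s n) - (f x + g x))) \<le>
        (LINT x|lborel. norm (f (x + s n) - f x)) + (LINT x|lborel. norm (g (x + s n) - g x))"
    proof (intro always_eventually allI)
      fix n
      have "(LINT x|lborel. norm (f (x + s n) + g (x + s n) - (f x + g x))) \<le>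
        (LINT x|lborel. norm (f (x + s n) - f x) + norm (g (x + s n) - g x))"
        using tr add by (intro integral_mono) (auto intro: norm_diff_triangle_ineq)
      then show "(LINT x|lborel. norm (f (x + s n) + g (x + s n) - (f x + g x))) \<le>
        (LINT x|lborel. norm (f (x + s n) - f x)) + (LINT x|lborel. norm (g (x + s n) - g x))"
        using tr add by simp
    qed
  qed (auto intro!: always_eventually integral_nonneg_AE)
next
  case (lim f h)
  have tr: "integrable lborel (\<lambda>x. f (x + w))" "integrable lborel (\<lambda>x. h i (x + w))" for w i
    using lim.hyps lborel_integral_translate(2) by blast+
  \<comment> \<open>The approximants satisfy \<bar>h i\<bar> \<le> 2 \<bar>f\<bar>, which gives the
    majorant 3 \<bar>f\<bar>.\<close>
  have "(\<lambda>i. LINT x|lborel. norm (h i x - f x)) \<longlonglongrightarrow> (LINT x|(lborel :: 'n measure). (0::real))"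
  proof (rule integral_dominated_convergence[where w = "\<lambda>x. 3 * norm (f x)"])
    show "AE x in lborel. (\<lambda>i. norm (h i x - f x)) \<longlonglongrightarrow> 0"
      using lim.hyps(2) by (auto simp: tendsto_norm_zero LIM_zero)
    show "AE x in lborel. norm (norm (h i x - f x)) \<le> 3 * norm (f x)" for i
    proof (intro AE_I2)
      fix x
      show "norm (norm (h i x - f x)) \<le> 3 * norm (f x)"
        using lim.hyps(3)[of x i] norm_triangle_ineq4[of "h i x" "f x"] by simp
    qed
    show "(\<lambda>x. norm (h i x - f x)) \<in> borel_measurable lborel" for i
      using lim.hyps(1,4) by (auto dest!: borel_measurable_integrable)
  qed (use lim.hyps in auto)
  then have conv: "(\<lambda>i. LINT x|lborel. norm (h i x - f x)) \<longlonglongrightarrow> 0" by simp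
  show ?case
  proof (rule LIMSEQ_I)
    fix r :: real assume "r > 0"
    then obtain i where "norm ((LINT x|lborel. norm (h i x - f x)) - 0) < r / 3"
      using LIMSEQ_D[OF conv, of "r / 3"] by auto
    then have i: "(LINT x|lborel. norm (h i x - f x)) < r / 3" by simp
    obtain N where N: "\<And>n. n \<ge> N \<Longrightarrow> norm ((LINT x|lborel. norm (h i (x + s n) - h i x)) - 0) < r / 3"
      using LIMSEQ_D[OF lim.IH[of i], of "r / 3"] \<open>r > 0\<close> by auto
    have "(LINT x|lborel. norm (f (x + s n) - f x)) < r" if "n \<ge> N" for n
    proof -
      have "(LINT x|lborel. norm (f (x + s n) - f x)) \<le>
        (LINT x|lborel. norm (h i (x + s n) - f (x + s n)) + norm (h i (x + s n) - h i x) + norm (h i x - f x))"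
        using tr lim.hyps
      proof (intro integral_mono)
        fix x show "norm (f (x + s n) - f x) \<le>
          norm (h i (x + s n) - f (x + s n)) + norm (h i (x + s n) - h i x) + norm (h i x - f x)"
          by norm
      qed auto
      also have "\<dots> = (LINT x|lborel. norm (h i (x + s n) - f (x + s n)))
          + (LINT x|lborel. norm (h i (x + s n) - h i x)) + (LINT x|lborel. norm (h i x - f x))"
        using tr lim.hyps by simp
      also have "\<dots> = 2 * (LINT x|lborel. norm (h i x - f x)) + (LINT x|lborel. norm (h i (x + s n) - h i x))"
        using lborel_integral_translate(1)[of "\<lambda>x. norm (h i x - f x)" "s n"] by simp
      also have "\<dots> < r" using i N[OF that] by (simp add: abs_less_iff)
      finally show ?thesis .
    qed
    moreover have "(LINT x|lborel. norm (f (x + s n) - f x)) \<ge> 0" for n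
      by (intro integral_nonneg_AE) auto
    ultimately show "\<exists>no. \<forall>n\<ge>no. norm ((LINT x|lborel. norm (f (x + s n) - f x)) - 0) < r"
      by auto
  qed
qed

text \<open>The n-th function is at least 1 - 1/(n + 1) on the n-th set of a compact exhaustion, and
  every point of \<open>G\<close> eventually lies in these sets.\<close>

lemma open_indicator_limit_test_functions:
  fixes G :: "(real^'m) set"
  assumes "open G"
  obtains \<phi> where "\<And>n::nat. \<phi> n \<in> test_functions G" "\<And>n x. 0 \<le> \<phi> n x" "\<And>n x. \<phi> n x \<le> 1"
    "\<And>x. (\<lambda>n. \<phi> n x) \<longlonglongrightarrow> indicator G x"
proof -
  obtain C where C: "\<And>n. compact (C n)" "\<And>n. C n \<subseteq> G" "\<Union>(range C) = G"
      "\<And>K. compact K \<Longrightarrow> K \<subseteq> G \<Longrightarrow> \<exists>N. \<forall>n\<ge>N. K \<subseteq> C (n::nat)"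
    using open_Union_compact_subsets[OF assms] by metis
  have "\<exists>\<phi>. \<phi> \<in> test_functions G \<and> (\<forall>x. 0 \<le> \<phi> x \<and> \<phi> x \<le> 1) \<and> (\<forall>x\<in>C n. 1 - 1 / real (Suc n) \<le> \<phi> x)" for n
    by (rule test_function_near_1_on_compact[OF C(1) assms C(2), of "1 / real (Suc n)" n]) auto
  then obtain \<phi> where \<phi>: "\<And>n. \<phi> n \<in> test_functions G" "\<And>n x. 0 \<le> \<phi> n x" "\<And>n x. \<phi> n x \<le> 1"
      "\<And>n x. x \<in> C n \<Longrightarrow> 1 - 1 / real (Suc n) \<le> \<phi> n x"
    by metis
  have "(\<lambda>n. \<phi> n x) \<longlonglongrightarrow> indicator G x" for x
  proof (cases "x \<in> G")
    case True
    obtain N where N: "\<And>n. n \<ge> N \<Longrightarrow> x \<in> C n"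
      using C(4)[of "{x}"] True by auto
    have "(\<lambda>n. \<phi> n x) \<longlonglongrightarrow> 1"
    proof (rule tendsto_sandwich)
      show "\<forall>\<^sub>F n in sequentially. 1 - 1 / real (Suc n) \<le> \<phi> n x"
        using N \<phi>(4) by (auto simp: eventually_sequentially)
      show "(\<lambda>n. 1 - 1 / real (Suc n)) \<longlonglongrightarrow> 1"
        using tendsto_diff[OF tendsto_const LIMSEQ_inverse_real_of_nat, of 1] by (simp add: field_simps)
    qed (auto simp: \<phi>)
    then show ?thesis using True by simp
  next
    case False
    then have "\<phi> n x = 0" for n using \<phi>(1)[of n] by (auto simp: test_functions_iff)
    then show ?thesis using False by simp
  qed
  with \<phi> that show thesis by blast
qed

text \<open>The bound passes from test functions to indicators of open subsets of \<open>G\<close>,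
  and from these to the set where \<open>g\<close> is positive, which up to a null set is a
  countable intersection of open sets.\<close>

lemma test_functions_bound_positive_part:
  fixes g :: "real^'m \<Rightarrow> real"
  assumes g: "integrable lborel g" and G: "open G"
    and bound: "\<And>\<phi>. \<phi> \<in> test_functions G \<Longrightarrow> (\<And>x. 0 \<le> \<phi> x) \<Longrightarrow> (\<And>x. \<phi> x \<le> 1) \<Longrightarrow>
      (LINT x|lborel. \<phi> x * g x) \<le> c"
  shows "(LINT x|lborel. indicator G x * max 0 (g x)) \<le> c"
proof -
  have gm [measurable]: "g \<in> borel_measurable borel" using g by auto
  have 1: "(LINT x|lborel. indicator H x * g x) \<le> c" if H: "open H" "H \<subseteq> G" for H
  proof -
    obtain \<phi> where \<phi>: "\<And>n::nat. \<phi> n \<in> test_functions H" "\<And>n x. 0 \<le> \<phi> n x" "\<And>n x. \<phi> n x \<le> 1"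
      "\<And>x. (\<lambda>n. \<phi> n x) \<longlonglongrightarrow> indicator H x"
      using open_indicator_limit_test_functions[OF H(1)] by metis
    have [measurable]: "\<phi> n \<in> borel_measurable borel" for n using \<phi>(1) test_functions_measurable by blast
    have "(\<lambda>n. LINT x|lborel. \<phi> n x * g x) \<longlonglongrightarrow> (LINT x|lborel. indicator H x * g x)"
    proof (rule integral_dominated_convergence[where w = "\<lambda>x. norm (g x)"])
      show "AE x in lborel. (\<lambda>n. \<phi> n x * g x) \<longlonglongrightarrow> indicator H x * g x"
        using \<phi>(4) by (auto intro!: tendsto_mult)
      show "AE x in lborel. norm (\<phi> n x * g x) \<le> norm (g x)" for n
        using \<phi>(2,3) by (auto simp: abs_mult mult_left_le_one_le)
    qed (use H g in auto)
    moreover have "(LINT x|lborel. \<phi> n x * g x) \<le> c" for n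
      using \<phi> bound test_functions_mono[OF H(2)] by blast
    ultimately show ?thesis by (meson LIMSEQ_le_const2)
  qed
  have [measurable]: "G \<in> sets borel" using G by auto
  define P where "P = {x \<in> space lborel. x \<in> G \<and> g x > 0}"
  have P [measurable]: "P \<in> sets borel" unfolding P_def by measurable
  then have "P \<in> sets lebesgue" by auto
  then obtain C T where C: "gdelta C" "T \<in> null_sets lebesgue" "P \<union> T = C"
    using lebesgue_set_almost_gdelta by metis
  from C(1) obtain F :: "nat \<Rightarrow> _" where F: "\<And>n. open (F n)" "C = \<Inter>(range F)"
    by (auto elim!: gdelta.cases)
  \<comment> \<open>Finite intersections stay open and decrease to \<open>G \<inter> C\<close>, so
    the bound for open sets applies to each \<open>H n\<close>.\<close>
  define H where "H n = G \<inter> (\<Inter>i\<le>n. F i)" for n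
  have H: "open (H n)" "H n \<subseteq> G" for n
    unfolding H_def using F G by (auto intro!: open_Int open_INT)
  have PT: "(\<lambda>n. indicator (H n) x * g x) \<longlonglongrightarrow> indicator G x * max 0 (g x)" if "x \<notin> T" for x
  proof (cases "x \<in> P")
    case True
    then have "x \<in> H n" for n using C(3) F(2) by (auto simp: H_def P_def)
    then show ?thesis using True by (auto simp: P_def)
  next
    case False
    have rhs: "indicator G x * max 0 (g x) = 0" using False by (auto simp: P_def indicator_def)
    have "x \<notin> C" using False that C(3) by auto
    then obtain m where "x \<notin> F m" using F(2) by auto
    then have "x \<notin> H n" if "n \<ge> m" for n using that by (auto simp: H_def)
    then have "\<forall>\<^sub>F n in sequentially. indicator (H n) x * g x = indicator G x * max 0 (g x)"
      unfolding rhs by (auto simp: eventually_sequentially intro!: exI[of _ m])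
    then show ?thesis by (rule tendsto_eventually)
  qed
  have "AE x in lebesgue. x \<notin> T" using C(2) by (rule AE_not_in)
  then have "AE x in lebesgue. (\<lambda>n. indicator (H n) x * g x) \<longlonglongrightarrow> indicator G x * max 0 (g x)"
    by eventually_elim (rule PT)
  then have ae: "AE x in lborel. (\<lambda>n. indicator (H n) x * g x) \<longlonglongrightarrow> indicator G x * max 0 (g x)"
    by (simp add: AE_completion_iff)
  have [measurable]: "H n \<in> sets borel" for n using H by auto
  have "(\<lambda>n. LINT x|lborel. indicator (H n) x * g x) \<longlonglongrightarrow> (LINT x|lborel. indicator G x * max 0 (g x))"
    by (rule integral_dominated_convergence[where w = "\<lambda>x. norm (g x)", OF _ _ _ ae])
       (use g in \<open>auto simp: indicator_def\<close>)
  then show ?thesis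
    using 1[OF H] by (meson LIMSEQ_le_const2)
qed

text \<open>The factor 2 comes from treating \<open>g\<close> and \<open>- g\<close>
  separately.\<close>

lemma test_functions_bound_abs:
  fixes g :: "real^'m \<Rightarrow> real"
  assumes g: "integrable lborel g" and G: "open G"
    and bound: "\<And>\<phi>. \<phi> \<in> test_functions G \<Longrightarrow> (\<And>x. 0 \<le> \<phi> x) \<Longrightarrow> (\<And>x. \<phi> x \<le> 1) \<Longrightarrow>
      \<bar>LINT x|lborel. \<phi> x * g x\<bar> \<le> c"
  shows "(LINT x|lborel. indicator G x * \<bar>g x\<bar>) \<le> 2 * c"
proof -
  have "(LINT x|lborel. indicator G x * max 0 (g x)) \<le> c"
    using bound by (intro test_functions_bound_positive_part[OF g G]) (meson abs_le_D1)
  moreover have "(LINT x|lborel. indicator G x * max 0 (- g x)) \<le> c"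
    using g bound by (intro test_functions_bound_positive_part[OF _ G]) (auto simp: abs_le_iff)
  moreover have "(LINT x|lborel. indicator G x * \<bar>g x\<bar>) =
      (LINT x|lborel. indicator G x * max 0 (g x) + indicator G x * max 0 (- g x))"
    by (intro Bochner_Integration.integral_cong) (auto simp: max_def)
  moreover have "integrable lborel (\<lambda>x. indicator G x * max 0 (g x))"
    "integrable lborel (\<lambda>x. indicator G x * max 0 (- g x))"
    using G g by (auto intro!: integrable_real_mult_indicator simp: mult.commute[of "indicator _ _"])
  ultimately show ?thesis by simp
qed

section \<open>Directional derivatives of convex Lipschitz functions\<close>

text \<open>The steps 1/(n + 1) suffice because the quotients of a convex function are monotone in
  the step; a sequential limit also yields measurability directly.\<close>

definition dir_deriv :: "('v::real_normed_vector \<Rightarrow> real) \<Rightarrow> 'v \<Rightarrow> 'v \<Rightarrow> real" where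
  "dir_deriv f a c = lim (\<lambda>n. real (Suc n) * (f (a + (1 / real (Suc n)) *\<^sub>R c) - f a))"

text \<open>The normalization at 0 lets \<open>f\<close> commute with cutting off by an indicator
  and gives \<bar>f x\<bar> \<le> L \<bar>x\<bar>, so composition preserves integrability on sets of
  infinite measure.\<close>

locale convex_lipschitz =
  fixes f :: "'v::euclidean_space \<Rightarrow> real" and L :: real
  assumes convex: "convex_on UNIV f"
    and lipschitz: "\<bar>f x - f y\<bar> \<le> L * norm (x - y)"
    and zero: "f 0 = 0"
begin

lemma lipschitz_zero: "\<bar>f x\<bar> \<le> L * norm x"
  using lipschitz[of x 0] zero by simp

lemma continuous: "continuous_on S f"
proof -
  have "(\<bar>L\<bar>)-lipschitz_on UNIV f"
  proof (rule lipschitz_onI)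
    fix x y :: 'v
    have "L * norm (x - y) \<le> \<bar>L\<bar> * norm (x - y)" by (intro mult_right_mono) auto
    then show "dist (f x) (f y) \<le> \<bar>L\<bar> * dist x y"
      using lipschitz[of x y] by (simp add: dist_norm)
  qed auto
  then show ?thesis
    using lipschitz_on_continuous_on continuous_on_subset by blast
qed

lemma measurable [measurable]: "f \<in> borel_measurable borel"
  using continuous by (rule borel_measurable_continuous_onI)

lemma difference_quotient_mono:
  assumes "0 < s" "s \<le> t"
  shows "(f (a + s *\<^sub>R c) - f a) / s \<le> (f (a + t *\<^sub>R c) - f a) / t"
proof -
  have "f ((1 - s / t) *\<^sub>R a + (s / t) *\<^sub>R (a + t *\<^sub>R c)) \<le> (1 - s / t) * f a + (s / t) * f (a + t *\<^sub>R c)"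
    using assms by (intro convex_onD[OF convex]) auto
  moreover have "(1 - s / t) *\<^sub>R a + (s / t) *\<^sub>R (a + t *\<^sub>R c) = a + s *\<^sub>R c"
    using assms by (simp add: algebra_simps)
  ultimately have "f (a + s *\<^sub>R c) - f a \<le> (s / t) * (f (a + t *\<^sub>R c) - f a)"
    using assms by (simp add: algebra_simps)
  then show ?thesis using assms by (simp add: field_simps)
qed

text \<open>Convexity makes the quotients decrease and the Lipschitz bound keeps them above - L
  \<bar>c\<bar>.\<close>

lemma dir_deriv_tendsto:
  "(\<lambda>n. real (Suc n) * (f (a + (1 / real (Suc n)) *\<^sub>R c) - f a)) \<longlonglongrightarrow> dir_deriv f a c"
proof -
  let ?q = "\<lambda>n. real (Suc n) * (f (a + (1 / real (Suc n)) *\<^sub>R c) - f a)"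
  have q: "?q n = (f (a + (1 / real (Suc n)) *\<^sub>R c) - f a) / (1 / real (Suc n))" for n by simp
  have "decseq ?q"
    unfolding decseq_def q by (intro allI impI difference_quotient_mono) (auto simp: field_simps)
  moreover have "- (L * norm c) \<le> ?q n" for n
  proof -
    have "\<bar>f (a + (1 / real (Suc n)) *\<^sub>R c) - f a\<bar> \<le> L * norm c / real (Suc n)"
      using lipschitz[of "a + (1 / real (Suc n)) *\<^sub>R c" a] by (simp add: field_simps)
    then have "- (L * norm c / real (Suc n)) \<le> f (a + (1 / real (Suc n)) *\<^sub>R c) - f a"
      by linarith
    then have "real (Suc n) * - (L * norm c / real (Suc n)) \<le> ?q n"
      by (intro mult_left_mono) auto
    then show ?thesis by simp
  qed
  ultimately obtain l where "?q \<longlonglongrightarrow> l"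
    using decseq_convergent[of ?q] by blast
  then have "convergent ?q" by (rule convergentI)
  then show ?thesis
    unfolding dir_deriv_def convergent_LIMSEQ_iff .
qed

text \<open>A decreasing limit is an infimum. This is the form in which convexity is used: a bound
  at every finite step \<open>t\<close>.\<close>

lemma dir_deriv_le:
  assumes "t > 0"
  shows "dir_deriv f a c \<le> (f (a + t *\<^sub>R c) - f a) / t"
proof (rule tendsto_upperbound[OF dir_deriv_tendsto])
  obtain N where N: "1 / real (Suc N) < t"
    using assms nat_approx_posE by blast
  show "\<forall>\<^sub>F n in sequentially. real (Suc n) * (f (a + (1 / real (Suc n)) *\<^sub>R c) - f a) \<le> (f (a + t *\<^sub>R c) - f a) / t"
    unfolding eventually_sequentially
  proof (intro exI[of _ N] allI impI)
    fix n assume "N \<le> n"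
    then have "1 / real (Suc n) \<le> 1 / real (Suc N)" by (simp add: field_simps)
    then have "1 / real (Suc n) \<le> t" using N by linarith
    from difference_quotient_mono[OF _ this, of a c]
    show "real (Suc n) * (f (a + (1 / real (Suc n)) *\<^sub>R c) - f a) \<le> (f (a + t *\<^sub>R c) - f a) / t"
      by (simp add: mult.commute)
  qed
qed auto

lemma dir_deriv_lipschitz: "\<bar>dir_deriv f a c - dir_deriv f a d\<bar> \<le> L * norm (c - d)"
proof (rule tendsto_upperbound[OF tendsto_rabs[OF tendsto_diff[OF dir_deriv_tendsto dir_deriv_tendsto]]])
  show "\<forall>\<^sub>F n in sequentially. \<bar>real (Suc n) * (f (a + (1 / real (Suc n)) *\<^sub>R c) - f a) -
     real (Suc n) * (f (a + (1 / real (Suc n)) *\<^sub>R d) - f a)\<bar> \<le> L * norm (c - d)"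
  proof (intro always_eventually allI)
    fix n
    have "\<bar>real (Suc n) * (f (a + (1 / real (Suc n)) *\<^sub>R c) - f a) -
        real (Suc n) * (f (a + (1 / real (Suc n)) *\<^sub>R d) - f a)\<bar>
      = real (Suc n) * \<bar>f (a + (1 / real (Suc n)) *\<^sub>R c) - f (a + (1 / real (Suc n)) *\<^sub>R d)\<bar>"
      by (metis (no_types, opaque_lifting) abs_mult abs_of_nat diff_diff_eq2 diff_add_cancel right_diff_distrib)
    also have "\<dots> \<le> real (Suc n) * (L * norm ((1 / real (Suc n)) *\<^sub>R (c - d)))"
      using lipschitz[of "a + (1 / real (Suc n)) *\<^sub>R c" "a + (1 / real (Suc n)) *\<^sub>R d"]
      by (intro mult_left_mono) (simp_all add: algebra_simps)
    also have "\<dots> = L * norm (c - d)"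
      unfolding norm_scaleR by simp
    finally show "\<bar>real (Suc n) * (f (a + (1 / real (Suc n)) *\<^sub>R c) - f a) -
        real (Suc n) * (f (a + (1 / real (Suc n)) *\<^sub>R d) - f a)\<bar> \<le> L * norm (c - d)" .
  qed
qed auto

lemma dir_deriv_bound: "\<bar>dir_deriv f a c\<bar> \<le> L * norm c"
  using dir_deriv_lipschitz[of a c 0] by (simp add: dir_deriv_def)

text \<open>The point \<open>a\<close> is the midpoint of \<open>a + r *\<^sub>R c\<close> and
  \<open>a - r *\<^sub>R c\<close>.\<close>

lemma dir_deriv_add_minus_nonneg: "0 \<le> dir_deriv f a c + dir_deriv f a (- c)"
proof (rule tendsto_lowerbound[OF tendsto_add[OF dir_deriv_tendsto dir_deriv_tendsto]])
  show "\<forall>\<^sub>F n in sequentially. 0 \<le> real (Suc n) * (f (a + (1 / real (Suc n)) *\<^sub>R c) - f a) +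
     real (Suc n) * (f (a + (1 / real (Suc n)) *\<^sub>R - c) - f a)"
  proof (intro always_eventually allI)
    fix n
    have "f ((1 - 1/2) *\<^sub>R (a + (1 / real (Suc n)) *\<^sub>R c) + (1/2) *\<^sub>R (a + (1 / real (Suc n)) *\<^sub>R - c)) \<le>
      (1 - 1/2) * f (a + (1 / real (Suc n)) *\<^sub>R c) + (1/2) * f (a + (1 / real (Suc n)) *\<^sub>R - c)"
      by (intro convex_onD[OF convex]) auto
    moreover have "(1 - 1/2) *\<^sub>R (a + r *\<^sub>R c) + (1/2) *\<^sub>R (a + r *\<^sub>R - c) = a" for r
    proof -
      have *: "(1 - 1/2) *\<^sub>R u + (1/2) *\<^sub>R v = (1/2) *\<^sub>R (u + v)" for u v :: 'v
        by (simp add: scaleR_add_right)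
      show ?thesis unfolding * using scaleR_half_double[of a] by simp
    qed
    ultimately have "0 \<le> (f (a + (1 / real (Suc n)) *\<^sub>R c) - f a) + (f (a + (1 / real (Suc n)) *\<^sub>R - c) - f a)"
      by simp
    then have "0 \<le> real (Suc n) * ((f (a + (1 / real (Suc n)) *\<^sub>R c) - f a) + (f (a + (1 / real (Suc n)) *\<^sub>R - c) - f a))"
      by (intro mult_nonneg_nonneg) auto
    then show "0 \<le> real (Suc n) * (f (a + (1 / real (Suc n)) *\<^sub>R c) - f a) +
     real (Suc n) * (f (a + (1 / real (Suc n)) *\<^sub>R - c) - f a)"
      by (simp only: distrib_left)
  qed
qed auto

text \<open>The directional derivative is an infimum of difference quotients, each jointly
  continuous in base point and direction; one fixed quotient close to the infimum decides.\<close>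

lemma dir_deriv_upper_semicontinuous:
  assumes "A \<longlonglongrightarrow> a" "C \<longlonglongrightarrow> c" "e > 0"
  shows "\<forall>\<^sub>F n in sequentially. dir_deriv f (A n) (C n) < dir_deriv f a c + e"
proof -
  obtain N where N: "real (Suc N) * (f (a + (1 / real (Suc N)) *\<^sub>R c) - f a) < dir_deriv f a c + e"
    using order_tendstoD(2)[OF dir_deriv_tendsto[of a c], of "dir_deriv f a c + e"] \<open>e > 0\<close>
    by (auto simp: eventually_sequentially)
  have "isCont f z" for z using continuous[of UNIV] by (simp add: continuous_on_eq_continuous_at)
  then have "(\<lambda>n. real (Suc N) * (f (A n + (1 / real (Suc N)) *\<^sub>R C n) - f (A n))) \<longlonglongrightarrow>
     real (Suc N) * (f (a + (1 / real (Suc N)) *\<^sub>R c) - f a)"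
    by (intro tendsto_intros isCont_tendsto_compose[of _ f] assms)
  from order_tendstoD(2)[OF this N] show ?thesis
  proof eventually_elim
    case (elim n)
    then show ?case
      using dir_deriv_le[of "1 / real (Suc N)" "A n" "C n"] by (simp add: mult.commute)
  qed
qed

text \<open>Upper semicontinuity in direction \<open>- c\<close> is lower semicontinuity in
  direction \<open>c\<close> once the two derivatives are opposite.\<close>

lemma dir_deriv_continuous_of_two_sided:
  assumes "A \<longlonglongrightarrow> a" "C \<longlonglongrightarrow> c"
    and "\<And>n. dir_deriv f (A n) (C n) + dir_deriv f (A n) (- C n) = 0"
    and "dir_deriv f a c + dir_deriv f a (- c) = 0"
  shows "(\<lambda>n. dir_deriv f (A n) (C n)) \<longlonglongrightarrow> dir_deriv f a c"
proof (rule order_tendstoI)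
  fix y assume "dir_deriv f a c < y"
  then show "\<forall>\<^sub>F n in sequentially. dir_deriv f (A n) (C n) < y"
    using dir_deriv_upper_semicontinuous[OF assms(1,2), of "y - dir_deriv f a c"] by simp
next
  fix y assume "y < dir_deriv f a c"
  then have "\<forall>\<^sub>F n in sequentially. dir_deriv f (A n) (- C n) < dir_deriv f a (- c) + (dir_deriv f a c - y)"
    by (intro dir_deriv_upper_semicontinuous assms tendsto_minus) simp
  then show "\<forall>\<^sub>F n in sequentially. y < dir_deriv f (A n) (C n)"
  proof eventually_elim
    case (elim n)
    then show ?case using assms(3)[of n] assms(4) by linarith
  qed
qed

lemma dir_deriv_measurable:
  assumes [measurable]: "a \<in> borel_measurable M" "b \<in> borel_measurable M"
  shows "(\<lambda>x. dir_deriv f (a x) (b x)) \<in> borel_measurable M"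
proof (rule borel_measurable_LIMSEQ_metric)
  show "(\<lambda>n. real (Suc n) * (f (a x + (1 / real (Suc n)) *\<^sub>R b x) - f (a x))) \<longlonglongrightarrow> dir_deriv f (a x) (b x)" for x
    by (rule dir_deriv_tendsto)
qed measurable

end

section \<open>Difference quotients of weakly differentiable functions\<close>

text \<open>The factor \<open>\<sigma>\<close> will be 1 or -1, so that steps tending to 0 from
  below become positive steps in the opposite direction.\<close>

lemma test_functions_line_derivative:
  assumes "\<phi> \<in> test_functions U"
  shows "((\<lambda>s. \<phi> (x + (s * \<sigma>) *\<^sub>R axis i 1)) has_real_derivative
     \<sigma> * partial_deriv i \<phi> (x + (s * \<sigma>) *\<^sub>R axis i 1)) (at s)"
proof -
  let ?e = "axis i 1" and ?F = "frechet_derivative \<phi> (at (x + (s * \<sigma>) *\<^sub>R axis i 1))"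
  have F: "(\<phi> has_derivative ?F) (at (x + (s * \<sigma>) *\<^sub>R ?e))"
    using assms smooth_fun_has_derivative by (auto simp: test_functions_iff)
  have "((\<lambda>s. x + (s * \<sigma>) *\<^sub>R ?e) has_derivative (\<lambda>h. (h * \<sigma>) *\<^sub>R ?e)) (at s)"
    by (auto intro!: derivative_eq_intros)
  from has_derivative_compose[OF this F]
  have "((\<lambda>s. \<phi> (x + (s * \<sigma>) *\<^sub>R ?e)) has_derivative (\<lambda>h. ?F ((h * \<sigma>) *\<^sub>R ?e))) (at s)" .
  moreover have "?F ((h * \<sigma>) *\<^sub>R ?e) = (\<sigma> * partial_deriv i \<phi> (x + (s * \<sigma>) *\<^sub>R ?e)) * h" for h
    using linear_simps(5)[OF has_derivative_bounded_linear[OF F], of "h * \<sigma>" ?e]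
    by (simp add: partial_deriv_def)
  ultimately show ?thesis
    by (simp add: has_field_derivative_def)
qed

text \<open>The second partial derivative is again a test function, hence bounded. Uniformity of the
  remainder in \<open>x\<close> is what allows differentiation under the integral.\<close>

lemma test_functions_taylor:
  assumes "\<phi> \<in> test_functions U"
  obtains C where "C \<ge> 0"
    "\<And>x s. \<bar>\<phi> (x + (s * \<sigma>) *\<^sub>R axis i 1) - \<phi> x - s * (\<sigma> * partial_deriv i \<phi> x)\<bar> \<le> C * s\<^sup>2"
proof -
  let ?e = "axis i 1"
  obtain M where M: "M > 0" "\<And>x. \<bar>partial_deriv i (partial_deriv i \<phi>) x\<bar> \<le> M"
    using test_functions_bounded[OF test_functions_partial_deriv[OF test_functions_partial_deriv[OF assms]]]
    by metis
  have 1: "\<bar>partial_deriv i \<phi> (x + (s * \<sigma>) *\<^sub>R ?e) - partial_deriv i \<phi> x\<bar> \<le> \<bar>\<sigma>\<bar> * M * \<bar>s\<bar>" for x s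
    using field_differentiable_bound[of UNIV "\<lambda>s. partial_deriv i \<phi> (x + (s * \<sigma>) *\<^sub>R ?e)" _ "\<bar>\<sigma>\<bar> * M" 0 s,
        OF _ test_functions_line_derivative[OF test_functions_partial_deriv[OF assms]]] M
    by (simp add: abs_mult mult_left_mono norm_minus_commute abs_minus_commute)
  show thesis
  proof (rule that[of "\<bar>\<sigma>\<bar> * \<bar>\<sigma>\<bar> * M"])
    fix x s
    let ?g = "\<lambda>s. \<phi> (x + (s * \<sigma>) *\<^sub>R ?e) - s * (\<sigma> * partial_deriv i \<phi> x)"
    have "norm (?g s - ?g 0) \<le> (\<bar>\<sigma>\<bar> * \<bar>\<sigma>\<bar> * M * \<bar>s\<bar>) * norm (s - 0)"
    proof (rule field_differentiable_bound[where S = "{-\<bar>s\<bar>..\<bar>s\<bar>}" and f = ?g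
          and f' = "\<lambda>z. \<sigma> * partial_deriv i \<phi> (x + (z * \<sigma>) *\<^sub>R ?e) - \<sigma> * partial_deriv i \<phi> x"])
      fix z assume z: "z \<in> {-\<bar>s\<bar>..\<bar>s\<bar>}"
      have "(?g has_real_derivative \<sigma> * partial_deriv i \<phi> (x + (z * \<sigma>) *\<^sub>R ?e) - \<sigma> * partial_deriv i \<phi> x) (at z)"
        by (intro DERIV_diff test_functions_line_derivative[OF assms] DERIV_cmult_right) (auto intro!: derivative_eq_intros)
      then show "(?g has_field_derivative \<sigma> * partial_deriv i \<phi> (x + (z * \<sigma>) *\<^sub>R ?e) - \<sigma> * partial_deriv i \<phi> x)
          (at z within {-\<bar>s\<bar>..\<bar>s\<bar>})"
        by (rule has_field_derivative_at_within)
      have "\<bar>\<sigma>\<bar> * M * \<bar>z\<bar> \<le> \<bar>\<sigma>\<bar> * M * \<bar>s\<bar>" using z M by (intro mult_left_mono) auto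
      with 1[of x z] have "\<bar>partial_deriv i \<phi> (x + (z * \<sigma>) *\<^sub>R ?e) - partial_deriv i \<phi> x\<bar> \<le> \<bar>\<sigma>\<bar> * M * \<bar>s\<bar>"
        by linarith
      then have "\<bar>\<sigma>\<bar> * \<bar>partial_deriv i \<phi> (x + (z * \<sigma>) *\<^sub>R ?e) - partial_deriv i \<phi> x\<bar> \<le> \<bar>\<sigma>\<bar> * (\<bar>\<sigma>\<bar> * M * \<bar>s\<bar>)"
        by (intro mult_left_mono) auto
      then show "norm (\<sigma> * partial_deriv i \<phi> (x + (z * \<sigma>) *\<^sub>R ?e) - \<sigma> * partial_deriv i \<phi> x)
        \<le> \<bar>\<sigma>\<bar> * \<bar>\<sigma>\<bar> * M * \<bar>s\<bar>"
        by (simp only: real_norm_def right_diff_distrib[symmetric] abs_mult mult.assoc)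
    qed auto
    then show "\<bar>\<phi> (x + (s * \<sigma>) *\<^sub>R ?e) - \<phi> x - s * (\<sigma> * partial_deriv i \<phi> x)\<bar> \<le> \<bar>\<sigma>\<bar> * \<bar>\<sigma>\<bar> * M * s\<^sup>2"
      by (simp add: power2_eq_square mult_ac)
  qed (use M in auto)
qed

lemma integrable_test_function_mult:
  fixes u :: "real^'m \<Rightarrow> real"
  assumes "\<phi> \<in> test_functions U" "integrable lborel u"
  shows "integrable lborel (\<lambda>x. \<phi> x * u x)" "integrable lborel (\<lambda>x. \<phi> (x - v) * u x)"
    "integrable lborel (\<lambda>x. \<phi> x * u (x + v))"
proof -
  have *: "integrable lborel (\<lambda>x. \<psi> x * u x)" if \<psi>: "\<psi> \<in> test_functions UNIV" for \<psi>
  proof -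
    obtain M where M: "M > 0" "\<And>x. \<bar>\<psi> x\<bar> \<le> M" using test_functions_bounded[OF \<psi>] by metis
    show ?thesis
    proof (rule Bochner_Integration.integrable_bound)
      show "integrable lborel (\<lambda>x. M * norm (u x))" using assms(2) by simp
      show "(\<lambda>x. \<psi> x * u x) \<in> borel_measurable lborel"
        using assms(2) test_functions_measurable[OF \<psi>] by (auto intro!: borel_measurable_times)
      show "AE x in lborel. norm (\<psi> x * u x) \<le> norm (M * norm (u x))"
        using M by (auto simp: abs_mult intro!: mult_right_mono)
    qed
  qed
  show "integrable lborel (\<lambda>x. \<phi> x * u x)" "integrable lborel (\<lambda>x. \<phi> (x - v) * u x)"
    using assms(1) test_functions_mono[of U UNIV] by (auto intro!: * test_functions_translate[of \<phi> U])
  with lborel_integral_translate(2)[of "\<lambda>x. \<phi> (x - v) * u x" v]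
  show "integrable lborel (\<lambda>x. \<phi> x * u (x + v))" by simp
qed

text \<open>The translation acts on \<open>\<phi>\<close> only, so integrability of \<open>u\<close>
  is enough: the uniform Taylor remainder contributes at most C s^2 times the L1 norm of
  \<open>u\<close>.\<close>

lemma translated_test_function_derivative:
  fixes u :: "real^'m \<Rightarrow> real"
  assumes \<phi>: "\<phi> \<in> test_functions U" and u: "integrable lborel u"
  shows "((\<lambda>t. LINT x|lborel. \<phi> (x - (t * \<sigma>) *\<^sub>R axis i 1) * u x) has_real_derivative
     - (LINT x|lborel. \<sigma> * partial_deriv i \<phi> (x - (t * \<sigma>) *\<^sub>R axis i 1) * u x)) (at t)"
proof -
  let ?e = "axis i 1" and ?h = "\<lambda>t. LINT x|lborel. \<phi> (x - (t * \<sigma>) *\<^sub>R axis i 1) * u x"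
  let ?H = "LINT x|lborel. \<sigma> * partial_deriv i \<phi> (x - (t * \<sigma>) *\<^sub>R axis i 1) * u x"
  obtain C where C: "C \<ge> 0"
    "\<And>x s. \<bar>\<phi> (x + (s * \<sigma>) *\<^sub>R ?e) - \<phi> x - s * (\<sigma> * partial_deriv i \<phi> x)\<bar> \<le> C * s\<^sup>2"
    using test_functions_taylor[OF \<phi>] by metis
  define K where "K = C * (LINT x|lborel. \<bar>u x\<bar>)"
  have K: "norm (?h (t + s) - ?h t - s * - ?H) \<le> K * s\<^sup>2" for s
  proof -
    let ?y = "\<lambda>x. x - (t * \<sigma>) *\<^sub>R ?e"
    have i1: "integrable lborel (\<lambda>x. \<phi> (x - (r * \<sigma>) *\<^sub>R ?e) * u x)" for r
      using integrable_test_function_mult[OF \<phi> u] by blast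
    have i2: "integrable lborel (\<lambda>x. \<sigma> * partial_deriv i \<phi> (?y x) * u x)"
      using integrable_test_function_mult(2)[OF test_functions_partial_deriv[OF \<phi>] u]
      by (simp add: mult.assoc)
    have eq: "?h (t + s) - ?h t - s * - ?H = (LINT x|lborel. \<phi> (x - ((t + s) * \<sigma>) *\<^sub>R ?e) * u x
         - \<phi> (?y x) * u x + s * (\<sigma> * partial_deriv i \<phi> (?y x) * u x))"
      using i1 i2 by simp
    have "norm (LINT x|lborel. \<phi> (x - ((t + s) * \<sigma>) *\<^sub>R ?e) * u x
         - \<phi> (?y x) * u x + s * (\<sigma> * partial_deriv i \<phi> (?y x) * u x)) \<le> (LINT x|lborel. C * s\<^sup>2 * \<bar>u x\<bar>)"
    proof (rule order.trans[OF integral_norm_bound integral_mono])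
      fix x
      have "\<phi> (x - ((t + s) * \<sigma>) *\<^sub>R ?e) * u x - \<phi> (?y x) * u x + s * (\<sigma> * partial_deriv i \<phi> (?y x) * u x)
         = (\<phi> (?y x + ((- s) * \<sigma>) *\<^sub>R ?e) - \<phi> (?y x) - (- s) * (\<sigma> * partial_deriv i \<phi> (?y x))) * u x"
        by (simp add: algebra_simps)
      then show "norm (\<phi> (x - ((t + s) * \<sigma>) *\<^sub>R ?e) * u x - \<phi> (?y x) * u x
          + s * (\<sigma> * partial_deriv i \<phi> (?y x) * u x)) \<le> C * s\<^sup>2 * \<bar>u x\<bar>"
        using C(2)[of "?y x" "- s"] by (simp only: real_norm_def abs_mult power2_minus mult_right_mono abs_ge_zero)
    qed (use u i1 i2 in \<open>auto intro!: integrable_norm Bochner_Integration.integrable_add Bochner_Integration.integrable_diff integrable_mult_right\<close>)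
    then show ?thesis unfolding eq K_def by (simp add: mult_ac)
  qed
  have "((\<lambda>s. norm (?h (t + s) - ?h t - - ?H * s) / norm s) \<longlongrightarrow> 0) (at 0)"
  proof (rule tendsto_sandwich[OF _ _ tendsto_const])
    show "((\<lambda>s. K * \<bar>s\<bar>) \<longlongrightarrow> 0) (at 0)"
      by (rule tendsto_eq_intros | simp)+
    show "\<forall>\<^sub>F s in at 0. norm (?h (t + s) - ?h t - - ?H * s) / norm s \<le> K * \<bar>s\<bar>"
      unfolding eventually_at_filter
    proof (intro always_eventually allI impI)
      fix s :: real assume s: "s \<noteq> 0"
      have "norm (?h (t + s) - ?h t - - ?H * s) \<le> K * \<bar>s\<bar> * \<bar>s\<bar>"
      proof -
        have "s * - ?H = - ?H * s" by (rule mult.commute)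
        moreover have "K * s\<^sup>2 = K * \<bar>s\<bar> * \<bar>s\<bar>" by (simp add: power2_eq_square mult.assoc)
        ultimately show ?thesis using K[of s] by (simp only:)
      qed
      then show "norm (?h (t + s) - ?h t - - ?H * s) / norm s \<le> K * \<bar>s\<bar>"
        using s by (simp add: field_simps)
    qed
  qed auto
  then show ?thesis
    unfolding has_field_derivative_def has_derivative_at
    by (simp add: bounded_linear_mult_right)
qed

lemma integrable_test_function_scaleR:
  fixes c :: "real^'m \<Rightarrow> 'v::euclidean_space"
  assumes \<psi>: "\<psi> \<in> test_functions U" and c: "integrable lborel c"
  shows "integrable lborel (\<lambda>x. \<psi> x *\<^sub>R c x)"
proof -
  obtain M where M: "M > 0" "\<And>x. \<bar>\<psi> x\<bar> \<le> M" using test_functions_bounded[OF \<psi>] by metis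
  show ?thesis
  proof (rule Bochner_Integration.integrable_bound)
    show "integrable lborel (\<lambda>x. M * norm (c x))" using c by simp
    show "(\<lambda>x. \<psi> x *\<^sub>R c x) \<in> borel_measurable lborel"
      using c test_functions_measurable[OF \<psi>] by (auto intro!: borel_measurable_scaleR)
    show "AE x in lborel. norm (\<psi> x *\<^sub>R c x) \<le> norm (M * norm (c x))"
      using M by (auto simp: abs_mult intro!: mult_right_mono)
  qed
qed

text \<open>Tested against \<open>\<phi>\<close>, the difference quotient minus \<open>b\<close> is \<open>\<integral>\<phi> (x) (b (x + \<xi> v) - b (x))\<close> for some
  intermediate \<open>\<xi>\<close>, by the mean value theorem; the \<open>L\<^sup>1\<close> modulus of continuity of \<open>b\<close> bounds this
  uniformly in \<open>0 \<le> \<phi> \<le> 1\<close>, so duality bounds the \<open>L\<^sup>1\<close> norm.\<close>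

lemma difference_quotient_L1_real:
  fixes a b :: "real^'m \<Rightarrow> real"
  assumes a: "integrable lborel a" and b: "integrable lborel b"
    and weak: "\<And>\<phi>. \<phi> \<in> test_functions G \<Longrightarrow>
      (LINT x|lborel. \<sigma> * partial_deriv i \<phi> x * a x) = - (LINT x|lborel. \<phi> x * b x)"
    and H: "open H" "\<And>x s. x \<in> H \<Longrightarrow> 0 \<le> s \<Longrightarrow> s \<le> \<tau> \<Longrightarrow> x + (s * \<sigma>) *\<^sub>R axis i 1 \<in> G"
    and t: "\<And>n. 0 < t n" "\<And>n. t n \<le> \<tau>" "t \<longlonglongrightarrow> 0"
  shows "(\<lambda>n. LINT x|lborel. indicator H x * \<bar>(a (x + (t n * \<sigma>) *\<^sub>R axis i 1) - a x) / t n - b x\<bar>) \<longlonglongrightarrow> 0"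
proof -
  define v :: "real^'m" where "v = \<sigma> *\<^sub>R axis i 1"
  have v: "(s * \<sigma>) *\<^sub>R axis i 1 = s *\<^sub>R v" for s by (simp add: v_def)
  define g where "g n x = (a (x + t n *\<^sub>R v) - a x) / t n - b x" for n x
  \<comment> \<open>The modulus of continuity of \<open>b\<close> in the mean along the direction
    \<open>v\<close>.\<close>
  define \<omega> where "\<omega> s = (LINT x|lborel. \<bar>b (x + s *\<^sub>R v) - b x\<bar>)" for s
  have tr: "integrable lborel (\<lambda>x. a (x + w))" "integrable lborel (\<lambda>x. b (x + w))" for w
    using a b by (auto simp: lborel_integral_translate(2))
  have g: "integrable lborel (g n)" for n
    unfolding g_def using tr a b by (intro Bochner_Integration.integrable_diff integrable_divide_zero) auto
  have \<omega>: "(\<omega> \<longlongrightarrow> 0) (at_right 0)"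
  proof (rule tendsto_at_right_sequentially[of 0 1])
    fix S :: "nat \<Rightarrow> real" assume "S \<longlonglongrightarrow> 0"
    then have "(\<lambda>n. S n *\<^sub>R v) \<longlonglongrightarrow> 0 *\<^sub>R v" by (intro tendsto_intros)
    then have "(\<lambda>n. S n *\<^sub>R v) \<longlonglongrightarrow> 0" by simp
    from L1_translation_continuous[OF b this]
    show "(\<lambda>n. \<omega> (S n)) \<longlonglongrightarrow> 0" unfolding \<omega>_def by simp
  qed simp
  have key: "\<exists>\<xi>. 0 < \<xi> \<and> \<xi> < t n \<and> \<bar>LINT x|lborel. \<phi> x * g n x\<bar> \<le> \<omega> \<xi>"
    if \<phi>: "\<phi> \<in> test_functions H" "\<And>x. 0 \<le> \<phi> x" "\<And>x. \<phi> x \<le> 1" for \<phi> n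
  proof -
    define h where "h r = (LINT x|lborel. \<phi> (x - r *\<^sub>R v) * a x)" for r
    have h: "h r = (LINT x|lborel. \<phi> x * a (x + r *\<^sub>R v))" for r
      unfolding h_def using lborel_integral_translate(1)[of "\<lambda>x. \<phi> (x - r *\<^sub>R v) * a x" "r *\<^sub>R v"] by simp
    have deriv: "(h has_real_derivative (LINT x|lborel. \<phi> x * b (x + r *\<^sub>R v))) (at r)"
      if r: "0 \<le> r" "r \<le> \<tau>" for r
    proof -
      let ?\<psi> = "\<lambda>x. \<phi> (x - r *\<^sub>R v)"
      \<comment> \<open>Translation by at most \<open>\<tau>\<close> carries \<open>H\<close> into
        \<open>G\<close>, so the weak derivative may be tested with the translate.\<close>
      have \<psi>: "?\<psi> \<in> test_functions G"
        by (rule test_functions_translate[OF \<phi>(1)]) (use H(2) r v in auto)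
      have "partial_deriv i ?\<psi> = (\<lambda>x. partial_deriv i \<phi> (x - r *\<^sub>R v))"
        by (rule ext, rule partial_deriv_translate(2), rule smooth_fun_differentiable)
           (use \<phi>(1) in \<open>simp add: test_functions_iff\<close>)
      then have "- (LINT x|lborel. \<sigma> * partial_deriv i \<phi> (x - r *\<^sub>R v) * a x) = (LINT x|lborel. ?\<psi> x * b x)"
        using weak[OF \<psi>] by simp
      also have "\<dots> = (LINT x|lborel. \<phi> x * b (x + r *\<^sub>R v))"
        using lborel_integral_translate(1)[of "\<lambda>x. ?\<psi> x * b x" "r *\<^sub>R v"] by simp
      finally show ?thesis
        using translated_test_function_derivative[OF \<phi>(1) a, of \<sigma> i r] unfolding v h_def by simp
    qed
    obtain \<xi> where \<xi>: "0 < \<xi>" "\<xi> < t n" "h (t n) - h 0 = (t n - 0) * (LINT x|lborel. \<phi> x * b (x + \<xi> *\<^sub>R v))"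
      using MVT2[of 0 "t n" h "\<lambda>r. LINT x|lborel. \<phi> x * b (x + r *\<^sub>R v)"] t deriv
      by (meson order.trans)
    note int = integrable_test_function_mult(1)[OF \<phi>(1)]
    have "(LINT x|lborel. \<phi> x * g n x) = (LINT x|lborel. (\<phi> x * a (x + t n *\<^sub>R v) - \<phi> x * a x) / t n - \<phi> x * b x)"
      unfolding g_def by (intro Bochner_Integration.integral_cong) (auto simp: algebra_simps diff_divide_distrib)
    also have "\<dots> = (h (t n) - h 0) / t n - (LINT x|lborel. \<phi> x * b x)"
      unfolding h using int[OF tr(1)] int[OF a] int[OF b] by simp
    also have "\<dots> = (LINT x|lborel. \<phi> x * b (x + \<xi> *\<^sub>R v)) - (LINT x|lborel. \<phi> x * b x)"
      using \<xi>(3) t(1)[of n] by simp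
    also have "\<dots> = (LINT x|lborel. \<phi> x * (b (x + \<xi> *\<^sub>R v) - b x))"
      using int[OF tr(2)] int[OF b] by (simp add: right_diff_distrib)
    finally have eq: "(LINT x|lborel. \<phi> x * g n x) = (LINT x|lborel. \<phi> x * (b (x + \<xi> *\<^sub>R v) - b x))" .
    have "norm (LINT x|lborel. \<phi> x * (b (x + \<xi> *\<^sub>R v) - b x)) \<le> \<omega> \<xi>"
      unfolding \<omega>_def
    proof (rule order.trans[OF integral_norm_bound integral_mono])
      show "norm (\<phi> x * (b (x + \<xi> *\<^sub>R v) - b x)) \<le> \<bar>b (x + \<xi> *\<^sub>R v) - b x\<bar>" for x
        using \<phi>(2,3)[of x] by (simp add: abs_mult mult_left_le_one_le)
    qed (use tr b int in auto)
    then show ?thesis using \<xi> eq by auto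
  qed
  show ?thesis
  proof (rule LIMSEQ_I)
    fix r :: real assume "r > 0"
    \<comment> \<open>Duality loses a factor 2, so this choice leaves \<open>r / 2\<close>.\<close>
    then have "\<forall>\<^sub>F s in at_right 0. \<omega> s < r / 4"
      using order_tendstoD(2)[OF \<omega>, of "r / 4"] by simp
    then obtain \<delta> where \<delta>: "\<delta> > 0" "\<And>s. 0 < s \<Longrightarrow> s < \<delta> \<Longrightarrow> \<omega> s < r / 4"
      by (auto simp: eventually_at_right_field)
    obtain N where N: "\<And>n. n \<ge> N \<Longrightarrow> t n < \<delta>"
      using order_tendstoD(2)[OF t(3) \<delta>(1)] by (auto simp: eventually_sequentially)
    have "norm ((LINT x|lborel. indicator H x * \<bar>g n x\<bar>) - 0) < r" if "n \<ge> N" for n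
    proof -
      have "(LINT x|lborel. indicator H x * \<bar>g n x\<bar>) \<le> 2 * (r / 4)"
      proof (rule test_functions_bound_abs[OF g H(1)])
        fix \<phi> assume "\<phi> \<in> test_functions H" "\<And>x. 0 \<le> \<phi> x" "\<And>x. \<phi> x \<le> (1 :: real)"
        from key[OF this, of n] obtain \<xi> where "0 < \<xi>" "\<xi> < t n" "\<bar>LINT x|lborel. \<phi> x * g n x\<bar> \<le> \<omega> \<xi>"
          by blast
        then show "\<bar>LINT x|lborel. \<phi> x * g n x\<bar> \<le> r / 4"
          using \<delta>(2)[of \<xi>] N[OF that] by linarith
      qed
      moreover have "0 \<le> (LINT x|lborel. indicator H x * \<bar>g n x\<bar>)"
        by (intro integral_nonneg_AE) auto
      ultimately show ?thesis using \<open>r > 0\<close> by simp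
    qed
    then show "\<exists>no. \<forall>n\<ge>no. norm ((LINT x|lborel. indicator H x * \<bar>(a (x + (t n * \<sigma>) *\<^sub>R axis i 1) - a x) / t n - b x\<bar>) - 0) < r"
      unfolding v g_def by blast
  qed
qed

text \<open>Coordinatewise reduction to the real case; the norm is at most the sum of the absolute
  coordinates.\<close>

lemma difference_quotient_L1:
  fixes a b :: "real^'m \<Rightarrow> 'v::euclidean_space"
  assumes a: "integrable lborel a" and b: "integrable lborel b"
    and weak: "\<And>\<phi>. \<phi> \<in> test_functions G \<Longrightarrow>
      (LINT x|lborel. (\<sigma> * partial_deriv i \<phi> x) *\<^sub>R a x) = - (LINT x|lborel. \<phi> x *\<^sub>R b x)"
    and H: "open H" "\<And>x s. x \<in> H \<Longrightarrow> 0 \<le> s \<Longrightarrow> s \<le> \<tau> \<Longrightarrow> x + (s * \<sigma>) *\<^sub>R axis i 1 \<in> G"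
    and t: "\<And>n. 0 < t n" "\<And>n. t n \<le> \<tau>" "t \<longlonglongrightarrow> 0"
  shows "(\<lambda>n. LINT x|lborel. indicator H x * norm ((1 / t n) *\<^sub>R (a (x + (t n * \<sigma>) *\<^sub>R axis i 1) - a x) - b x)) \<longlonglongrightarrow> 0"
proof -
  let ?D = "\<lambda>n x. (1 / t n) *\<^sub>R (a (x + (t n * \<sigma>) *\<^sub>R axis i 1) - a x) - b x"
  have D: "integrable lborel (?D n)" for n
    using lborel_integral_translate(2)[of a] a b by auto
  have intH: "integrable lborel (\<lambda>x. indicator H x * f x)" if "integrable lborel f" for f :: "_ \<Rightarrow> real"
    using integrable_real_mult_indicator[of H lborel f] that H(1) by (simp add: mult.commute)
  have coord: "(\<lambda>n. LINT x|lborel. indicator H x * \<bar>?D n x \<bullet> j\<bar>) \<longlonglongrightarrow> 0" if j: "j \<in> Basis" for j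
  proof -
    have eq: "?D n x \<bullet> j = ((a (x + (t n * \<sigma>) *\<^sub>R axis i 1) \<bullet> j - a x \<bullet> j) / t n - b x \<bullet> j)" for n x
      by (simp add: inner_diff_left)
    show ?thesis unfolding eq
    proof (rule difference_quotient_L1_real[where a = "\<lambda>x. a x \<bullet> j" and b = "\<lambda>x. b x \<bullet> j", OF _ _ _ H t])
      fix \<phi> assume \<phi>: "\<phi> \<in> test_functions G"
      note int = integrable_test_function_scaleR
      have "(LINT x|lborel. (\<sigma> * partial_deriv i \<phi> x) *\<^sub>R a x) \<bullet> j = (LINT x|lborel. ((\<sigma> * partial_deriv i \<phi> x) *\<^sub>R a x) \<bullet> j)"
        using int[OF test_functions_partial_deriv[OF \<phi>] a] by (intro integral_inner_left[symmetric]) (simp flip: scaleR_scaleR)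
      moreover have "(LINT x|lborel. \<phi> x *\<^sub>R b x) \<bullet> j = (LINT x|lborel. (\<phi> x *\<^sub>R b x) \<bullet> j)"
        using int[OF \<phi> b] by (intro integral_inner_left[symmetric]) simp
      ultimately show "(LINT x|lborel. \<sigma> * partial_deriv i \<phi> x * (a x \<bullet> j)) = - (LINT x|lborel. \<phi> x * (b x \<bullet> j))"
        using arg_cong[OF weak[OF \<phi>], of "\<lambda>z. z \<bullet> j"] by simp
    qed (use a b in auto)
  qed
  show ?thesis
  proof (rule tendsto_sandwich[OF _ _ tendsto_const])
    show "(\<lambda>n. \<Sum>j\<in>Basis. LINT x|lborel. indicator H x * \<bar>?D n x \<bullet> j\<bar>) \<longlonglongrightarrow> 0"
      using tendsto_sum[of Basis, OF coord] by simp
    show "\<forall>\<^sub>F n in sequentially. (LINT x|lborel. indicator H x * norm (?D n x)) \<le>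
        (\<Sum>j\<in>Basis. LINT x|lborel. indicator H x * \<bar>?D n x \<bullet> j\<bar>)"
    proof (intro always_eventually allI)
      fix n
      have int: "integrable lborel (\<lambda>x. indicator H x * \<bar>?D n x \<bullet> j\<bar>)" for j
        using D[of n] by (intro intH integrable_abs) auto
      have "(LINT x|lborel. indicator H x * norm (?D n x)) \<le> (LINT x|lborel. (\<Sum>j\<in>Basis. indicator H x * \<bar>?D n x \<bullet> j\<bar>))"
      proof (rule integral_mono)
        show "integrable lborel (\<lambda>x. indicator H x * norm (?D n x))"
          using D[of n] by (intro intH integrable_norm)
        show "indicator H x * norm (?D n x) \<le> (\<Sum>j\<in>Basis. indicator H x * \<bar>?D n x \<bullet> j\<bar>)" for x
          unfolding sum_distrib_left[symmetric] by (intro mult_left_mono norm_le_l1) auto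
      qed (rule Bochner_Integration.integrable_sum[OF int])
      also have "\<dots> = (\<Sum>j\<in>Basis. LINT x|lborel. indicator H x * \<bar>?D n x \<bullet> j\<bar>)"
        using int by (rule Bochner_Integration.integral_sum)
      finally show "(LINT x|lborel. indicator H x * norm (?D n x)) \<le>
        (\<Sum>j\<in>Basis. LINT x|lborel. indicator H x * \<bar>?D n x \<bullet> j\<bar>)" .
    qed
  qed (auto intro!: always_eventually integral_nonneg_AE)
qed

context convex_lipschitz
begin

lemma integrable_comp:
  "integrable M a \<Longrightarrow> integrable M (\<lambda>x. f (a x))"
  by (rule Bochner_Integration.integrable_bound[of _ "\<lambda>x. L * norm (a x)"])
     (auto intro!: AE_I2 order.trans[OF lipschitz_zero] measurable_compose[OF _ measurable])

lemma integrable_dir_deriv: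
  assumes "integrable M a" "integrable M b"
  shows "integrable M (\<lambda>x. dir_deriv f (a x) (b x))"
proof (rule Bochner_Integration.integrable_bound[of _ "\<lambda>x. L * norm (b x)"])
  show "AE x in M. norm (dir_deriv f (a x) (b x)) \<le> norm (L * norm (b x))"
    by (intro AE_I2) (metis abs_ge_self dir_deriv_bound order.trans real_norm_def)
qed (use assms in \<open>auto intro: dir_deriv_measurable\<close>)

text \<open>At step \<open>t n\<close> the quotient of \<open>f \<circ> a\<close> is at least the
  derivative in the direction \<open>D n\<close> of the actual increment. Exchanging
  \<open>D n\<close> for \<open>b\<close> costs at most L \<bar>D n - b\<bar>, which vanishes in the
  mean, and \<open>\<phi> \<ge> 0\<close> preserves the inequality.\<close>

lemma weak_derivative_one_sided:
  fixes a b :: "real^'m \<Rightarrow> 'v"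
  assumes a: "integrable lborel a" and b: "integrable lborel b"
    and weak: "\<And>\<phi>. \<phi> \<in> test_functions G \<Longrightarrow>
      (LINT x|lborel. (\<sigma> * partial_deriv i \<phi> x) *\<^sub>R a x) = - (LINT x|lborel. \<phi> x *\<^sub>R b x)"
    and H: "open H" "\<And>x s. x \<in> H \<Longrightarrow> 0 \<le> s \<Longrightarrow> s \<le> \<tau> \<Longrightarrow> x + (s * \<sigma>) *\<^sub>R axis i 1 \<in> G" "\<tau> > 0"
    and \<phi>: "\<phi> \<in> test_functions H" "\<And>x. 0 \<le> \<phi> x"
  shows "(LINT x|lborel. \<phi> x * dir_deriv f (a x) (b x)) \<le> - (LINT x|lborel. \<sigma> * partial_deriv i \<phi> x * f (a x))"
proof -
  define v :: "real^'m" where "v = \<sigma> *\<^sub>R axis i 1"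
  have v: "(s * \<sigma>) *\<^sub>R axis i 1 = s *\<^sub>R v" for s by (simp add: v_def)
  \<comment> \<open>The steps remain in (0, \<tau>], so segments starting in \<open>H\<close> remain
    in \<open>G\<close>.\<close>
  define t where "t n = \<tau> / real (Suc n)" for n
  have t: "0 < t n" "t n \<le> \<tau>" for n
    using H(3) by (auto simp: t_def field_simps mult_le_cancel_left1)
  have t0: "t \<longlonglongrightarrow> 0"
    using tendsto_mult[OF tendsto_const[of \<tau>] LIMSEQ_inverse_real_of_nat]
    unfolding t_def by (simp add: divide_inverse)
  define D where "D n x = (1 / t n) *\<^sub>R (a (x + t n *\<^sub>R v) - a x)" for n x
  have atr: "integrable lborel (\<lambda>x. a (x + w))" for w
    using a by (simp add: lborel_integral_translate(2))
  have D: "integrable lborel (D n)" for n unfolding D_def using atr a by auto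
  have u: "integrable lborel (\<lambda>x. f (a x))" "integrable lborel (\<lambda>x. f (a (x + w)))" for w
    using integrable_comp a atr by auto
  obtain M where M: "M > 0" "\<And>x. \<bar>\<phi> x\<bar> \<le> M" using test_functions_bounded[OF \<phi>(1)] by metis
  define h where "h r = (LINT x|lborel. \<phi> (x - r *\<^sub>R v) * f (a x))" for r
  have h: "h r = (LINT x|lborel. \<phi> x * f (a (x + r *\<^sub>R v)))" for r
    unfolding h_def using lborel_integral_translate(1)[of "\<lambda>x. \<phi> (x - r *\<^sub>R v) * f (a x)" "r *\<^sub>R v"] by simp
  have "(h has_real_derivative - (LINT x|lborel. \<sigma> * partial_deriv i \<phi> x * f (a x))) (at 0)"
    using translated_test_function_derivative[OF \<phi>(1) u(1), of \<sigma> i 0] unfolding v h_def by simp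
  then have "((\<lambda>s. (h (0 + s) - h 0) / s) \<longlongrightarrow> - (LINT x|lborel. \<sigma> * partial_deriv i \<phi> x * f (a x))) (at 0)"
    unfolding DERIV_def .
  moreover have "filterlim t (at 0) sequentially"
    using t0 t(1) by (auto simp: filterlim_at intro!: always_eventually) (metis less_irrefl)
  ultimately have lim1: "(\<lambda>n. (h (t n) - h 0) / t n) \<longlonglongrightarrow> - (LINT x|lborel. \<sigma> * partial_deriv i \<phi> x * f (a x))"
    using filterlim_compose by fastforce
  define E where "E n = (LINT x|lborel. indicator H x * norm (D n x - b x))" for n
  have E: "E \<longlonglongrightarrow> 0"
    using difference_quotient_L1[OF a b weak H(1,2) t t0] unfolding E_def D_def v by simp
  note int = integrable_test_function_mult(1)[OF \<phi>(1)]
  have intH: "integrable lborel (\<lambda>x. indicator H x * norm (D n x - b x))" for n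
    using integrable_real_mult_indicator[of H lborel "\<lambda>x. norm (D n x - b x)"] H(1) D[of n] b
    by (simp add: mult.commute)
  have le: "(LINT x|lborel. \<phi> x * dir_deriv f (a x) (b x)) - \<bar>L\<bar> * M * E n \<le> (h (t n) - h 0) / t n" for n
  proof -
    have "(LINT x|lborel. \<phi> x * dir_deriv f (a x) (b x)) - \<bar>L\<bar> * M * E n =
       (LINT x|lborel. \<phi> x * dir_deriv f (a x) (b x) - \<bar>L\<bar> * M * (indicator H x * norm (D n x - b x)))"
      unfolding E_def using int[OF integrable_dir_deriv[OF a b]] intH[of n] by simp
    also have "\<dots> \<le> (LINT x|lborel. (\<phi> x * f (a (x + t n *\<^sub>R v)) - \<phi> x * f (a x)) / t n)"
    proof (rule integral_mono)
      fix x
      show "\<phi> x * dir_deriv f (a x) (b x) - \<bar>L\<bar> * M * (indicator H x * norm (D n x - b x)) \<le>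
         (\<phi> x * f (a (x + t n *\<^sub>R v)) - \<phi> x * f (a x)) / t n"
      proof (cases "x \<in> H")
        case False
        then have "\<phi> x = 0" using \<phi>(1) by (auto simp: test_functions_iff)
        then show ?thesis using False by simp
      next
        case True
        have "dir_deriv f (a x) (D n x) \<le> (f (a x + t n *\<^sub>R D n x) - f (a x)) / t n"
          using t by (intro dir_deriv_le)
        also have "a x + t n *\<^sub>R D n x = a (x + t n *\<^sub>R v)"
          using t(1)[of n] by (simp add: D_def)
        finally have 1: "dir_deriv f (a x) (D n x) \<le> (f (a (x + t n *\<^sub>R v)) - f (a x)) / t n" .
        have 2: "dir_deriv f (a x) (b x) \<le> dir_deriv f (a x) (D n x) + \<bar>L\<bar> * norm (D n x - b x)"
        proof -
          have "L * norm (D n x - b x) \<le> \<bar>L\<bar> * norm (D n x - b x)" by (intro mult_right_mono) auto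
          then show ?thesis using dir_deriv_lipschitz[of "a x" "D n x" "b x"] by linarith
        qed
        have "\<phi> x * dir_deriv f (a x) (b x) \<le>
            \<phi> x * ((f (a (x + t n *\<^sub>R v)) - f (a x)) / t n + \<bar>L\<bar> * norm (D n x - b x))"
          using 1 2 \<phi>(2) by (intro mult_left_mono) auto
        also have "\<dots> = \<phi> x * (f (a (x + t n *\<^sub>R v)) - f (a x)) / t n + \<phi> x * (\<bar>L\<bar> * norm (D n x - b x))"
          by (simp add: distrib_left)
        also have "\<dots> \<le> \<phi> x * (f (a (x + t n *\<^sub>R v)) - f (a x)) / t n + M * (\<bar>L\<bar> * norm (D n x - b x))"
          using M(2)[of x] by (intro add_left_mono mult_right_mono) auto
        finally show ?thesis using True by (simp add: right_diff_distrib mult_ac)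
      qed
    qed (use int[OF integrable_dir_deriv[OF a b]] intH[of n] int[OF u(1)] int[OF u(2)] in
          \<open>auto intro!: Bochner_Integration.integrable_diff integrable_mult_right integrable_divide_zero\<close>)
    also have "\<dots> = (h (t n) - h 0) / t n"
      unfolding h using int[OF u(2)] int[OF u(1)] by simp
    finally show ?thesis .
  qed
  have "(\<lambda>n. (LINT x|lborel. \<phi> x * dir_deriv f (a x) (b x)) - \<bar>L\<bar> * M * E n) \<longlonglongrightarrow>
      (LINT x|lborel. \<phi> x * dir_deriv f (a x) (b x)) - \<bar>L\<bar> * M * 0"
    by (intro tendsto_intros E)
  from LIMSEQ_le[OF this lim1] le show ?thesis by auto
qed

end

lemma AE_eq_0_if_integral_nonpos:
  fixes g :: "'a \<Rightarrow> real"
  assumes "integrable M g" "\<And>x. 0 \<le> g x" "integral\<^sup>L M g \<le> 0"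
  shows "AE x in M. g x = 0"
proof -
  have "integral\<^sup>L M g = 0"
    using assms(2,3) by (intro order.antisym integral_nonneg_AE) auto
  then show ?thesis
    using integral_nonneg_eq_0_iff_AE[OF assms(1)] assms(2) by simp
qed

text \<open>Provides the room for translations that the difference quotients need.\<close>

lemma test_functions_neighbourhood:
  fixes \<phi> :: "real^'m \<Rightarrow> real"
  assumes "\<phi> \<in> test_functions G" "open G"
  obtains H \<tau> where "open H" "\<phi> \<in> test_functions H" "\<tau> > 0"
    "\<And>x y. x \<in> H \<Longrightarrow> norm y \<le> \<tau> \<Longrightarrow> x + y \<in> G"
proof -
  obtain K where K: "smooth_fun \<phi>" "compact K" "K \<subseteq> G" "\<And>x. x \<notin> K \<Longrightarrow> \<phi> x = 0"
    using assms(1) unfolding test_functions_iff by blast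
  obtain e where e: "e > 0" "(\<Union>x\<in>K. cball x e) \<subseteq> G"
    using compact_subset_open_imp_cball_epsilon_subset[OF K(2) assms(2) K(3)] by blast
  show thesis
  proof (rule that[of "\<Union>x\<in>K. ball x (e / 2)" "e / 2"])
    show "\<phi> \<in> test_functions (\<Union>x\<in>K. ball x (e / 2))"
      unfolding test_functions_iff using K e by (intro conjI exI[of _ K]) force+
    fix x y :: "real^'m" assume x: "x \<in> (\<Union>x\<in>K. ball x (e / 2))" and y: "norm y \<le> e / 2"
    then obtain z where z: "z \<in> K" "dist z x < e / 2" by auto
    have "dist z (x + y) \<le> dist z x + norm y"
      by (metis add_diff_cancel_left' dist_norm dist_triangle norm_minus_commute)
    then have "x + y \<in> cball z e" using z y by simp
    then show "x + y \<in> G" using e(2) z(1) by blast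
  qed (use e in auto)
qed

context convex_lipschitz
begin

text \<open>Added together, the bounds for the directions b and -b say that a pointwise nonnegative
  function has nonpositive integrals against nonnegative test functions, hence vanishes on
  \<open>G\<close>. The one-sided bounds then become equations.\<close>

lemma weak_derivative_chain_rule:
  fixes a b :: "real^'m \<Rightarrow> 'v"
  assumes a: "integrable lborel a" and b: "integrable lborel b" and G: "open G"
    and weak: "\<And>\<phi>. \<phi> \<in> test_functions G \<Longrightarrow>
      (LINT x|lborel. partial_deriv i \<phi> x *\<^sub>R a x) = - (LINT x|lborel. \<phi> x *\<^sub>R b x)"
  shows "AE x in lborel. x \<in> G \<longrightarrow> dir_deriv f (a x) (b x) + dir_deriv f (a x) (- b x) = 0"
    and "\<phi> \<in> test_functions G \<Longrightarrow>
      (LINT x|lborel. partial_deriv i \<phi> x * f (a x)) = - (LINT x|lborel. \<phi> x * dir_deriv f (a x) (b x))"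
proof -
  let ?d = "\<lambda>x. dir_deriv f (a x) (b x)" and ?m = "\<lambda>x. dir_deriv f (a x) (- b x)"
  have d: "integrable lborel ?d" and m: "integrable lborel ?m" and u: "integrable lborel (\<lambda>x. f (a x))"
    using a b integrable_dir_deriv[of _ a b] integrable_dir_deriv[of _ a "\<lambda>x. - b x"] integrable_comp by auto
  note int = integrable_test_function_mult(1)
  have one_sided: "(LINT x|lborel. \<phi> x * ?d x) \<le> - (LINT x|lborel. partial_deriv i \<phi> x * f (a x))"
      "(LINT x|lborel. \<phi> x * ?m x) \<le> (LINT x|lborel. partial_deriv i \<phi> x * f (a x))"
    if \<phi>: "\<phi> \<in> test_functions G" "\<And>x. 0 \<le> \<phi> x" for \<phi>
  proof -
    obtain H \<tau> where H: "open H" "\<phi> \<in> test_functions H" "\<tau> > 0"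
      "\<And>x y. x \<in> H \<Longrightarrow> norm y \<le> \<tau> \<Longrightarrow> x + y \<in> G"
      using test_functions_neighbourhood[OF \<phi>(1) G] by metis
    show "(LINT x|lborel. \<phi> x * ?d x) \<le> - (LINT x|lborel. partial_deriv i \<phi> x * f (a x))"
      using weak_derivative_one_sided[OF a b, of G 1 i H \<tau> \<phi>] weak H \<phi>(2) by simp
    \<comment> \<open>The choice \<sigma> = -1 reverses the coordinate direction; the weak
      derivative along it is \<open>- b\<close>.\<close>
    have "(LINT x|lborel. \<phi> x * ?m x) \<le> - (LINT x|lborel. - 1 * partial_deriv i \<phi> x * f (a x))"
    proof (rule weak_derivative_one_sided[OF a, where G = G and H = H and \<tau> = \<tau> and b = "\<lambda>x. - b x"])
      show "(LINT x|lborel. (- 1 * partial_deriv i \<phi> x) *\<^sub>R a x) = - (LINT x|lborel. \<phi> x *\<^sub>R - b x)"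
        if "\<phi> \<in> test_functions G" for \<phi>
        using weak[OF that] by simp
      show "x + (s * - 1) *\<^sub>R axis i 1 \<in> G" if "x \<in> H" "0 \<le> s" "s \<le> \<tau>" for x s
        using that by (intro H(4)) simp_all
    qed (use H \<phi>(2) b in auto)
    then show "(LINT x|lborel. \<phi> x * ?m x) \<le> (LINT x|lborel. partial_deriv i \<phi> x * f (a x))"
      by simp
  qed
  show ae: "AE x in lborel. x \<in> G \<longrightarrow> ?d x + ?m x = 0"
  proof -
    have Gm: "G \<in> sets borel" using G by simp
    have int0: "integrable lborel (\<lambda>x. indicator G x * max 0 (?d x + ?m x))"
      using integrable_real_mult_indicator[of G lborel "\<lambda>x. max 0 (?d x + ?m x)"] Gm d m by (simp add: mult.commute)
    have "(LINT x|lborel. indicator G x * max 0 (?d x + ?m x)) \<le> 0"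
    proof (rule test_functions_bound_positive_part[OF _ G])
      fix \<phi> assume \<phi>: "\<phi> \<in> test_functions G" "\<And>x. 0 \<le> \<phi> x"
      show "(LINT x|lborel. \<phi> x * (?d x + ?m x)) \<le> 0"
        using one_sided[OF \<phi>] int[OF \<phi>(1) d] int[OF \<phi>(1) m] by (simp add: distrib_left)
    qed (use d m in auto)
    then have "AE x in lborel. indicator G x * max 0 (?d x + ?m x) = 0"
      by (intro AE_eq_0_if_integral_nonpos[OF int0]) auto
    then show ?thesis
    proof eventually_elim
      case (elim x)
      then show ?case using dir_deriv_add_minus_nonneg[of "a x" "b x"] by (auto simp: max_def split: if_splits)
    qed
  qed
  have eq: "(LINT x|lborel. partial_deriv i \<phi> x * f (a x)) = - (LINT x|lborel. \<phi> x * ?d x)"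
    if \<phi>: "\<phi> \<in> test_functions G" "\<And>x. 0 \<le> \<phi> x" for \<phi>
  proof -
    have "(LINT x|lborel. \<phi> x * ?m x) = (LINT x|lborel. - (\<phi> x * ?d x))"
    proof (rule integral_cong_AE)
      show "AE x in lborel. \<phi> x * ?m x = - (\<phi> x * ?d x)"
        using ae
      proof eventually_elim
        case (elim x)
        show ?case
        proof (cases "x \<in> G")
          case True
          then have "?m x = - ?d x" using elim by simp
          then show ?thesis by simp
        next
          case False
          then have "\<phi> x = 0" using \<phi>(1) by (auto simp: test_functions_iff)
          then show ?thesis by simp
        qed
      qed
    qed (use int[OF \<phi>(1) d] int[OF \<phi>(1) m] in \<open>auto dest: borel_measurable_integrable\<close>)
    then show ?thesis using one_sided[OF \<phi>] by simp
  qed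
  assume \<phi>: "\<phi> \<in> test_functions G"
  obtain K where K: "compact K" "K \<subseteq> G" "\<And>x. x \<notin> K \<Longrightarrow> \<phi> x = 0"
    using \<phi> unfolding test_functions_iff by blast
  obtain M where M: "M > 0" "\<And>x. \<bar>\<phi> x\<bar> \<le> M" using test_functions_bounded[OF \<phi>] by metis
  obtain \<eta> where \<eta>: "\<eta> \<in> test_functions G" "\<And>x. 0 \<le> \<eta> x" "\<And>x. x \<in> K \<Longrightarrow> 1 - 1/2 \<le> \<eta> x"
    using test_function_near_1_on_compact[OF K(1) G K(2), of "1/2"] by (metis half_gt_zero_iff zero_less_one)
  \<comment> \<open>A signed test function is the difference of two nonnegative ones: on
    \<open>K\<close> the function \<open>\<eta>\<close> is at least 1/2, so
    \<open>2 * M * \<eta>\<close> dominates \<bar>\<phi>\<bar>.\<close>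
  let ?\<psi> = "\<lambda>x. \<phi> x + (2 * M) * \<eta> x"
  have \<psi>: "?\<psi> \<in> test_functions G" by (rule test_functions_lincomb[OF \<phi> \<eta>(1)])
  have "0 \<le> ?\<psi> x" for x
  proof (cases "x \<in> K")
    case True
    then have "2 * M * (1/2) \<le> 2 * M * \<eta> x" using \<eta>(3)[of x] M by (intro mult_left_mono) auto
    then show ?thesis using M(2)[of x] by linarith
  next
    case False
    then show ?thesis using K(3) \<eta>(2)[of x] M by simp
  qed
  note eq' = eq[OF \<psi> this]
  have pd: "partial_deriv i ?\<psi> x = partial_deriv i \<phi> x + (2 * M) * partial_deriv i \<eta> x" for x
    by (rule partial_deriv_lincomb) (use \<phi> \<eta>(1) in \<open>auto simp: test_functions_iff\<close>)
  from eq'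
  have "(LINT x|lborel. partial_deriv i \<phi> x * f (a x) + 2 * M * (partial_deriv i \<eta> x * f (a x)))
      = - (LINT x|lborel. \<phi> x * ?d x + 2 * M * (\<eta> x * ?d x))"
    unfolding pd by (simp only: distrib_right mult.assoc)
  then have "(LINT x|lborel. partial_deriv i \<phi> x * f (a x)) + 2 * M * (LINT x|lborel. partial_deriv i \<eta> x * f (a x))
      = - ((LINT x|lborel. \<phi> x * ?d x) + 2 * M * (LINT x|lborel. \<eta> x * ?d x))"
    using int[OF test_functions_partial_deriv[OF \<phi>] u] int[OF test_functions_partial_deriv[OF \<eta>(1)] u]
      int[OF \<phi> d] int[OF \<eta>(1) d] by simp
  then show "(LINT x|lborel. partial_deriv i \<phi> x * f (a x)) = - (LINT x|lborel. \<phi> x * ?d x)"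
    using eq[OF \<eta>(1,2)] by simp
qed

end

section \<open>Calculus of weak partial derivatives\<close>

lemma lebesgue_integrable_borel_version:
  fixes f :: "'n::euclidean_space \<Rightarrow> 'v::euclidean_space"
  assumes f: "integrable lebesgue f"
  obtains g where "integrable lborel g" "AE x in lborel. f x = g x"
proof -
  have "\<exists>g. g \<in> borel_measurable lborel \<and> (AE x in lborel. f x \<bullet> j = g x)" for j
    using completion_ex_borel_measurable_real[of "\<lambda>x. f x \<bullet> j" lborel] f by (auto dest: borel_measurable_integrable)
  then obtain g where g: "\<And>j. g j \<in> borel_measurable lborel" "\<And>j. AE x in lborel. f x \<bullet> j = g j x"
    by metis
  define h where "h x = (\<Sum>j\<in>Basis. g j x *\<^sub>R j)" for x
  have hm: "h \<in> borel_measurable lborel" unfolding h_def using g(1) by measurable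
  have "AE x in lborel. \<forall>j\<in>Basis. f x \<bullet> j = g j x"
    using g(2) by (intro AE_finite_allI) auto
  then have ae: "AE x in lborel. f x = h x"
  proof eventually_elim
    case (elim x)
    have "h x = (\<Sum>j\<in>Basis. (f x \<bullet> j) *\<^sub>R j)"
      unfolding h_def using elim by (intro sum.cong) auto
    then show ?case by (simp only: euclidean_representation)
  qed
  have hl: "h \<in> borel_measurable lebesgue" using hm by (rule measurable_completion)
  have "AE x in lebesgue. f x = h x" using ae by (simp add: AE_completion_iff)
  then have "integrable lebesgue h"
    using f hl integrable_cong_AE[of f lebesgue h] by (auto dest: borel_measurable_integrable)
  then have "integrable lborel h" using integrable_completion[OF hm] by simp
  with ae that show thesis by blast
qed

text \<open>Cutting off at \<open>K\<close> gives a globally integrable Borel function, to which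
  translations can be applied.\<close>

lemma absolutely_integrable_borel_version:
  fixes f :: "'n::euclidean_space \<Rightarrow> 'v::euclidean_space"
  assumes "f absolutely_integrable_on K"
  obtains g where "integrable lborel g" "AE x in lborel. x \<in> K \<longrightarrow> f x = g x"
proof -
  obtain g where g: "integrable lborel g" "AE x in lborel. indicator K x *\<^sub>R f x = g x"
    using lebesgue_integrable_borel_version assms unfolding set_integrable_def by blast
  from g(2) have "AE x in lborel. x \<in> K \<longrightarrow> f x = g x" by eventually_elim auto
  with g(1) that show thesis by blast
qed

text \<open>Transfers the integrals of \<open>has_weak_partial\<close> to \<open>lborel\<close>.
  Outside \<open>K\<close> the functions \<open>g\<close> and \<open>g'\<close> are unrelated, but
  \<open>\<phi>\<close> vanishes there.\<close>

lemma lebesgue_on_integral_eq_lborel: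
  fixes g g' :: "'n::euclidean_space \<Rightarrow> 'v::euclidean_space" and \<phi> :: "'n \<Rightarrow> real"
  assumes U: "U \<in> sets lebesgue" and K: "K \<subseteq> U" and \<phi>: "\<phi> \<in> borel_measurable borel" "\<And>x. x \<notin> K \<Longrightarrow> \<phi> x = 0"
    and g': "g' \<in> borel_measurable borel" "AE x in lborel. x \<in> K \<longrightarrow> g x = g' x"
  shows "(LINT x|lebesgue_on U. \<phi> x *\<^sub>R g x) = (LINT x|lborel. \<phi> x *\<^sub>R g' x)"
proof -
  have m: "(\<lambda>x. \<phi> x *\<^sub>R g' x) \<in> borel_measurable lborel" using \<phi>(1) g'(1) by measurable
  have ml: "(\<lambda>x. \<phi> x *\<^sub>R g' x) \<in> borel_measurable lebesgue" using m by (rule measurable_completion)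
  have "AE x in lborel. \<phi> x *\<^sub>R g' x = indicator U x *\<^sub>R (\<phi> x *\<^sub>R g x)"
    using g'(2) by eventually_elim (use \<phi>(2) K in \<open>auto simp: indicator_def\<close>)
  then have ae: "AE x in lebesgue. \<phi> x *\<^sub>R g' x = indicator U x *\<^sub>R (\<phi> x *\<^sub>R g x)"
    by (simp only: AE_completion_iff)
  have "(LINT x|lebesgue_on U. \<phi> x *\<^sub>R g x) = (LINT x|lebesgue. indicator U x *\<^sub>R (\<phi> x *\<^sub>R g x))"
    using U by (intro integral_restrict_space) auto
  also have "\<dots> = (LINT x|lebesgue. \<phi> x *\<^sub>R g' x)"
    using ae borel_measurable_AE[OF ml ae] ml by (intro integral_cong_AE) auto
  also have "\<dots> = (LINT x|lborel. \<phi> x *\<^sub>R g' x)"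
    by (rule integral_completion[OF m])
  finally show ?thesis .
qed

text \<open>Countably many interiors of compact subsets cover \<open>U\<close>, so their exceptional
  null sets can be united. On each piece, locally integrable functions are integrable.\<close>

lemma AE_lebesgue_on_exhaustI:
  fixes U :: "'n::euclidean_space set"
  assumes U: "open U"
    and P: "\<And>G K. open G \<Longrightarrow> compact K \<Longrightarrow> G \<subseteq> K \<Longrightarrow> K \<subseteq> U \<Longrightarrow> AE x in lborel. x \<in> G \<longrightarrow> P x"
  shows "AE x in lebesgue_on U. P x"
proof -
  obtain C where C: "\<And>n::nat. compact (C n)" "\<And>n. C n \<subseteq> U" "\<And>n. C n \<subseteq> interior (C (Suc n))" "\<Union>(range C) = U"
    using open_Union_compact_subsets[OF U] by metis
  have "AE x in lborel. \<forall>n. x \<in> interior (C (Suc n)) \<longrightarrow> P x"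
    unfolding AE_all_countable
  proof
    fix n show "AE x in lborel. x \<in> interior (C (Suc n)) \<longrightarrow> P x"
      by (rule P[of _ "C (Suc n)"]) (use C interior_subset in \<open>blast+\<close>)
  qed
  then have "AE x in lborel. x \<in> U \<longrightarrow> P x"
    by eventually_elim (use C(3,4) in blast)
  then have "AE x in lebesgue. x \<in> U \<longrightarrow> P x" by (simp add: AE_completion_iff)
  then show ?thesis using U by (simp add: AE_restrict_space_iff)
qed

lemma test_functions_exhaust:
  fixes U :: "(real^'m) set"
  assumes U: "open U" and \<phi>: "\<phi> \<in> test_functions U"
  obtains G K where "open G" "compact K" "G \<subseteq> K" "K \<subseteq> U" "\<phi> \<in> test_functions G"
proof -
  obtain C where C: "\<And>n::nat. compact (C n)" "\<And>n. C n \<subseteq> U" "\<And>n. C n \<subseteq> interior (C (Suc n))"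
      "\<And>K. compact K \<Longrightarrow> K \<subseteq> U \<Longrightarrow> \<exists>N. \<forall>n\<ge>N. K \<subseteq> C n"
    using open_Union_compact_subsets[OF U] by metis
  obtain K where K: "smooth_fun \<phi>" "compact K" "K \<subseteq> U" "\<And>x. x \<notin> K \<Longrightarrow> \<phi> x = 0"
    using \<phi> unfolding test_functions_iff by blast
  obtain N where "K \<subseteq> C N" using C(4)[OF K(2,3)] by blast
  then have "\<phi> \<in> test_functions (interior (C (Suc N)))"
    unfolding test_functions_iff using K C(3)[of N] by blast
  then show thesis using that[of "interior (C (Suc N))" "C (Suc N)"] C interior_subset by blast
qed

lemma locally_integrable_test_function:
  fixes f :: "real^'m \<Rightarrow> 'v::euclidean_space"
  assumes U: "open U" and \<phi>: "\<phi> \<in> test_functions U" and f: "locally_integrable U f"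
  shows "integrable (lebesgue_on U) (\<lambda>x. \<phi> x *\<^sub>R f x)"
proof -
  obtain K where K: "compact K" "K \<subseteq> U" "\<And>x. x \<notin> K \<Longrightarrow> \<phi> x = 0"
    using \<phi> unfolding test_functions_iff by blast
  obtain M where M: "M > 0" "\<And>x. \<bar>\<phi> x\<bar> \<le> M" using test_functions_bounded[OF \<phi>] by metis
  have fK: "integrable lebesgue (\<lambda>x. indicator K x *\<^sub>R f x)"
    using f K unfolding locally_integrable_def set_integrable_def by blast
  have \<phi>m: "\<phi> \<in> borel_measurable lebesgue"
    using test_functions_measurable[OF \<phi>] by (auto intro: measurable_completion)
  have "integrable lebesgue (\<lambda>x. \<phi> x *\<^sub>R (indicator K x *\<^sub>R f x))"
  proof (rule Bochner_Integration.integrable_bound[of _ "\<lambda>x. M * norm (indicator K x *\<^sub>R f x)"])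
    show "integrable lebesgue (\<lambda>x. M * norm (indicator K x *\<^sub>R f x))"
      using fK by (intro integrable_mult_right integrable_norm)
    show "(\<lambda>x. \<phi> x *\<^sub>R (indicator K x *\<^sub>R f x)) \<in> borel_measurable lebesgue"
      by (rule borel_measurable_scaleR[OF \<phi>m borel_measurable_integrable[OF fK]])
    show "AE x in lebesgue. norm (\<phi> x *\<^sub>R (indicator K x *\<^sub>R f x)) \<le> norm (M * norm (indicator K x *\<^sub>R f x))"
    proof (intro AE_I2)
      fix x
      have "\<bar>\<phi> x\<bar> * norm (indicator K x *\<^sub>R f x) \<le> M * norm (indicator K x *\<^sub>R f x)"
        using M(2) by (intro mult_right_mono) auto
      then show "norm (\<phi> x *\<^sub>R (indicator K x *\<^sub>R f x)) \<le> norm (M * norm (indicator K x *\<^sub>R f x))"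
        using M(1) by (simp add: abs_mult mult.assoc)
    qed
  qed
  moreover have "(\<lambda>x. \<phi> x *\<^sub>R (indicator K x *\<^sub>R f x)) = (\<lambda>x. indicator U x *\<^sub>R (\<phi> x *\<^sub>R f x))"
    using K(2,3) by (auto simp: indicator_def fun_eq_iff)
  ultimately have "integrable lebesgue (\<lambda>x. indicator U x *\<^sub>R (\<phi> x *\<^sub>R f x))" by (simp only:)
  then show ?thesis using U by (subst integrable_restrict_space) auto
qed

text \<open>Cut-offs along a compact exhaustion are measurable and converge pointwise.\<close>

lemma locally_integrable_measurable:
  fixes f :: "real^'m \<Rightarrow> 'v::euclidean_space"
  assumes U: "open U" and f: "locally_integrable U f"
  shows "f \<in> borel_measurable (lebesgue_on U)"
proof -
  obtain C where C: "\<And>n::nat. compact (C n)" "\<And>n. C n \<subseteq> U"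
      "\<And>K. compact K \<Longrightarrow> K \<subseteq> U \<Longrightarrow> \<exists>N. \<forall>n\<ge>N. K \<subseteq> C n"
    using open_Union_compact_subsets[OF U] by metis
  have "(\<lambda>x. indicator U x *\<^sub>R f x) \<in> borel_measurable lebesgue"
  proof (rule borel_measurable_LIMSEQ_metric)
    show "(\<lambda>x. indicator (C n) x *\<^sub>R f x) \<in> borel_measurable lebesgue" for n
      using f C unfolding locally_integrable_def set_integrable_def by (blast intro: borel_measurable_integrable)
    show "(\<lambda>n. indicator (C n) x *\<^sub>R f x) \<longlonglongrightarrow> indicator U x *\<^sub>R f x" for x
    proof (cases "x \<in> U")
      case True
      then obtain N where "\<forall>n\<ge>N. {x} \<subseteq> C n" using C(3)[of "{x}"] by auto
      then have "\<forall>\<^sub>F n in sequentially. indicator (C n) x *\<^sub>R f x = indicator U x *\<^sub>R f x"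
        unfolding eventually_sequentially using True by (intro exI[of _ N]) auto
      then show ?thesis by (rule tendsto_eventually)
    next
      case False
      then have "x \<notin> C n" for n using C(2) by blast
      then show ?thesis using False by simp
    qed
  qed
  then show ?thesis using U by (simp add: borel_measurable_restrict_space_iff)
qed

section \<open>Linearity and uniqueness of weak derivatives\<close>

lemma locally_integrable_bounded_linear:
  assumes "bounded_linear T" "locally_integrable U f"
  shows "locally_integrable U (\<lambda>x. T (f x))"
  unfolding locally_integrable_def set_integrable_def
proof (intro allI impI)
  fix K assume "compact K \<and> K \<subseteq> U"
  then have "integrable lebesgue (\<lambda>x. indicator K x *\<^sub>R f x)"
    using assms(2) unfolding locally_integrable_def set_integrable_def by blast
  from integrable_bounded_linear[OF assms(1) this]
  show "integrable lebesgue (\<lambda>x. indicator K x *\<^sub>R T (f x))"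
    by (simp add: linear_simps(5)[OF assms(1)])
qed

lemma locally_integrable_add:
  "locally_integrable U f \<Longrightarrow> locally_integrable U g \<Longrightarrow> locally_integrable U (\<lambda>x. f x + g x)"
  unfolding locally_integrable_def set_integrable_def by (auto simp: scaleR_add_right)

lemma has_weak_partialI:
  assumes "locally_integrable U f" "locally_integrable U g"
    "\<And>\<phi>. \<phi> \<in> test_functions U \<Longrightarrow>
      (LINT x|lebesgue_on U. partial_deriv i \<phi> x *\<^sub>R f x) = - (LINT x|lebesgue_on U. \<phi> x *\<^sub>R g x)"
  shows "has_weak_partial U i f g"
  using assms unfolding has_weak_partial_def by blast

lemma has_weak_partialD:
  assumes "has_weak_partial U i f g"
  shows "locally_integrable U f" "locally_integrable U g"
    "\<And>\<phi>. \<phi> \<in> test_functions U \<Longrightarrow>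
      (LINT x|lebesgue_on U. partial_deriv i \<phi> x *\<^sub>R f x) = - (LINT x|lebesgue_on U. \<phi> x *\<^sub>R g x)"
  using assms unfolding has_weak_partial_def by blast+

lemma has_weak_partial_bounded_linear:
  assumes U: "open U" and T: "bounded_linear T" and fg: "has_weak_partial U i f g"
  shows "has_weak_partial U i (\<lambda>x. T (f x)) (\<lambda>x. T (g x))"
proof (rule has_weak_partialI)
  fix \<phi> assume \<phi>: "\<phi> \<in> test_functions U"
  have *: "(LINT x|lebesgue_on U. \<psi> x *\<^sub>R T (h x)) = T (LINT x|lebesgue_on U. \<psi> x *\<^sub>R h x)"
    if "\<psi> \<in> test_functions U" "locally_integrable U h" for \<psi> h
    using integral_bounded_linear[OF T locally_integrable_test_function[OF U that]]
    by (simp add: linear_simps(5)[OF T])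
  show "(LINT x|lebesgue_on U. partial_deriv i \<phi> x *\<^sub>R T (f x)) = - (LINT x|lebesgue_on U. \<phi> x *\<^sub>R T (g x))"
    using *[OF test_functions_partial_deriv[OF \<phi>] has_weak_partialD(1)[OF fg]]
      *[OF \<phi> has_weak_partialD(2)[OF fg]] has_weak_partialD(3)[OF fg \<phi>]
    by (simp add: linear_neg[OF bounded_linear.linear[OF T]])
qed (intro locally_integrable_bounded_linear[OF T] has_weak_partialD[OF fg])+

lemma has_weak_partial_add:
  assumes U: "open U" and fg: "has_weak_partial U i f g" "has_weak_partial U i f' g'"
  shows "has_weak_partial U i (\<lambda>x. f x + f' x) (\<lambda>x. g x + g' x)"
proof (rule has_weak_partialI)
  fix \<phi> assume \<phi>: "\<phi> \<in> test_functions U"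
  note int = locally_integrable_test_function[OF U]
  show "(LINT x|lebesgue_on U. partial_deriv i \<phi> x *\<^sub>R (f x + f' x)) = - (LINT x|lebesgue_on U. \<phi> x *\<^sub>R (g x + g' x))"
    using int[OF test_functions_partial_deriv[OF \<phi>] has_weak_partialD(1)[OF fg(1)]]
      int[OF test_functions_partial_deriv[OF \<phi>] has_weak_partialD(1)[OF fg(2)]]
      int[OF \<phi> has_weak_partialD(2)[OF fg(1)]] int[OF \<phi> has_weak_partialD(2)[OF fg(2)]]
      has_weak_partialD(3)[OF fg(1) \<phi>] has_weak_partialD(3)[OF fg(2) \<phi>]
    by (simp add: scaleR_add_right)
qed (intro locally_integrable_add has_weak_partialD[OF fg(1)] has_weak_partialD[OF fg(2)])+

lemma has_weak_partial_diff:
  assumes U: "open U" and fg: "has_weak_partial U i f g" "has_weak_partial U i f' g'"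
  shows "has_weak_partial U i (\<lambda>x. f x - f' x) (\<lambda>x. g x - g' x)"
  using has_weak_partial_add[OF U fg(1) has_weak_partial_bounded_linear[OF U _ fg(2), of uminus]]
    bounded_linear_minus[OF bounded_linear_ident] by simp

lemma has_weak_partial_zero: "has_weak_partial U i (\<lambda>x. 0) (\<lambda>x. 0)"
  by (rule has_weak_partialI) (auto simp: locally_integrable_def)

lemma has_weak_partial_sum:
  assumes "open U" "\<And>k. k \<in> I \<Longrightarrow> has_weak_partial U i (f k) (g k)"
  shows "has_weak_partial U i (\<lambda>x. \<Sum>k\<in>I. f k x) (\<lambda>x. \<Sum>k\<in>I. g k x)"
  using assms(2)
  by (induction I rule: infinite_finite_induct) (auto intro: has_weak_partial_zero has_weak_partial_add[OF assms(1)])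

lemma has_weak_partial_cong:
  fixes f g :: "real^'m \<Rightarrow> 'v::euclidean_space"
  assumes "\<And>x. x \<in> U \<Longrightarrow> f x = f' x" "\<And>x. x \<in> U \<Longrightarrow> g x = g' x"
  shows "has_weak_partial U i f g \<longleftrightarrow> has_weak_partial U i f' g'"
proof -
  have l: "locally_integrable U h \<longleftrightarrow> locally_integrable U h'" if "\<And>x. x \<in> U \<Longrightarrow> h x = h' x"
    for h h' :: "real^'m \<Rightarrow> 'v"
  proof -
    have "(\<lambda>x. indicator K x *\<^sub>R h x) = (\<lambda>x. indicator K x *\<^sub>R h' x)" if "K \<subseteq> U" for K
      using that \<open>\<And>x. x \<in> U \<Longrightarrow> h x = h' x\<close> by (auto simp: indicator_def fun_eq_iff)
    then show ?thesis unfolding locally_integrable_def set_integrable_def by (metis (no_types, lifting))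
  qed
  have int: "(LINT x|lebesgue_on U. \<phi> x *\<^sub>R h x) = (LINT x|lebesgue_on U. \<phi> x *\<^sub>R h' x)"
    if "\<And>x. x \<in> U \<Longrightarrow> h x = h' x" for h h' :: "real^'m \<Rightarrow> 'v" and \<phi>
    using that by (intro Bochner_Integration.integral_cong) auto
  show ?thesis unfolding has_weak_partial_def
    using l[OF assms(1)] l[OF assms(2)] int[OF assms(1)] int[OF assms(2)] by auto
qed

text \<open>The duality bound with constant 0, applied to each coordinate of the difference. It
  makes the representative selected by \<open>weak_partial\<close> immaterial.\<close>

lemma has_weak_partial_unique:
  fixes f :: "real^'m \<Rightarrow> 'v::euclidean_space"
  assumes U: "open U" and "has_weak_partial U i f g" "has_weak_partial U i f h"
  shows "AE x in lebesgue_on U. g x = h x"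
proof (rule AE_lebesgue_on_exhaustI[OF U])
  fix G K :: "(real^'m) set" assume GK: "open G" "compact K" "G \<subseteq> K" "K \<subseteq> U"
  have lg: "locally_integrable U g" and lh: "locally_integrable U h"
    using assms has_weak_partialD(2) by blast+
  obtain g' where g': "integrable lborel g'" "AE x in lborel. x \<in> K \<longrightarrow> g x = g' x"
    using absolutely_integrable_borel_version lg GK unfolding locally_integrable_def by blast
  obtain h' where h': "integrable lborel h'" "AE x in lborel. x \<in> K \<longrightarrow> h x = h' x"
    using absolutely_integrable_borel_version lh GK unfolding locally_integrable_def by blast
  have zero: "AE x in lborel. indicator G x * \<bar>(g' x - h' x) \<bullet> j\<bar> = 0" for j
  proof -
    have int: "integrable lborel (\<lambda>x. (g' x - h' x) \<bullet> j)" using g' h' by simp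
    then have int2: "integrable lborel (\<lambda>x. indicator G x * \<bar>(g' x - h' x) \<bullet> j\<bar>)"
      using integrable_real_mult_indicator[of G lborel "\<lambda>x. \<bar>(g' x - h' x) \<bullet> j\<bar>"] GK(1) by (simp add: mult.commute)
    have "(LINT x|lborel. indicator G x * \<bar>(g' x - h' x) \<bullet> j\<bar>) \<le> 2 * 0"
    proof (rule test_functions_bound_abs[OF int GK(1)])
      fix \<phi> assume \<phi>: "\<phi> \<in> test_functions G"
      then have \<phi>U: "\<phi> \<in> test_functions U" using test_functions_mono GK by blast
      have \<phi>0: "\<phi> x = 0" if "x \<notin> K" for x
        using \<phi> that GK(3) by (auto simp: test_functions_iff)
      have "(LINT x|lborel. \<phi> x *\<^sub>R g' x) = (LINT x|lborel. \<phi> x *\<^sub>R h' x)"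
        using has_weak_partialD(3)[OF assms(2) \<phi>U] has_weak_partialD(3)[OF assms(3) \<phi>U]
          lebesgue_on_integral_eq_lborel[OF _ GK(4) test_functions_measurable[OF \<phi>] \<phi>0 _ g'(2)]
          lebesgue_on_integral_eq_lborel[OF _ GK(4) test_functions_measurable[OF \<phi>] \<phi>0 _ h'(2)]
          U g'(1) h'(1) by (simp add: borel_measurable_integrable)
      then have "(LINT x|lborel. \<phi> x *\<^sub>R (g' x - h' x)) = 0"
        using integrable_test_function_scaleR[OF \<phi> g'(1)] integrable_test_function_scaleR[OF \<phi> h'(1)]
        by (simp add: scaleR_diff_right)
      moreover have "(LINT x|lborel. (\<phi> x *\<^sub>R (g' x - h' x)) \<bullet> j) = (LINT x|lborel. \<phi> x *\<^sub>R (g' x - h' x)) \<bullet> j"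
        using integrable_test_function_scaleR[OF \<phi>, of "\<lambda>x. g' x - h' x"] g'(1) h'(1)
        by (intro integral_inner_left) auto
      ultimately show "\<bar>LINT x|lborel. \<phi> x * ((g' x - h' x) \<bullet> j)\<bar> \<le> 0" by simp
    qed
    then show ?thesis
      by (intro AE_eq_0_if_integral_nonpos[OF int2]) auto
  qed
  have "AE x in lborel. \<forall>j\<in>Basis. indicator G x * \<bar>(g' x - h' x) \<bullet> j\<bar> = 0"
    using zero by (intro AE_finite_allI) auto
  with g'(2) h'(2) show "AE x in lborel. x \<in> G \<longrightarrow> g x = h x"
  proof eventually_elim
    case (elim x)
    show ?case
    proof
      assume x: "x \<in> G"
      then have "\<forall>j\<in>Basis. (g' x - h' x) \<bullet> j = 0" using elim by simp
      then have "g' x - h' x = 0" by (rule euclidean_all_zero_iff[THEN iffD1])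
      then show "g x = h x" using elim x GK by auto
    qed
  qed
qed

section \<open>Chain rule for locally integrable functions\<close>

lemma (in convex_lipschitz) dir_deriv_zero: "dir_deriv f a 0 = 0"
  using dir_deriv_bound[of a 0] by simp

text \<open>Both claims are local: the almost everywhere identity through an exhaustion, the
  integral identity because each test function lives on one piece of it. There the chain rule for
  globally integrable functions applies.\<close>

theorem (in convex_lipschitz) has_weak_partial_comp:
  fixes A B :: "real^'m \<Rightarrow> 'v"
  assumes U: "open U" and AB: "has_weak_partial U i A B"
  shows "has_weak_partial U i (\<lambda>x. f (A x)) (\<lambda>x. dir_deriv f (A x) (B x))"
    and "AE x in lebesgue_on U. dir_deriv f (A x) (B x) + dir_deriv f (A x) (- B x) = 0"
proof -
  note lA = has_weak_partialD(1)[OF AB] and lB = has_weak_partialD(2)[OF AB]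
  have local_version: "\<exists>a b. integrable lborel a \<and> integrable lborel b \<and>
      (AE x in lborel. x \<in> K \<longrightarrow> A x = a x) \<and> (AE x in lborel. x \<in> K \<longrightarrow> B x = b x) \<and>
      (\<forall>\<phi>\<in>test_functions G. (LINT x|lborel. partial_deriv i \<phi> x *\<^sub>R a x) = - (LINT x|lborel. \<phi> x *\<^sub>R b x))"
    if GK: "open G" "compact K" "G \<subseteq> K" "K \<subseteq> U" for G K
  proof -
    obtain a where a: "integrable lborel a" "AE x in lborel. x \<in> K \<longrightarrow> A x = a x"
      using absolutely_integrable_borel_version lA GK unfolding locally_integrable_def by blast
    obtain b where b: "integrable lborel b" "AE x in lborel. x \<in> K \<longrightarrow> B x = b x"
      using absolutely_integrable_borel_version lB GK unfolding locally_integrable_def by blast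
    have "(LINT x|lborel. partial_deriv i \<phi> x *\<^sub>R a x) = - (LINT x|lborel. \<phi> x *\<^sub>R b x)"
      if \<phi>: "\<phi> \<in> test_functions G" for \<phi>
    proof -
      have \<phi>U: "\<phi> \<in> test_functions U" using \<phi> test_functions_mono GK by blast
      have 0: "\<psi> x = 0" if "x \<notin> K" "\<psi> \<in> test_functions G" for x \<psi>
        using that GK(3) by (auto simp: test_functions_iff)
      have "(LINT x|lebesgue_on U. \<phi> x *\<^sub>R B x) = (LINT x|lborel. \<phi> x *\<^sub>R b x)"
        by (rule lebesgue_on_integral_eq_lborel[OF _ GK(4) test_functions_measurable[OF \<phi>] 0[OF _ \<phi>] _ b(2)])
           (use U b(1) in auto)
      moreover have "(LINT x|lebesgue_on U. partial_deriv i \<phi> x *\<^sub>R A x) = (LINT x|lborel. partial_deriv i \<phi> x *\<^sub>R a x)"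
        using test_functions_partial_deriv[OF \<phi>]
        by (intro lebesgue_on_integral_eq_lborel[OF _ GK(4) test_functions_measurable 0 _ a(2)])
           (use U a(1) in auto)
      ultimately show ?thesis using has_weak_partialD(3)[OF AB \<phi>U] by simp
    qed
    with a b show ?thesis by blast
  qed
  show "AE x in lebesgue_on U. dir_deriv f (A x) (B x) + dir_deriv f (A x) (- B x) = 0"
  proof (rule AE_lebesgue_on_exhaustI[OF U])
    fix G K :: "(real^'m) set" assume GK: "open G" "compact K" "G \<subseteq> K" "K \<subseteq> U"
    obtain a b where ab: "integrable lborel a" "integrable lborel b"
      "AE x in lborel. x \<in> K \<longrightarrow> A x = a x" "AE x in lborel. x \<in> K \<longrightarrow> B x = b x"
      "\<And>\<phi>. \<phi>\<in>test_functions G \<Longrightarrow> (LINT x|lborel. partial_deriv i \<phi> x *\<^sub>R a x) = - (LINT x|lborel. \<phi> x *\<^sub>R b x)"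
      using local_version[OF GK] by blast
    have "AE x in lborel. x \<in> G \<longrightarrow> dir_deriv f (a x) (b x) + dir_deriv f (a x) (- b x) = 0"
      using weak_derivative_chain_rule(1)[OF ab(1,2) GK(1) ab(5)] .
    with ab(3,4) show "AE x in lborel. x \<in> G \<longrightarrow> dir_deriv f (A x) (B x) + dir_deriv f (A x) (- B x) = 0"
      by eventually_elim (use GK in auto)
  qed
  show "has_weak_partial U i (\<lambda>x. f (A x)) (\<lambda>x. dir_deriv f (A x) (B x))"
  proof (rule has_weak_partialI)
    show "locally_integrable U (\<lambda>x. f (A x))"
      unfolding locally_integrable_def set_integrable_def
    proof (intro allI impI)
      fix K assume "compact K \<and> K \<subseteq> U"
      then have "integrable lebesgue (\<lambda>x. indicator K x *\<^sub>R A x)"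
        using lA unfolding locally_integrable_def set_integrable_def by blast
      then have "integrable lebesgue (\<lambda>x. f (indicator K x *\<^sub>R A x))"
        by (rule integrable_comp)
      \<comment> \<open>The normalization \<open>f 0 = 0\<close> enters here.\<close>
      moreover have "f (indicator K x *\<^sub>R A x) = indicator K x *\<^sub>R f (A x)" for x
        by (auto simp: indicator_def zero)
      ultimately show "integrable lebesgue (\<lambda>x. indicator K x *\<^sub>R f (A x))" by simp
    qed
    show "locally_integrable U (\<lambda>x. dir_deriv f (A x) (B x))"
      unfolding locally_integrable_def set_integrable_def
    proof (intro allI impI)
      fix K assume "compact K \<and> K \<subseteq> U"
      then have "integrable lebesgue (\<lambda>x. indicator K x *\<^sub>R A x)" "integrable lebesgue (\<lambda>x. indicator K x *\<^sub>R B x)"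
        using lA lB unfolding locally_integrable_def set_integrable_def by blast+
      then have "integrable lebesgue (\<lambda>x. dir_deriv f (indicator K x *\<^sub>R A x) (indicator K x *\<^sub>R B x))"
        by (rule integrable_dir_deriv)
      moreover have "dir_deriv f (indicator K x *\<^sub>R A x) (indicator K x *\<^sub>R B x) = indicator K x *\<^sub>R dir_deriv f (A x) (B x)" for x
        by (auto simp: indicator_def dir_deriv_zero)
      ultimately show "integrable lebesgue (\<lambda>x. indicator K x *\<^sub>R dir_deriv f (A x) (B x))" by simp
    qed
    fix \<phi> assume "\<phi> \<in> test_functions U"
    then obtain G K where GK: "open G" "compact K" "G \<subseteq> K" "K \<subseteq> U" and \<phi>: "\<phi> \<in> test_functions G"
      using test_functions_exhaust[OF U] by metis
    obtain a b where ab: "integrable lborel a" "integrable lborel b"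
      "AE x in lborel. x \<in> K \<longrightarrow> A x = a x" "AE x in lborel. x \<in> K \<longrightarrow> B x = b x"
      "\<And>\<phi>. \<phi>\<in>test_functions G \<Longrightarrow> (LINT x|lborel. partial_deriv i \<phi> x *\<^sub>R a x) = - (LINT x|lborel. \<phi> x *\<^sub>R b x)"
      using local_version[OF GK] by blast
    have 0: "\<psi> x = 0" if "x \<notin> K" "\<psi> \<in> test_functions G" for x \<psi>
      using that GK(3) by (auto simp: test_functions_iff)
    have "(LINT x|lebesgue_on U. partial_deriv i \<phi> x *\<^sub>R f (A x)) = (LINT x|lborel. partial_deriv i \<phi> x *\<^sub>R f (a x))"
    proof (rule lebesgue_on_integral_eq_lborel[OF _ GK(4)])
      show "AE x in lborel. x \<in> K \<longrightarrow> f (A x) = f (a x)" using ab(3) by eventually_elim auto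
      show "(\<lambda>x. f (a x)) \<in> borel_measurable borel"
        using integrable_comp[OF ab(1)] by (auto dest: borel_measurable_integrable)
    qed (use U 0[OF _ test_functions_partial_deriv[OF \<phi>]] test_functions_measurable[OF test_functions_partial_deriv[OF \<phi>]] in auto)
    moreover have "(LINT x|lebesgue_on U. \<phi> x *\<^sub>R dir_deriv f (A x) (B x)) = (LINT x|lborel. \<phi> x *\<^sub>R dir_deriv f (a x) (b x))"
    proof (rule lebesgue_on_integral_eq_lborel[OF _ GK(4)])
      show "AE x in lborel. x \<in> K \<longrightarrow> dir_deriv f (A x) (B x) = dir_deriv f (a x) (b x)"
        using ab(3,4) by eventually_elim auto
      show "(\<lambda>x. dir_deriv f (a x) (b x)) \<in> borel_measurable borel"
        using integrable_dir_deriv[OF ab(1,2)] by (auto dest: borel_measurable_integrable)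
    qed (use U 0[OF _ \<phi>] test_functions_measurable[OF \<phi>] in auto)
    ultimately show "(LINT x|lebesgue_on U. partial_deriv i \<phi> x *\<^sub>R f (A x)) =
        - (LINT x|lebesgue_on U. \<phi> x *\<^sub>R dir_deriv f (A x) (B x))"
      using weak_derivative_chain_rule(2)[OF ab(1,2) GK(1) ab(5) \<phi>] by simp
  qed
qed

section \<open>Ordered eigenvalues of Hermitian matrices\<close>

definition cinner :: "complex^'d \<Rightarrow> complex^'d \<Rightarrow> complex" where
  "cinner x y = (\<Sum>k\<in>UNIV. cnj (x $ k) * y $ k)"

definition orthonormal_rows :: "(complex^'d^'d) set" where
  "orthonormal_rows = {V. \<forall>i j. cinner (V $ i) (V $ j) = (if i = j then 1 else 0)}"

lemma cinner_add_left: "cinner (x + y) z = cinner x z + cinner y z"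
  and cinner_add_right: "cinner x (y + z) = cinner x y + cinner x z"
  and cinner_scale_left: "cinner (c *s x) z = cnj c * cinner x z"
  and cinner_scale_right: "cinner x (c *s z) = c * cinner x z"
  and cinner_diff_left: "cinner (x - y) z = cinner x z - cinner y z"
  and cinner_diff_right: "cinner x (y - z) = cinner x y - cinner x z"
  by (simp_all add: cinner_def algebra_simps sum.distrib sum_distrib_left sum_subtractf)

lemmas cinner_simps = cinner_add_left cinner_add_right cinner_scale_left cinner_scale_right
  cinner_diff_left cinner_diff_right

lemma cinner_commute: "cinner y x = cnj (cinner x y)"
  by (simp add: cinner_def mult.commute)

lemma cinner_self: "cinner x x = complex_of_real ((norm x)\<^sup>2)"
  by (simp add: cinner_def norm_vec_def L2_set_def sum_nonneg mult.commute[of "cnj _"]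
      complex_norm_square[symmetric] del: of_real_power)

lemma Herm_cinner: "A \<in> Herm \<Longrightarrow> cinner x (A *v y) = cinner (A *v x) y"
proof -
  assume "A \<in> Herm"
  then have h: "cnj (A $ j $ i) = A $ i $ j" for i j
    unfolding Herm_def by (auto simp: vec_eq_iff)
  have "cinner (A *v x) y = (\<Sum>k\<in>UNIV. \<Sum>l\<in>UNIV. cnj (A $ k $ l) * cnj (x $ l) * y $ k)"
    by (simp add: cinner_def matrix_vector_mult_def sum_distrib_right)
  also have "\<dots> = (\<Sum>l\<in>UNIV. \<Sum>k\<in>UNIV. cnj (A $ k $ l) * cnj (x $ l) * y $ k)"
    by (rule sum.swap)
  also have "\<dots> = cinner x (A *v y)"
    by (simp add: cinner_def matrix_vector_mult_def sum_distrib_left h mult_ac)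
  finally show ?thesis by simp
qed

lemma orthonormal_rows_norm: "V \<in> orthonormal_rows \<Longrightarrow> norm (V $ j) = 1"
proof -
  assume "V \<in> orthonormal_rows"
  then have "complex_of_real ((norm (V $ j))\<^sup>2) = 1"
    unfolding cinner_self[symmetric] orthonormal_rows_def by simp
  then have "(norm (V $ j))\<^sup>2 = 1" by (simp only: of_real_eq_1_iff)
  then show ?thesis by (simp add: power2_eq_1_iff) (metis norm_ge_zero neg_numeral_le_one not_one_le_zero zero_le_one le_minus_one_simps(3))
qed

lemma continuous_on_cinner [continuous_intros]:
  "continuous_on S f \<Longrightarrow> continuous_on S g \<Longrightarrow> continuous_on S (\<lambda>x. cinner (f x) (g x))"
  unfolding cinner_def by (intro continuous_intros)

lemma compact_orthonormal_rows: "compact (orthonormal_rows :: (complex^'d^'d) set)"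
proof (rule compact_eq_bounded_closed[THEN iffD2], rule conjI)
  have "norm V \<le> real CARD('d)" if "V \<in> orthonormal_rows" for V :: "complex^'d^'d"
  proof -
    have "norm V \<le> (\<Sum>i\<in>UNIV. norm (V $ i))" unfolding norm_vec_def[of V] by (rule L2_set_le_sum) auto
    also have "\<dots> = real CARD('d)" using orthonormal_rows_norm[OF that] by simp
    finally show ?thesis .
  qed
  then show "bounded (orthonormal_rows :: (complex^'d^'d) set)"
    by (meson boundedI)
  have eq: "orthonormal_rows = (\<Inter>i. \<Inter>j. {V :: complex^'d^'d. cinner (V $ i) (V $ j) = (if i = j then 1 else 0)})"
    unfolding orthonormal_rows_def by auto
  have cl: "closed {V :: complex^'d^'d. cinner (V $ i) (V $ j) = (if i = j then 1 else 0)}" for i j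
    by (intro closed_Collect_eq continuous_intros)
  show "closed (orthonormal_rows :: (complex^'d^'d) set)"
    unfolding eq by (intro closed_INT ballI cl)
qed

lemma mat_1_orthonormal_rows: "(mat 1 :: complex^'d^'d) \<in> orthonormal_rows"
proof -
  have "cinner ((mat 1 :: complex^'d^'d) $ i) (mat 1 $ j) = (if i = j then 1 else 0)" for i j :: 'd
  proof -
    have "cinner ((mat 1 :: complex^'d^'d) $ i) (mat 1 $ j) = (\<Sum>k\<in>UNIV. if k = i then (if j = k then 1 else 0) else 0)"
      unfolding cinner_def by (intro sum.cong) (auto simp: mat_def)
    then show ?thesis by auto
  qed
  then show ?thesis unfolding orthonormal_rows_def by simp
qed

section \<open>Plane rotations and diagonalization by maximization\<close>

text \<open>A complex Givens rotation in the plane of rows \<open>i\<close> and \<open>j\<close>: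
  \<open>p\<close> and \<open>s\<close> serve as cosine and sine, and \<open>w\<close> is a
  phase.\<close>

definition rotate_rows :: "'d \<Rightarrow> 'd \<Rightarrow> real \<Rightarrow> real \<Rightarrow> complex \<Rightarrow> complex^'d^'d \<Rightarrow> complex^'d^'d" where
  "rotate_rows i j p s w V = (\<chi> k. if k = i then of_real p *s V $ i + (of_real s * w) *s V $ j
     else if k = j then of_real p *s V $ j + (- of_real s * cnj w) *s V $ i else V $ k)"

lemma rotate_rows_orthonormal:
  assumes V: "V \<in> orthonormal_rows" and "i \<noteq> j" and ps: "p\<^sup>2 + s\<^sup>2 = 1" and w: "norm w = 1"
  shows "rotate_rows i j p s w V \<in> orthonormal_rows"
proof -
  have on: "cinner (V $ k) (V $ l) = (if k = l then 1 else 0)" for k l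
    using V unfolding orthonormal_rows_def by simp
  have ww: "w * cnj w = 1" using w by (simp add: complex_norm_square[symmetric])
  have ps': "complex_of_real p * complex_of_real p + complex_of_real s * complex_of_real s = 1"
    using arg_cong[OF ps, of complex_of_real] by (simp add: power2_eq_square)
  have 1: "of_real p * of_real p + of_real s * w * (of_real s * cnj w) = (1 :: complex)"
  proof -
    have "of_real p * of_real p + of_real s * w * (of_real s * cnj w) =
      complex_of_real p * of_real p + of_real s * of_real s * (w * cnj w)" by (simp add: mult_ac)
    then show ?thesis using ww ps' by simp
  qed
  show ?thesis
    unfolding orthonormal_rows_def mem_Collect_eq
  proof (intro allI)
    fix k l
    show "cinner (rotate_rows i j p s w V $ k) (rotate_rows i j p s w V $ l) = (if k = l then 1 else 0)"
      using \<open>i \<noteq> j\<close> 1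
      by (auto simp: rotate_rows_def cinner_simps on algebra_simps)
  qed
qed

text \<open>The entries \<open>M i j\<close> and \<open>M j i\<close> are conjugate, so the cross
  terms combine to a real part in which the phase \<open>w\<close> is free.\<close>

lemma rotate_rows_quadratic_form:
  fixes A V :: "complex^'d^'d" and i j :: 'd and p s :: real and w :: complex
  assumes A: "A \<in> Herm" and "i \<noteq> j" and w: "norm w = 1"
  defines "M \<equiv> \<lambda>k l. cinner (V $ k) (A *v V $ l)"
    and "W \<equiv> rotate_rows i j p s w V"
  shows "Re (cinner (W $ i) (A *v W $ i)) = p\<^sup>2 * Re (M i i) + s\<^sup>2 * Re (M j j) + 2 * p * s * Re (w * M i j)"
    and "Re (cinner (W $ j) (A *v W $ j)) = p\<^sup>2 * Re (M j j) + s\<^sup>2 * Re (M i i) - 2 * p * s * Re (w * M i j)"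
    and "k \<noteq> i \<Longrightarrow> k \<noteq> j \<Longrightarrow> W $ k = V $ k"
proof -
  have Mc: "M j i = cnj (M i j)"
    unfolding M_def by (metis A Herm_cinner cinner_commute)
  have ww: "w * cnj w = 1" using w by (simp add: complex_norm_square[symmetric])
  have rw: "cnj w * cnj z = cnj (w * z)" for z by simp
  have "cinner (W $ i) (A *v W $ i) = (of_real p * of_real p) * M i i + of_real p * (of_real s * w) * M i j
     + (of_real s * cnj w) * of_real p * M j i + (of_real s * of_real s) * (w * cnj w) * M j j"
    unfolding W_def rotate_rows_def M_def using \<open>i \<noteq> j\<close>
    by (simp add: cinner_simps matrix_vector_right_distrib
        matrix_vector_mult_diff_distrib vector_scalar_commute algebra_simps)
  then have "cinner (W $ i) (A *v W $ i) = of_real (p\<^sup>2) * M i i + of_real (s\<^sup>2) * M j j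
     + of_real (p * s) * (w * M i j + cnj (w * M i j))"
    unfolding Mc ww by (simp add: algebra_simps power2_eq_square)
  then show "Re (cinner (W $ i) (A *v W $ i)) = p\<^sup>2 * Re (M i i) + s\<^sup>2 * Re (M j j) + 2 * p * s * Re (w * M i j)"
    by (simp only: plus_complex.sel Re_complex_of_real complex_add_cnj times_complex.sel Im_complex_of_real)
  have "cinner (W $ j) (A *v W $ j) = (of_real p * of_real p) * M j j - of_real p * (of_real s * cnj w) * M j i
     - (of_real s * w) * of_real p * M i j + (of_real s * of_real s) * (w * cnj w) * M i i"
    unfolding W_def rotate_rows_def M_def using \<open>i \<noteq> j\<close>
    by (simp add: cinner_simps matrix_vector_right_distrib
        matrix_vector_mult_diff_distrib vector_scalar_commute algebra_simps)
  then have "cinner (W $ j) (A *v W $ j) = of_real (p\<^sup>2) * M j j + of_real (s\<^sup>2) * M i i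
     - of_real (p * s) * (w * M i j + cnj (w * M i j))"
    unfolding Mc ww by (simp add: algebra_simps power2_eq_square)
  then show "Re (cinner (W $ j) (A *v W $ j)) = p\<^sup>2 * Re (M j j) + s\<^sup>2 * Re (M i i) - 2 * p * s * Re (w * M i j)"
    by (simp only: plus_complex.sel minus_complex.sel Re_complex_of_real complex_add_cnj times_complex.sel Im_complex_of_real)
  show "k \<noteq> i \<Longrightarrow> k \<noteq> j \<Longrightarrow> W $ k = V $ k"
    unfolding W_def rotate_rows_def by simp
qed

text \<open>Maximise \<open>\<Sum>j. c j * \<langle>V j, A (V j)\<rangle>\<close> over orthonormal bases, with strictly increasing weights \<open>c\<close>.
  Optimality under rotations of two basis vectors forces the off-diagonal entries to vanish, and
  exchanging the two vectors shows that the diagonal is sorted.\<close>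

lemma Herm_sorted_diagonalization:
  fixes A :: "complex^'d::{finite,linorder}^'d::{finite,linorder}"
  assumes A: "A \<in> Herm"
  obtains V l where "V \<in> orthonormal_rows" "mono (\<lambda>i. l $ i)"
    "\<And>i j. cinner (V $ i) (A *v V $ j) = (if i = j then complex_of_real (l $ i) else 0)"
proof -
  \<comment> \<open>The number of smaller indices is a convenient strictly increasing
    weight.\<close>
  define c where "c j = real (card {k :: 'd. k < j})" for j
  have c: "c i < c j" if "i < j" for i j
    unfolding c_def using that by (auto intro!: psubset_card_mono)
  define F where "F V = (\<Sum>j\<in>UNIV. c j * Re (cinner (V $ j) (A *v V $ j)))" for V
  have "continuous_on orthonormal_rows F"
    unfolding F_def by (intro continuous_intros continuous_on_Re matrix_vector_mult_linear_continuous_on[THEN continuous_on_compose2])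
      auto
  then obtain V where V: "V \<in> orthonormal_rows" "\<And>W. W \<in> orthonormal_rows \<Longrightarrow> F W \<le> F V"
    using continuous_attains_sup[OF compact_orthonormal_rows _ ] mat_1_orthonormal_rows
    by (metis empty_iff)
  define M where "M k l = cinner (V $ k) (A *v V $ l)" for k l
  have Mc: "M l k = cnj (M k l)" for k l
    unfolding M_def by (metis A Herm_cinner cinner_commute)
  \<comment> \<open>Substituting p^2 = 1 - s^2, the rotation changes \<open>F\<close> by
    \<open>c i - c j\<close> times this expression, and \<open>c i - c j\<close> is
    positive.\<close>
  have key: "s\<^sup>2 * (Re (M j j) - Re (M i i)) + 2 * p * s * Re (w * M i j) \<le> 0"
    if "j < i" "p\<^sup>2 + s\<^sup>2 = 1" "norm w = 1" for i j p s w
  proof -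
    have ij: "i \<noteq> j" using that by auto
    let ?W = "rotate_rows i j p s w V"
    note q = rotate_rows_quadratic_form[OF A ij that(3), where V = V and p = p and s = s, folded M_def]
    have split: "sum h UNIV = h i + h j + sum h (UNIV - {i, j})" for h :: "'d \<Rightarrow> real"
    proof -
      have "sum h UNIV = sum h {i, j} + sum h (UNIV - {i, j})"
        by (metis finite sum.subset_diff subset_UNIV add.commute)
      then show ?thesis using ij by simp
    qed
    have "sum (\<lambda>k. c k * Re (cinner (?W $ k) (A *v ?W $ k))) (UNIV - {i, j}) =
       sum (\<lambda>k. c k * Re (cinner (V $ k) (A *v V $ k))) (UNIV - {i, j})"
      by (intro sum.cong) (auto simp: q(3))
    then have "F ?W - F V = c i * (Re (cinner (?W $ i) (A *v ?W $ i)) - Re (M i i)) + c j * (Re (cinner (?W $ j) (A *v ?W $ j)) - Re (M j j))"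
      unfolding F_def split M_def by (simp add: algebra_simps)
    also have "\<dots> = (c i - c j) * (s\<^sup>2 * (Re (M j j) - Re (M i i)) + 2 * p * s * Re (w * M i j))"
    proof -
      have p: "p\<^sup>2 = 1 - s\<^sup>2" using that(2) by simp
      show ?thesis unfolding q(1,2) p by (simp add: algebra_simps)
    qed
    finally have eq: "F ?W - F V = (c i - c j) * (s\<^sup>2 * (Re (M j j) - Re (M i i)) + 2 * p * s * Re (w * M i j))" .
    have "F ?W \<le> F V" by (rule V(2)[OF rotate_rows_orthonormal[OF V(1) ij that(2,3)]])
    then show ?thesis using eq c[OF that(1)] by (smt (verit) mult_pos_pos)
  qed
  \<comment> \<open>The case p = 0, s = 1 exchanges the two rows.\<close>
  have sorted: "Re (M j j) \<le> Re (M i i)" if "j < i" for i j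
    using key[OF that, of 0 1 1] by simp
  have zero: "M i j = 0" if ji: "j < i" for i j
  proof (rule ccontr)
    assume "M i j \<noteq> 0"
    define m where "m = norm (M i j)"
    have m: "m > 0" using \<open>M i j \<noteq> 0\<close> by (simp add: m_def)
    \<comment> \<open>This phase makes \<open>w * M i j\<close> equal to the modulus
      \<open>m\<close>.\<close>
    define w where "w = cnj (M i j) / of_real m"
    have w: "norm w = 1" using m by (simp add: w_def norm_divide m_def)
    have wM: "Re (w * M i j) = m"
    proof -
      have "w * M i j = of_real (m\<^sup>2) / of_real m"
        unfolding w_def m_def using complex_norm_square[of "M i j"] by (simp add: mult.commute)
      then show ?thesis using m by (simp add: power2_eq_square)
    qed
    define \<delta> where "\<delta> = Re (M j j) - Re (M i i)"
    \<comment> \<open>The tangent of the angle, small enough that the second-order term t^2 \<delta>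
      cannot compensate the first-order gain 2 t m: it has \<bar>t \<delta>\<bar> \<le> m.\<close>
    define t where "t = m / (1 + \<bar>\<delta>\<bar>)"
    define r where "r = sqrt (1 + t\<^sup>2)"
    have t: "t > 0" using m by (simp add: t_def)
    have r: "r > 0" "r\<^sup>2 = 1 + t\<^sup>2" by (auto simp: r_def add_pos_nonneg)
    have "(1 / r)\<^sup>2 + (t / r)\<^sup>2 = 1"
      using r(1) by (simp add: power_divide add_divide_distrib[symmetric] r(2)[symmetric])
    from key[OF ji this w] have "(t / r)\<^sup>2 * \<delta> + 2 * (1 / r) * (t / r) * m \<le> 0"
      unfolding wM \<delta>_def .
    then have "r\<^sup>2 * ((t / r)\<^sup>2 * \<delta> + 2 * (1 / r) * (t / r) * m) \<le> 0"
      by (intro mult_nonneg_nonpos) auto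
    then have "t * (t * \<delta> + 2 * m) \<le> 0"
      using r(1) by (simp add: power_divide distrib_left power2_eq_square algebra_simps)
    then have "t * \<delta> + 2 * m \<le> 0" using t by (simp add: mult_le_0_iff)
    moreover have "- m \<le> t * \<delta>"
    proof -
      have "t * \<bar>\<delta>\<bar> \<le> t * (1 + \<bar>\<delta>\<bar>)" using t by (intro mult_left_mono) auto
      also have "\<dots> = m" by (simp add: t_def)
      finally have "t * \<bar>\<delta>\<bar> \<le> m" .
      moreover have "\<bar>t * \<delta>\<bar> = t * \<bar>\<delta>\<bar>" using t by (simp add: abs_mult)
      ultimately show ?thesis by linarith
    qed
    ultimately show False using m by linarith
  qed
  have diag: "M i i = complex_of_real (Re (M i i))" for i
    using Mc[of i i] by (metis Reals_cnj_iff complex_is_Real_iff of_real_Re)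
  show thesis
  proof (rule that[of V "\<chi> i. Re (M i i)"])
    show "mono (\<lambda>i. (\<chi> i. Re (M i i)) $ i)"
      unfolding mono_def using sorted by (auto simp: le_less)
    show "cinner (V $ i) (A *v V $ j) = (if i = j then complex_of_real ((\<chi> i. Re (M i i)) $ i) else 0)" for i j
    proof (cases "i = j")
      case True
      then show ?thesis using diag[of i] by (simp add: M_def)
    next
      case False
      then consider "j < i" | "i < j" by fastforce
      then have "M i j = 0" using zero[of j i] zero[of i j] Mc[of i j] by cases auto
      then show ?thesis using False by (simp add: M_def)
    qed
  qed (rule V(1))
qed

section \<open>Characteristic polynomials and uniqueness of the ordered eigenvalues\<close>

text \<open>For orthonormal rows this is the inverse of \<open>transpose V\<close>; sandwiching
  \<open>A\<close> between the two lists the numbers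
  \<open>cinner (V $ i) (A *v V $ j)\<close>.\<close>

definition conj_matrix :: "complex^'m^'n \<Rightarrow> complex^'m^'n" where
  "conj_matrix V = (\<chi> i j. cnj (V $ i $ j))"

lemma orthonormal_rows_iff: "V \<in> orthonormal_rows \<longleftrightarrow> conj_matrix V ** transpose V = mat 1"
  unfolding orthonormal_rows_def conj_matrix_def
  by (auto simp: vec_eq_iff matrix_matrix_mult_def transpose_def mat_def cinner_def)

lemma cinner_rows_matrix: "(conj_matrix V ** A ** transpose W) $ i $ j = cinner (V $ i) (A *v W $ j)"
proof -
  have "(conj_matrix V ** A ** transpose W) $ i $ j = (conj_matrix V ** (A ** transpose W)) $ i $ j"
    by (simp add: matrix_mul_assoc)
  also have "\<dots> = cinner (V $ i) (A *v W $ j)"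
    by (simp add: conj_matrix_def matrix_matrix_mult_def transpose_def cinner_def matrix_vector_mult_def)
  finally show ?thesis .
qed

definition poly_matrix :: "'a::comm_ring_1^'m^'n \<Rightarrow> 'a poly^'m^'n" where
  "poly_matrix A = (\<chi> i j. [:A $ i $ j:])"

lemma sum_const_poly: "(\<Sum>k\<in>S. [:f k:]) = [:\<Sum>k\<in>S. f k:]"
  by (induction S rule: infinite_finite_induct) auto

lemma poly_matrix_mult: "poly_matrix (A ** B) = poly_matrix A ** poly_matrix B"
  by (simp add: poly_matrix_def matrix_matrix_mult_def vec_eq_iff sum_const_poly mult.commute)

lemma poly_matrix_mat_1: "poly_matrix (mat 1 :: 'a::comm_ring_1^'n^'n) = mat 1"
  by (simp add: poly_matrix_def mat_def vec_eq_iff one_pCons)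

lemma mat_mult_commute: "mat c ** (B :: 'a::comm_ring_1^'n^'n) = B ** mat c"
proof -
  have "(mat c ** B) $ i $ j = (B ** mat c) $ i $ j" for i j
  proof -
    have "(mat c ** B) $ i $ j = (\<Sum>k\<in>UNIV. mat c $ i $ k * B $ k $ j)"
      by (simp add: matrix_matrix_mult_def)
    also have "\<dots> = (\<Sum>k\<in>UNIV. if k = i then c * B $ k $ j else 0)"
      by (intro sum.cong) (auto simp: mat_def)
    moreover have "(B ** mat c) $ i $ j = (\<Sum>k\<in>UNIV. B $ i $ k * mat c $ k $ j)"
      by (simp add: matrix_matrix_mult_def)
    moreover have "\<dots> = (\<Sum>k\<in>UNIV. if k = j then B $ i $ k * c else 0)"
      by (intro sum.cong) (auto simp: mat_def)
    ultimately show ?thesis by (simp add: mult.commute)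
  qed
  then show ?thesis by (simp add: vec_eq_iff)
qed

lemma matrix_mult_diff_left: "(A - B) ** C = A ** C - B ** (C :: 'a::comm_ring_1^'n^'m)"
  and matrix_mult_diff_right: "C' ** (A - B) = C' ** A - (C' :: 'a::comm_ring_1^'k^'p) ** B"
  by (simp_all add: matrix_matrix_mult_def vec_eq_iff left_diff_distrib right_diff_distrib sum_subtractf)

text \<open>\<open>P\<close> and \<open>Q\<close> are inverse over the polynomial ring as well, and
  the scalar matrix of the indeterminate commutes with them, so the determinant is unchanged by
  conjugation.\<close>

lemma charpoly_of_diagonalization:
  fixes A P Q :: "complex^'d^'d"
  assumes PQ: "P ** Q = mat 1" and D: "\<And>i j. (P ** A ** Q) $ i $ j = (if i = j then d i else 0)"
  shows "charpoly A = (\<Prod>i\<in>UNIV. [:- d i, 1:])"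
proof -
  let ?X = "mat [:0, 1:] :: complex poly^'d^'d"
  have one: "det (poly_matrix P) * det (poly_matrix Q) = 1"
    using arg_cong[OF PQ, of "\<lambda>M. det (poly_matrix M)"] by (simp add: poly_matrix_mult poly_matrix_mat_1 det_mul)
  have "poly_matrix P ** (?X - poly_matrix A) ** poly_matrix Q = ?X - poly_matrix (P ** A ** Q)"
  proof -
    have "poly_matrix P ** ?X ** poly_matrix Q = ?X ** (poly_matrix P ** poly_matrix Q)"
      by (metis mat_mult_commute matrix_mul_assoc)
    also have "\<dots> = ?X" using PQ by (simp flip: poly_matrix_mult add: poly_matrix_mat_1)
    finally show ?thesis
      by (simp add: matrix_mult_diff_left matrix_mult_diff_right poly_matrix_mult)
  qed
  then have "det (poly_matrix P) * det (?X - poly_matrix A) * det (poly_matrix Q) = det (?X - poly_matrix (P ** A ** Q))"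
    by (metis det_mul)
  moreover have "det (?X - poly_matrix (P ** A ** Q)) = (\<Prod>i\<in>UNIV. (?X - poly_matrix (P ** A ** Q)) $ i $ i)"
    by (rule det_diagonal) (simp add: poly_matrix_def D mat_def)
  moreover have "\<dots> = (\<Prod>i\<in>UNIV. [:- d i, 1:])"
    by (intro prod.cong) (simp_all add: poly_matrix_def D mat_def)
  moreover have "det (poly_matrix P) * det (?X - poly_matrix A) * det (poly_matrix Q) = det (?X - poly_matrix A)"
  proof -
    have "p * d * q = (p * q) * d" for p d q :: "complex poly" by (simp only: mult_ac)
    then show ?thesis using one by simp
  qed
  ultimately show ?thesis unfolding charpoly_def poly_matrix_def by simp
qed

lemma order_prod_linear_factors:
  fixes d :: "'a \<Rightarrow> 'b::idom"
  assumes "finite I"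
  shows "order t (\<Prod>i\<in>I. [:- d i, 1:]) = card {i \<in> I. d i = t}"
  using assms
proof (induction I rule: finite_induct)
  case (insert i I)
  have nz: "(\<Prod>i\<in>I. [:- d i, 1:]) \<noteq> 0" using insert by simp
  have o: "order t [:- d i, 1:] = (if d i = t then 1 else 0)"
    using order_power_n_n[of t 1] by (auto intro: order_0I)
  have set: "{k \<in> insert i I. d k = t} = (if d i = t then insert i {k \<in> I. d k = t} else {k \<in> I. d k = t})"
    by auto
  have "order t ([:- d i, 1:] * (\<Prod>i\<in>I. [:- d i, 1:])) = order t [:- d i, 1:] + order t (\<Prod>i\<in>I. [:- d i, 1:])"
    using nz by (intro order_mult) (metis mult_eq_0_iff one_neq_zero pCons_eq_0_iff)
  then show ?case using insert unfolding set by (simp add: o del: mult_pCons_left)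
qed simp

text \<open>Equal multiplicities give sublevel sets of equal size. If \<open>l' i < l i\<close>, the
  sublevel set of \<open>l\<close> at \<open>l' i\<close> is a proper subset of
  \<open>{..i}\<close>, whereas that of \<open>l'\<close> contains \<open>{..i}\<close>.\<close>

lemma mono_counts_le:
  fixes l l' :: "'d::{finite,linorder} \<Rightarrow> real"
  assumes m: "mono l" "mono l'" and counts: "\<And>t. card {i. l i = t} = card {i. l' i = t}"
  shows "l i \<le> l' i"
proof -
  have le_card: "card {j. h j \<le> t} = (\<Sum>s\<in>T \<inter> {..t}. card {j. h j = s})"
    if T: "finite T" "range h \<subseteq> T" for h :: "'d \<Rightarrow> real" and t T
  proof -
    have "{j. h j \<le> t} = (\<Union>s\<in>T \<inter> {..t}. {j. h j = s})" using T by auto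
    then show ?thesis using T by (simp only:) (subst card_UN_disjoint, auto)
  qed
  let ?t = "l' i" and ?T = "range l \<union> range l'"
  have eq: "card {j. l j \<le> ?t} = card {j. l' j \<le> ?t}"
    using le_card[of ?T l ?t] le_card[of ?T l' ?t] counts by simp
  show ?thesis
  proof (rule ccontr)
    assume "\<not> l i \<le> l' i"
    then have "i \<notin> {j. l j \<le> ?t}" by simp
    moreover have "{j. l j \<le> ?t} \<subseteq> {..i}"
      using \<open>\<not> l i \<le> l' i\<close> m(1) unfolding mono_def by (auto simp: not_le) (metis le_cases less_le_trans not_less)
    ultimately have "{j. l j \<le> ?t} \<subset> {..i}" by blast
    then have "card {j. l j \<le> ?t} < card {..i}" by (intro psubset_card_mono) auto
    moreover have "{..i} \<subseteq> {j. l' j \<le> ?t}" using m(2) unfolding mono_def by auto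
    then have "card {..i} \<le> card {j. l' j \<le> ?t}" by (intro card_mono) auto
    ultimately show False using eq by simp
  qed
qed

text \<open>Resolves the definite description: the multiplicities come from the factored
  characteristic polynomial, and a sorted vector is determined by its multiplicities.\<close>

lemma eigvals_incr_eqI:
  fixes A :: "complex^'d::{finite,linorder}^'d::{finite,linorder}"
  assumes V: "V \<in> orthonormal_rows" and l: "mono (\<lambda>i. l $ i)"
    and D: "\<And>i j. cinner (V $ i) (A *v V $ j) = (if i = j then complex_of_real (l $ i) else 0)"
  shows "eigvals_incr A = l"
  unfolding eigvals_incr_def
proof (rule the_equality)
  have cp: "charpoly A = (\<Prod>i\<in>UNIV. [:- complex_of_real (l $ i), 1:])"
    using V by (intro charpoly_of_diagonalization[of "conj_matrix V" "transpose V"])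
      (auto simp: orthonormal_rows_iff cinner_rows_matrix D)
  have ord: "order (complex_of_real t) (charpoly A) = card {i. l $ i = t}" for t
    unfolding cp by (simp add: order_prod_linear_factors)
  then show "mono (\<lambda>i. l $ i) \<and> (\<forall>t. card {i. l $ i = t} = order (complex_of_real t) (charpoly A))"
    using l by simp
  fix l' :: "real^'d::{finite,linorder}"
  assume l': "mono (\<lambda>i. l' $ i) \<and> (\<forall>t. card {i. l' $ i = t} = order (complex_of_real t) (charpoly A))"
  then have counts: "card {i. l' $ i = t} = card {i. l $ i = t}" for t using ord by simp
  have "l' $ i = l $ i" for i
    using mono_counts_le[of "\<lambda>i. l' $ i" "\<lambda>i. l $ i" i] mono_counts_le[of "\<lambda>i. l $ i" "\<lambda>i. l' $ i" i] l l' counts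
    by (metis (no_types, lifting) order.antisym)
  then show "l' = l" by (simp add: vec_eq_iff)
qed

section \<open>Ky Fan sums as convex functions\<close>

text \<open>Defined for all matrices, so that it is convex on the entire ambient space; the sign
  turns Ky Fan's minimum into a supremum of linear functionals. Only for Hermitian matrices is it
  tied to eigenvalues.\<close>

definition neg_trace_sup :: "'d set \<Rightarrow> complex^'d^'d \<Rightarrow> real" where
  "neg_trace_sup S A = (SUP V\<in>orthonormal_rows. - (\<Sum>j\<in>S. Re (cinner (V $ j) (A *v V $ j))))"

text \<open>The common bound keeps the supremum finite and, applied to \<open>x - y\<close>, gives
  the Lipschitz estimate.\<close>

lemma convex_lipschitz_SUP:
  fixes T :: "'i \<Rightarrow> 'v::euclidean_space \<Rightarrow> real"
  assumes I: "I \<noteq> {}" and lin: "\<And>i. i \<in> I \<Longrightarrow> linear (T i)"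
    and bound: "\<And>i x. i \<in> I \<Longrightarrow> \<bar>T i x\<bar> \<le> L * norm x"
  shows "convex_lipschitz (\<lambda>x. SUP i\<in>I. T i x) L"
proof
  have bdd: "bdd_above ((\<lambda>i. T i x) ` I)" for x
    using bound by (intro bdd_aboveI2[of _ _ "L * norm x"]) (meson abs_le_D1)
  have up: "T i x \<le> (SUP i\<in>I. T i x)" if "i \<in> I" for i x
    using cSUP_upper[OF that bdd] .
  show "convex_on UNIV (\<lambda>x. SUP i\<in>I. T i x)"
  proof (rule convex_onI)
    fix t :: real and x y :: 'v assume t: "0 < t" "t < 1"
    show "(SUP i\<in>I. T i ((1 - t) *\<^sub>R x + t *\<^sub>R y)) \<le> (1 - t) * (SUP i\<in>I. T i x) + t * (SUP i\<in>I. T i y)"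
    proof (rule cSUP_least[OF I])
      fix i assume i: "i \<in> I"
      have "T i ((1 - t) *\<^sub>R x + t *\<^sub>R y) = (1 - t) * T i x + t * T i y"
        using lin[OF i] by (simp add: linear_add linear_scale)
      also have "\<dots> \<le> (1 - t) * (SUP i\<in>I. T i x) + t * (SUP i\<in>I. T i y)"
        using t by (intro add_mono mult_left_mono up i) auto
      finally show "T i ((1 - t) *\<^sub>R x + t *\<^sub>R y) \<le> (1 - t) * (SUP i\<in>I. T i x) + t * (SUP i\<in>I. T i y)" .
    qed
  qed auto
  have one: "(SUP i\<in>I. T i x) \<le> (SUP i\<in>I. T i y) + L * norm (x - y)" for x y
  proof (rule cSUP_least[OF I])
    fix i assume i: "i \<in> I"
    have "T i x = T i y + T i (x - y)" using lin[OF i] by (simp add: linear_diff)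
    also have "\<dots> \<le> (SUP i\<in>I. T i y) + L * norm (x - y)"
      using up[OF i, of y] bound[OF i, of "x - y"] by linarith
    finally show "T i x \<le> (SUP i\<in>I. T i y) + L * norm (x - y)" .
  qed
  show "\<bar>(SUP i\<in>I. T i x) - (SUP i\<in>I. T i y)\<bar> \<le> L * norm (x - y)" for x y
    using one[of x y] one[of y x] by (simp add: norm_minus_commute)
  have "(SUP i\<in>I. T i 0) = (SUP i\<in>I. (0 :: real))"
    using lin by (intro SUP_cong) (auto simp: linear_0)
  then show "(SUP i\<in>I. T i 0) = 0" using I by simp
qed

text \<open>The third power is crude: at most CARD('d) summands, each a double sum of CARD('d)^2
  terms bounded by \<open>norm A\<close>.\<close>

lemma convex_lipschitz_neg_trace_sup:
  "convex_lipschitz (neg_trace_sup S :: complex^'d^'d \<Rightarrow> real) (real CARD('d) ^ 3)"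
  unfolding neg_trace_sup_def
proof (rule convex_lipschitz_SUP)
  show "(orthonormal_rows :: (complex^'d^'d) set) \<noteq> {}" using mat_1_orthonormal_rows by blast
  fix V :: "complex^'d^'d" assume V: "V \<in> orthonormal_rows"
  show "linear (\<lambda>A :: complex^'d^'d. - (\<Sum>j\<in>S. Re (cinner (V $ j) (A *v V $ j))))"
  proof (rule linearI)
    fix A B :: "complex^'d^'d" and r :: real
    show "- (\<Sum>j\<in>S. Re (cinner (V $ j) ((A + B) *v V $ j))) =
      - (\<Sum>j\<in>S. Re (cinner (V $ j) (A *v V $ j))) + - (\<Sum>j\<in>S. Re (cinner (V $ j) (B *v V $ j)))"
      by (simp add: matrix_vector_mult_add_rdistrib cinner_add_right sum.distrib)
    have "cinner x (r *\<^sub>R y) = of_real r * cinner x y" for x y :: "complex^'d"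
    proof -
      have "(r *\<^sub>R y) $ k = of_real r * y $ k" for k
        by (simp only: vector_scaleR_component scaleR_conv_of_real[of r "y $ k"])
      then show ?thesis by (simp add: cinner_def sum_distrib_left mult_ac)
    qed
    moreover have "(r *\<^sub>R A) *v y = r *\<^sub>R (A *v y)" for y
      by (simp add: matrix_vector_mult_def vec_eq_iff scaleR_sum_right)
    ultimately show "- (\<Sum>j\<in>S. Re (cinner (V $ j) ((r *\<^sub>R A) *v V $ j))) =
      r *\<^sub>R - (\<Sum>j\<in>S. Re (cinner (V $ j) (A *v V $ j)))"
      by (simp add: sum_distrib_left)
  qed
  fix A :: "complex^'d^'d"
  have entry: "norm (cnj (V $ j $ k) * (A $ k $ l * V $ j $ l)) \<le> norm A" for j k l
  proof -
    have "norm (V $ j $ m) \<le> 1" for m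
      using Finite_Cartesian_Product.norm_nth_le[of "V $ j" m] orthonormal_rows_norm[OF V, of j] by simp
    then have "norm (V $ j $ k) * (norm (A $ k $ l) * norm (V $ j $ l)) \<le> 1 * (norm (A $ k $ l) * 1)"
      by (intro mult_mono) auto
    also have "\<dots> \<le> norm A"
      using Finite_Cartesian_Product.norm_nth_le[of "A $ k" l] Finite_Cartesian_Product.norm_nth_le[of A k] by simp
    finally show ?thesis by (simp add: norm_mult)
  qed
  have "norm (cinner (V $ j) (A *v V $ j)) \<le> real CARD('d) ^ 2 * norm A" for j
  proof -
    have "cinner (V $ j) (A *v V $ j) = (\<Sum>k\<in>UNIV. \<Sum>l\<in>UNIV. cnj (V $ j $ k) * (A $ k $ l * V $ j $ l))"
      by (simp add: cinner_def matrix_vector_mult_def sum_distrib_left)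
    also have "norm \<dots> \<le> (\<Sum>k\<in>(UNIV :: 'd set). \<Sum>l\<in>(UNIV :: 'd set). norm A)"
      by (intro sum_norm_le entry)
    also have "\<dots> = real CARD('d) ^ 2 * norm A" by (simp add: power2_eq_square)
    finally show ?thesis .
  qed
  then have "\<bar>Re (cinner (V $ j) (A *v V $ j))\<bar> \<le> real CARD('d) ^ 2 * norm A" for j
    using abs_Re_le_cmod order.trans by blast
  then have "\<bar>\<Sum>j\<in>S. Re (cinner (V $ j) (A *v V $ j))\<bar> \<le> (\<Sum>j\<in>S. real CARD('d) ^ 2 * norm A)"
    by (intro order.trans[OF sum_abs] sum_mono)
  also have "\<dots> \<le> (\<Sum>j\<in>(UNIV :: 'd set). real CARD('d) ^ 2 * norm A)"
    by (intro sum_mono2) auto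
  also have "\<dots> = real CARD('d) ^ 3 * norm A" by (simp add: power2_eq_square power3_eq_cube)
  finally show "\<bar>- (\<Sum>j\<in>S. Re (cinner (V $ j) (A *v V $ j)))\<bar> \<le> real CARD('d) ^ 3 * norm A" by simp
qed

text \<open>Ky Fan's minimum principle: the weights \<open>\<Sum>j\<in>S. \<bar>Y $ k $ j\<bar>\<^sup>2\<close> of the unitary change of basis
  \<open>Y\<close> lie in \<open>[0, 1]\<close> and sum to \<open>card S\<close>, so the eigenvalues with index in the lower set \<open>S\<close> are
  the cheapest choice.\<close>

lemma neg_trace_sup_eq_sum_eigvals:
  fixes A :: "complex^'d::{finite,linorder}^'d::{finite,linorder}"
  assumes A: "A \<in> Herm" and S: "S = {..m} \<or> S = {..<m}"
  shows "neg_trace_sup S A = - (\<Sum>j\<in>S. eigvals_incr A $ j)"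
proof -
  obtain V l where V: "V \<in> orthonormal_rows" and l: "mono (\<lambda>i. l $ i)"
    and D: "\<And>i j. cinner (V $ i) (A *v V $ j) = (if i = j then complex_of_real (l $ i) else 0)"
    using Herm_sorted_diagonalization[OF A] by metis
  have ev: "eigvals_incr A = l" by (rule eigvals_incr_eqI[OF V l D])
  have ub: "- (\<Sum>j\<in>S. Re (cinner (W $ j) (A *v W $ j))) \<le> - (\<Sum>j\<in>S. l $ j)" if W: "W \<in> orthonormal_rows" for W
  proof -
    let ?P = "conj_matrix V" and ?Q = "transpose V"
    have PQ: "?P ** ?Q = mat 1" using V by (simp add: orthonormal_rows_iff)
    then have QP: "?Q ** ?P = mat 1" using matrix_left_right_inverse by blast
    have W1: "conj_matrix W ** transpose W = mat 1" using W by (simp add: orthonormal_rows_iff)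
    then have W2: "transpose W ** conj_matrix W = mat 1" using matrix_left_right_inverse by blast
    define Dg where "Dg = ?P ** A ** ?Q"
    have Dg: "Dg $ i $ j = (if i = j then complex_of_real (l $ i) else 0)" for i j
      unfolding Dg_def cinner_rows_matrix D ..
    \<comment> \<open>Column \<open>j\<close> of \<open>Y\<close> holds the coordinates of
      \<open>W $ j\<close> in the eigenbasis \<open>V\<close>; \<open>Z\<close> is the adjoint and
      inverse of \<open>Y\<close>.\<close>
    define Y where "Y = ?P ** transpose W"
    define Z where "Z = conj_matrix W ** ?Q"
    have Z: "Z $ j $ k = cnj (Y $ k $ j)" for j k
      unfolding Z_def Y_def by (simp add: matrix_matrix_mult_def conj_matrix_def transpose_def mult.commute)
    have YZ: "Y ** Z = mat 1" unfolding Y_def Z_def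
      by (metis PQ W2 matrix_mul_assoc matrix_mul_lid)
    have ZY: "Z ** Y = mat 1" using YZ matrix_left_right_inverse by blast
    have "Z ** Dg ** Y = conj_matrix W ** (?Q ** ?P) ** A ** (?Q ** ?P) ** transpose W"
      unfolding Z_def Y_def Dg_def by (simp add: matrix_mul_assoc)
    then have "Z ** Dg ** Y = conj_matrix W ** A ** transpose W"
      unfolding QP by simp
    then have qf: "cinner (W $ j) (A *v W $ j) = (\<Sum>k\<in>UNIV. complex_of_real (l $ k) * (cnj (Y $ k $ j) * Y $ k $ j))" for j
    proof -
      assume eq: "Z ** Dg ** Y = conj_matrix W ** A ** transpose W"
      have "(Z ** Dg) $ j $ k = Z $ j $ k * complex_of_real (l $ k)" for k
      proof -
        have "(Z ** Dg) $ j $ k = (\<Sum>i\<in>UNIV. Z $ j $ i * Dg $ i $ k)"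
          by (simp add: matrix_matrix_mult_def)
        also have "\<dots> = (\<Sum>i\<in>UNIV. if i = k then Z $ j $ i * complex_of_real (l $ i) else 0)"
          by (intro sum.cong) (auto simp: Dg)
        finally show ?thesis by simp
      qed
      then have "(Z ** Dg ** Y) $ j $ j = (\<Sum>k\<in>UNIV. Z $ j $ k * complex_of_real (l $ k) * Y $ k $ j)"
        unfolding matrix_matrix_mult_def[of "Z ** Dg" Y] by simp
      then show ?thesis unfolding eq cinner_rows_matrix by (simp add: Z mult_ac)
    qed
    define w where "w k j = (norm (Y $ k $ j))\<^sup>2" for k j
    have cw: "cnj (Y $ k $ j) * Y $ k $ j = complex_of_real (w k j)" for k j
      unfolding w_def using complex_norm_square[of "Y $ k $ j"] by (simp add: mult.commute)
    have w0: "0 \<le> w k j" for k j unfolding w_def by simp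
    have row: "(\<Sum>j\<in>UNIV. w k j) = 1" for k
    proof -
      have "(Y ** Z) $ k $ k = complex_of_real (\<Sum>j\<in>UNIV. w k j)"
        unfolding matrix_matrix_mult_def by (simp add: Z cw[symmetric] mult.commute)
      then show ?thesis unfolding YZ by (simp add: mat_def of_real_eq_1_iff flip: of_real_sum)
    qed
    have col: "(\<Sum>k\<in>UNIV. w k j) = 1" for j
    proof -
      have "(Z ** Y) $ j $ j = complex_of_real (\<Sum>k\<in>UNIV. w k j)"
        unfolding matrix_matrix_mult_def by (simp add: Z cw[symmetric])
      then show ?thesis unfolding ZY by (simp add: mat_def of_real_eq_1_iff flip: of_real_sum)
    qed
    define v where "v k = (\<Sum>j\<in>S. w k j)" for k
    have v01: "0 \<le> v k" "v k \<le> 1" for k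
    proof -
      show "0 \<le> v k" unfolding v_def by (intro sum_nonneg w0)
      have "v k \<le> (\<Sum>j\<in>UNIV. w k j)" unfolding v_def by (intro sum_mono2) (auto simp: w0)
      then show "v k \<le> 1" by (simp add: row)
    qed
    have vsum: "(\<Sum>k\<in>UNIV. v k) = real (card S)"
      unfolding v_def by (subst sum.swap) (simp add: col)
    have "(\<Sum>j\<in>S. Re (cinner (W $ j) (A *v W $ j))) = (\<Sum>j\<in>S. \<Sum>k\<in>UNIV. l $ k * w k j)"
      unfolding qf cw by simp
    also have "\<dots> = (\<Sum>k\<in>UNIV. l $ k * v k)"
      unfolding v_def by (subst sum.swap) (simp add: sum_distrib_left)
    finally have eq: "(\<Sum>j\<in>S. Re (cinner (W $ j) (A *v W $ j))) = (\<Sum>k\<in>UNIV. l $ k * v k)" .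
    \<comment> \<open>As the weights sum to \<open>card S\<close>, shifting all eigenvalues by the
      threshold \<open>l $ m\<close> changes both sides equally. After the shift the terms have a
      fixed sign inside and outside \<open>S\<close>, and the comparison holds term by term for both
      forms of \<open>S\<close>.\<close>
    have "(\<Sum>k\<in>UNIV. (if k \<in> S then l $ k - l $ m else 0)) \<le> (\<Sum>k\<in>UNIV. (l $ k - l $ m) * v k)"
    proof (rule sum_mono)
      fix k
      show "(if k \<in> S then l $ k - l $ m else 0) \<le> (l $ k - l $ m) * v k"
      proof (cases "k \<in> S")
        case True
        then have "l $ k \<le> l $ m" using S l unfolding mono_def by auto
        then show ?thesis using True v01[of k] mult_left_le[of "v k" "l $ m - l $ k"] by (simp add: algebra_simps)
      next
        case False
        then have "m \<le> k" using S by auto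
        then have "l $ m \<le> l $ k" using l unfolding mono_def by auto
        then show ?thesis using False v01[of k] by simp
      qed
    qed
    moreover have "(\<Sum>k\<in>UNIV. (if k \<in> S then l $ k - l $ m else 0)) = (\<Sum>k\<in>S. l $ k) - real (card S) * l $ m"
      by (simp add: sum.If_cases sum_subtractf)
    moreover have "(\<Sum>k\<in>UNIV. (l $ k - l $ m) * v k) = (\<Sum>k\<in>UNIV. l $ k * v k) - l $ m * real (card S)"
      unfolding vsum[symmetric] by (simp add: left_diff_distrib sum_subtractf sum_distrib_left)
    ultimately show ?thesis unfolding eq by (simp add: mult.commute)
  qed
  have "neg_trace_sup S A = - (\<Sum>j\<in>S. l $ j)"
    unfolding neg_trace_sup_def
  proof (rule cSup_eq_maximum)
    have "- (\<Sum>j\<in>S. l $ j) = - (\<Sum>j\<in>S. Re (cinner (V $ j) (A *v V $ j)))" by (simp add: D)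
    then show "- (\<Sum>j\<in>S. l $ j) \<in> (\<lambda>V. - (\<Sum>j\<in>S. Re (cinner (V $ j) (A *v V $ j)))) ` orthonormal_rows"
      using V by blast
  qed (use ub in auto)
  then show ?thesis by (simp add: ev)
qed

lemma eigvals_incr_eq_diff_neg_trace_sup:
  fixes A :: "complex^'d::{finite,linorder}^'d::{finite,linorder}"
  assumes "A \<in> Herm"
  shows "eigvals_incr A = (\<chi> k. neg_trace_sup {..<k} A - neg_trace_sup {..k} A)"
proof -
  have "eigvals_incr A $ k = neg_trace_sup {..<k} A - neg_trace_sup {..k} A" for k
  proof -
    have "{..k} = insert k {..<k}" by auto
    then have "(\<Sum>j\<in>{..k}. eigvals_incr A $ j) = eigvals_incr A $ k + (\<Sum>j\<in>{..<k}. eigvals_incr A $ j)"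
      by simp
    then show ?thesis
      using neg_trace_sup_eq_sum_eigvals[OF assms, of "{..<k}" k] neg_trace_sup_eq_sum_eigvals[OF assms, of "{..k}" k]
      by simp
  qed
  then show ?thesis by (simp add: vec_eq_iff)
qed

section \<open>Superposition with differences of convex functions\<close>

lemma Lq_space_dominated:
  assumes A: "A \<in> Lq_space q U V" and B: "B \<in> borel_measurable (lebesgue_on U)"
    and le: "\<And>x. norm (B x) \<le> C * norm (A x)" and "0 \<le> C" "1 \<le> q"
  shows "B \<in> Lq_space q U UNIV"
proof -
  have "integrable (lebesgue_on U) (\<lambda>x. C powr q * (norm (A x) powr q))"
    using A by (auto simp: Lq_space_def)
  then have "integrable (lebesgue_on U) (\<lambda>x. norm (B x) powr q)"
  proof (rule Bochner_Integration.integrable_bound)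
    show "(\<lambda>x. norm (B x) powr q) \<in> borel_measurable (lebesgue_on U)"
      using B by measurable
    show "AE x in lebesgue_on U. norm (norm (B x) powr q) \<le> norm (C powr q * (norm (A x) powr q))"
    proof (intro AE_I2)
      fix x
      have "norm (B x) powr q \<le> (C * norm (A x)) powr q"
        using le assms(5) by (intro powr_mono2) auto
      then show "norm (norm (B x) powr q) \<le> norm (C powr q * (norm (A x) powr q))"
        using assms(4) by (simp add: powr_mult)
    qed
  qed
  then show ?thesis using B by (auto simp: Lq_space_def)
qed

lemma Lq_norm_cong_AE:
  assumes "f \<in> borel_measurable (lebesgue_on U)" "g \<in> borel_measurable (lebesgue_on U)"
    "AE x in lebesgue_on U. f x = g x"
  shows "Lq_norm q U f = Lq_norm q U g"
proof -
  have "(LINT x|lebesgue_on U. norm (f x) powr q) = (LINT x|lebesgue_on U. norm (g x) powr q)"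
  proof (rule integral_cong_AE)
    show "(\<lambda>x. norm (f x) powr q) \<in> borel_measurable (lebesgue_on U)"
      "(\<lambda>x. norm (g x) powr q) \<in> borel_measurable (lebesgue_on U)"
      using assms(1,2) by measurable
    show "AE x in lebesgue_on U. norm (f x) powr q = norm (g x) powr q"
      using assms(3) by eventually_elim simp
  qed
  then show ?thesis by (simp add: Lq_norm_def)
qed

lemma Lq_norm_nonneg: "0 \<le> Lq_norm q U f"
  by (simp add: Lq_norm_def)

text \<open>For \<open>d \<le> 1\<close> and \<open>q \<ge> 1\<close> the power d^q is at most d, so
  geometric bounds on norms pass unchanged to integrals of q-th powers.\<close>

lemma integral_le_of_Lq_norm_less:
  assumes "Lq_norm q U f < d" "d \<le> 1" "1 \<le> q"
  shows "(LINT x|lebesgue_on U. norm (f x) powr q) \<le> d"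
proof -
  let ?I = "LINT x|lebesgue_on U. norm (f x) powr q"
  have I: "0 \<le> ?I" by (intro integral_nonneg_AE) auto
  have d: "0 < d" using Lq_norm_nonneg[of q U f] assms(1) by linarith
  have "?I = (?I powr (1 / q)) powr q" using I assms(3) by (simp add: powr_powr)
  also have "\<dots> \<le> d powr q"
    using assms by (intro powr_mono2) (auto simp: Lq_norm_def)
  also have "\<dots> \<le> d powr 1" using d assms by (intro powr_mono') auto
  finally show ?thesis using d by simp
qed

lemma has_weak_partial_weak_partial:
  "has_weak_partial U i f g \<Longrightarrow> has_weak_partial U i f (weak_partial U i f)"
  unfolding weak_partial_def by (rule someI[of "has_weak_partial U i f"])

text \<open>Frees the seminorm from the choice in \<open>weak_partial\<close>: any explicit weak
  derivative computes it.\<close>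

lemma Lq_norm_weak_partial:
  assumes U: "open U" and fg: "has_weak_partial U i f g"
  shows "Lq_norm q U (weak_partial U i f) = Lq_norm q U g"
proof (rule Lq_norm_cong_AE)
  note w = has_weak_partial_weak_partial[OF fg]
  show "weak_partial U i f \<in> borel_measurable (lebesgue_on U)" "g \<in> borel_measurable (lebesgue_on U)"
    using locally_integrable_measurable[OF U] has_weak_partialD(2) w fg by blast+
  show "AE x in lebesgue_on U. weak_partial U i f x = g x"
    by (rule has_weak_partial_unique[OF U w fg])
qed

lemma Lq_space_cong:
  assumes "\<And>x. x \<in> U \<Longrightarrow> f x = g x"
  shows "f \<in> Lq_space q U V \<longleftrightarrow> g \<in> Lq_space q U V"
proof -
  have "f \<in> borel_measurable (lebesgue_on U) \<longleftrightarrow> g \<in> borel_measurable (lebesgue_on U)"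
    using assms by (intro measurable_cong) auto
  moreover have "f ` U \<subseteq> V \<longleftrightarrow> g ` U \<subseteq> V" using assms by auto
  moreover have "integrable (lebesgue_on U) (\<lambda>x. norm (f x) powr q) \<longleftrightarrow> integrable (lebesgue_on U) (\<lambda>x. norm (g x) powr q)"
    using assms by (intro Bochner_Integration.integrable_cong) auto
  ultimately show ?thesis by (simp add: Lq_space_def)
qed

lemma sobolev_space_cong:
  assumes "\<And>x. x \<in> U \<Longrightarrow> f x = g x"
  shows "f \<in> sobolev_space q U V \<longleftrightarrow> g \<in> sobolev_space q U V"
proof -
  have "has_weak_partial U i f h \<longleftrightarrow> has_weak_partial U i g h" for i h
    using assms by (intro has_weak_partial_cong) auto
  moreover have "f \<in> Lq_space q U V \<longleftrightarrow> g \<in> Lq_space q U V"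
    using assms by (rule Lq_space_cong)
  ultimately show ?thesis by (simp add: sobolev_space_def)
qed

text \<open>Functions that agree on \<open>U\<close> have the same weak derivatives, so the choice
  operator returns literally the same function for both.\<close>

lemma sobolev_norm_cong:
  assumes "\<And>x. x \<in> U \<Longrightarrow> f x = g x"
  shows "sobolev_norm q U f = sobolev_norm q U g"
proof -
  have "Lq_norm q U f = Lq_norm q U g"
  proof -
    have "(LINT x|lebesgue_on U. norm (f x) powr q) = (LINT x|lebesgue_on U. norm (g x) powr q)"
      using assms by (intro Bochner_Integration.integral_cong) auto
    then show ?thesis by (simp add: Lq_norm_def)
  qed
  moreover have "weak_partial U i f = weak_partial U i g" for i
  proof -
    have "has_weak_partial U i f h \<longleftrightarrow> has_weak_partial U i g h" for h
      using assms by (intro has_weak_partial_cong) auto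
    then show ?thesis by (simp add: weak_partial_def)
  qed
  ultimately show ?thesis by (simp add: sobolev_norm_def)
qed

text \<open>The integral of the series is at most that of a geometric series. Its sum then serves as
  majorant, and its convergence forces the terms to 0.\<close>

lemma AE_summable_of_integral_geometric:
  fixes h :: "nat \<Rightarrow> 'a \<Rightarrow> real"
  assumes int: "\<And>n. integrable M (h n)" and nonneg: "\<And>n x. 0 \<le> h n x"
    and le: "\<And>n. integral\<^sup>L M (h n) \<le> (1 / 2) ^ n"
  shows "AE x in M. summable (\<lambda>n. h n x)" "integrable M (\<lambda>x. \<Sum>n. h n x)"
proof -
  have "(\<integral>\<^sup>+x. (\<Sum>n. ennreal (h n x)) \<partial>M) = (\<Sum>n. \<integral>\<^sup>+x. ennreal (h n x) \<partial>M)"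
    using int by (intro nn_integral_suminf) auto
  also have "\<dots> = (\<Sum>n. ennreal (integral\<^sup>L M (h n)))"
    using int nonneg by (simp add: nn_integral_eq_integral)
  also have "\<dots> \<le> (\<Sum>n. ennreal ((1 / 2) ^ n))"
    using le by (intro suminf_le) (auto intro: ennreal_leI)
  also have "\<dots> = ennreal (\<Sum>n. (1 / 2) ^ n)"
    by (rule suminf_ennreal2[OF _ summable_geometric]) auto
  also have "\<dots> < top" by (rule ennreal_less_top)
  finally have "AE x in M. (\<Sum>n. ennreal (h n x)) \<noteq> \<infinity>"
    using int by (intro nn_integral_noteq_infinite) auto
  then show ae: "AE x in M. summable (\<lambda>n. h n x)"
    by eventually_elim (rule summable_suminf_not_top, use nonneg in auto)
  show "integrable M (\<lambda>x. \<Sum>n. h n x)"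
  proof (rule integrable_suminf)
    show "AE x in M. summable (\<lambda>n. norm (h n x))" using ae nonneg by simp
    show "summable (\<lambda>n. LINT x|M. norm (h n x))"
      by (rule summable_comparison_test'[OF summable_geometric[of "1 / 2 :: real"], of 0])
         (use le nonneg in \<open>auto simp: integral_nonneg_AE\<close>)
  qed (rule int)
qed

lemma powr_add_le:
  fixes a b q :: real
  assumes "0 \<le> a" "0 \<le> b" "1 \<le> q"
  shows "(a + b) powr q \<le> 2 powr q * (a powr q + b powr q)"
proof -
  have "(a + b) powr q \<le> (2 * max a b) powr q"
    using assms by (intro powr_mono2) auto
  also have "\<dots> = 2 powr q * (max a b) powr q"
    using assms by (simp add: powr_mult)
  also have "\<dots> \<le> 2 powr q * (a powr q + b powr q)"
    by (intro mult_left_mono) (auto simp: max_def)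
  finally show ?thesis .
qed

lemma Lq_space_diff:
  assumes A: "A \<in> Lq_space q U V" and B: "B \<in> Lq_space q U V'" and q: "1 \<le> q"
  shows "(\<lambda>x. B x - A x) \<in> Lq_space q U UNIV"
proof -
  have [measurable]: "A \<in> borel_measurable (lebesgue_on U)" "B \<in> borel_measurable (lebesgue_on U)"
    using A B by (auto simp: Lq_space_def)
  have "integrable (lebesgue_on U) (\<lambda>x. 2 powr q * (norm (B x) powr q + norm (A x) powr q))"
    using A B by (auto simp: Lq_space_def)
  then have "integrable (lebesgue_on U) (\<lambda>x. norm (B x - A x) powr q)"
  proof (rule Bochner_Integration.integrable_bound)
    show "AE x in lebesgue_on U. norm (norm (B x - A x) powr q) \<le> norm (2 powr q * (norm (B x) powr q + norm (A x) powr q))"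
    proof (intro AE_I2)
      fix x
      have "norm (B x - A x) powr q \<le> (norm (B x) + norm (A x)) powr q"
        using q by (intro powr_mono2 norm_triangle_ineq4) auto
      also have "\<dots> \<le> 2 powr q * (norm (B x) powr q + norm (A x) powr q)"
        using q by (intro powr_add_le) auto
      finally show "norm (norm (B x - A x) powr q) \<le> norm (2 powr q * (norm (B x) powr q + norm (A x) powr q))"
        by simp
    qed
  qed measurable
  then show ?thesis by (auto simp: Lq_space_def)
qed

lemma sobolev_norm_eq:
  assumes U: "open U" and fg: "\<And>i. has_weak_partial U i f (g i)"
  shows "sobolev_norm q U f = Lq_norm q U f + (\<Sum>i\<in>UNIV. Lq_norm q U (g i))"
  unfolding sobolev_norm_def using Lq_norm_weak_partial[OF U fg] by simp

text \<open>Reduces vector-valued measurability and weak derivatives to the scalar components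
  through sums and bounded linear maps.\<close>

lemma vec_lambda_eq_sum_axis: "(\<chi> k. u k :: real^'n) = (\<Sum>k\<in>UNIV. u k *\<^sub>R axis k 1)"
  by (simp add: vec_eq_iff axis_def if_distrib[of "\<lambda>z. _ * z"] cong: if_cong)

lemma borel_measurable_vec_lambda:
  fixes u :: "'n::finite \<Rightarrow> 'a \<Rightarrow> real"
  assumes "\<And>k. u k \<in> borel_measurable M"
  shows "(\<lambda>x. \<chi> k. u k x) \<in> borel_measurable M"
  unfolding vec_lambda_eq_sum_axis using assms by simp

section \<open>The superposition operator\<close>

locale difference_of_convex =
  fixes f g :: "'n::finite \<Rightarrow> 'v::euclidean_space \<Rightarrow> real" and L :: real
  assumes f: "\<And>k. convex_lipschitz (f k) L" and g: "\<And>k. convex_lipschitz (g k) L"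
begin

definition dc :: "'v \<Rightarrow> real^'n" where
  "dc a = (\<chi> k. f k a - g k a)"

definition dc_deriv :: "'v \<Rightarrow> 'v \<Rightarrow> real^'n" where
  "dc_deriv a b = (\<chi> k. dir_deriv (f k) a b - dir_deriv (g k) a b)"

text \<open>Imposed on \<open>f k\<close> and \<open>g k\<close> separately: the limit of a
  difference needs upper and lower bounds for each part.\<close>

definition two_sided :: "'v \<Rightarrow> 'v \<Rightarrow> bool" where
  "two_sided a b \<longleftrightarrow> (\<forall>k. dir_deriv (f k) a b + dir_deriv (f k) a (- b) = 0 \<and>
     dir_deriv (g k) a b + dir_deriv (g k) a (- b) = 0)"

text \<open>The 2 accounts for \<open>f\<close> and \<open>g\<close>, the cardinality for bounding
  the norm by the sum of the coordinates.\<close>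

definition dc_const :: real where "dc_const = 2 * \<bar>L\<bar> * real CARD('n)"

lemma dc_const_nonneg: "0 \<le> dc_const" by (simp add: dc_const_def)

lemma norm_le_dc_const:
  assumes "\<And>k. \<bar>u k\<bar> \<le> L * r" "\<And>k. \<bar>v k\<bar> \<le> L * r" "0 \<le> r"
  shows "norm (\<chi> k. u k - v k :: real^'n) \<le> dc_const * r"
proof -
  have Lr: "L * r \<le> \<bar>L\<bar> * r" using assms(3) by (intro mult_right_mono) auto
  have "norm (\<chi> k. u k - v k :: real^'n) \<le> (\<Sum>k\<in>UNIV. \<bar>(\<chi> k. u k - v k :: real^'n) $ k\<bar>)"
    by (rule norm_le_l1_cart)
  also have "\<dots> \<le> (\<Sum>k\<in>(UNIV :: 'n set). 2 * \<bar>L\<bar> * r)"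
  proof (rule sum_mono)
    fix k
    show "\<bar>(\<chi> k. u k - v k :: real^'n) $ k\<bar> \<le> 2 * \<bar>L\<bar> * r"
      using assms(1)[of k] assms(2)[of k] Lr by simp
  qed
  finally show ?thesis by (simp add: dc_const_def mult_ac)
qed

lemma dc_lipschitz: "norm (dc a - dc b) \<le> dc_const * norm (a - b)"
proof -
  have "dc a - dc b = (\<chi> k. (f k a - f k b) - (g k a - g k b))"
    by (simp add: dc_def vec_eq_iff)
  then show ?thesis
    using norm_le_dc_const[of "\<lambda>k. f k a - f k b" "norm (a - b)" "\<lambda>k. g k a - g k b"]
      convex_lipschitz.lipschitz[OF f] convex_lipschitz.lipschitz[OF g] by simp
qed

lemma dc_zero: "dc 0 = 0"
  using convex_lipschitz.zero[OF f] convex_lipschitz.zero[OF g] by (simp add: dc_def vec_eq_iff)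

lemma dc_deriv_bound: "norm (dc_deriv a b) \<le> dc_const * norm b"
  unfolding dc_deriv_def
  using convex_lipschitz.dir_deriv_bound[OF f] convex_lipschitz.dir_deriv_bound[OF g]
  by (intro norm_le_dc_const) auto

lemma dc_measurable:
  assumes "A \<in> borel_measurable M"
  shows "(\<lambda>x. dc (A x)) \<in> borel_measurable M"
  unfolding dc_def
  by (intro borel_measurable_vec_lambda borel_measurable_diff measurable_compose[OF assms]
      convex_lipschitz.measurable[OF f] convex_lipschitz.measurable[OF g])

lemma dc_deriv_measurable:
  "A \<in> borel_measurable M \<Longrightarrow> B \<in> borel_measurable M \<Longrightarrow> (\<lambda>x. dc_deriv (A x) (B x)) \<in> borel_measurable M"
  unfolding dc_deriv_def
  by (intro borel_measurable_vec_lambda borel_measurable_diff convex_lipschitz.dir_deriv_measurable[OF f]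
      convex_lipschitz.dir_deriv_measurable[OF g])

lemma dc_deriv_tendsto:
  assumes "A \<longlonglongrightarrow> a" "B \<longlonglongrightarrow> b" "\<And>n. two_sided (A n) (B n)" "two_sided a b"
  shows "(\<lambda>n. dc_deriv (A n) (B n)) \<longlonglongrightarrow> dc_deriv a b"
  unfolding dc_deriv_def using assms
  by (intro tendsto_vec_lambda tendsto_diff convex_lipschitz.dir_deriv_continuous_of_two_sided[OF f]
      convex_lipschitz.dir_deriv_continuous_of_two_sided[OF g])
     (auto simp: two_sided_def)

lemma has_weak_partial_dc:
  fixes A B :: "real^'m \<Rightarrow> 'v"
  assumes U: "open U" and AB: "has_weak_partial U i A B"
  shows "has_weak_partial U i (\<lambda>x. dc (A x)) (\<lambda>x. dc_deriv (A x) (B x))"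
    and "AE x in lebesgue_on U. two_sided (A x) (B x)"
proof -
  show "has_weak_partial U i (\<lambda>x. dc (A x)) (\<lambda>x. dc_deriv (A x) (B x))"
    unfolding dc_def dc_deriv_def vec_lambda_eq_sum_axis
    by (intro has_weak_partial_sum[OF U] has_weak_partial_bounded_linear[OF U bounded_linear_scaleR_left]
        has_weak_partial_diff[OF U] convex_lipschitz.has_weak_partial_comp(1)[OF f U AB]
        convex_lipschitz.has_weak_partial_comp(1)[OF g U AB])
  show "AE x in lebesgue_on U. two_sided (A x) (B x)"
    unfolding two_sided_def
    using convex_lipschitz.has_weak_partial_comp(2)[OF f U AB] convex_lipschitz.has_weak_partial_comp(2)[OF g U AB]
    by (simp add: AE_all_countable)
qed

lemma dc_sobolev_space:
  assumes U: "open U" and q: "1 \<le> q" and A: "A \<in> sobolev_space q U V"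
  shows "(\<lambda>x. dc (A x)) \<in> sobolev_space q U UNIV"
proof -
  have A_Lq: "A \<in> Lq_space q U V" using A by (simp add: sobolev_space_def)
  then have Am: "A \<in> borel_measurable (lebesgue_on U)" by (simp add: Lq_space_def)
  have "(\<lambda>x. dc (A x)) \<in> Lq_space q U UNIV"
    using dc_lipschitz[of _ 0] dc_zero dc_measurable[OF Am]
    by (intro Lq_space_dominated[OF A_Lq _ _ dc_const_nonneg q]) auto
  moreover have "\<exists>h\<in>Lq_space q U UNIV. has_weak_partial U i (\<lambda>x. dc (A x)) h" for i
  proof -
    obtain B where B: "B \<in> Lq_space q U V" "has_weak_partial U i A B"
      using A by (auto simp: sobolev_space_def)
    then have Bm: "B \<in> borel_measurable (lebesgue_on U)" by (simp add: Lq_space_def)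
    have "(\<lambda>x. dc_deriv (A x) (B x)) \<in> Lq_space q U UNIV"
      using dc_deriv_bound by (intro Lq_space_dominated[OF B(1) dc_deriv_measurable[OF Am Bm] _ dc_const_nonneg q])
    then show ?thesis using has_weak_partial_dc(1)[OF U B(2)] by blast
  qed
  ultimately show ?thesis by (simp add: sobolev_space_def)
qed

text \<open>Along a geometrically fast sequence the errors \<open>\<bar>\<partial>B n - \<partial>A\<bar> powr q\<close> are summable, which gives
  convergence almost everywhere and an integrable majorant without passing to subsequences.\<close>

lemma sobolev_norm_dc_tendsto:
  fixes A :: "real^'m \<Rightarrow> 'v"
  assumes U: "open U" and q: "1 \<le> q" and A: "A \<in> sobolev_space q U V"
    and B: "\<And>n. B n \<in> sobolev_space q U V"
    and fast: "\<And>n. sobolev_norm q U (\<lambda>x. B n x - A x) < (1 / 2) ^ n"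
  shows "(\<lambda>n. sobolev_norm q U (\<lambda>x. dc (B n x) - dc (A x))) \<longlonglongrightarrow> 0"
proof -
  let ?M = "lebesgue_on U"
  obtain A' where A': "\<And>i. A' i \<in> Lq_space q U V" "\<And>i. has_weak_partial U i A (A' i)"
    using A unfolding sobolev_space_def by (simp add: Bex_def) metis
  have "\<forall>n i. \<exists>h. h \<in> Lq_space q U V \<and> has_weak_partial U i (B n) h"
    using B unfolding sobolev_space_def by blast
  then obtain B' where B': "\<And>n i. B' n i \<in> Lq_space q U V" "\<And>n i. has_weak_partial U i (B n) (B' n i)"
    by metis
  have AL: "A \<in> Lq_space q U V" and BL: "B n \<in> Lq_space q U V" for n
    using A B by (auto simp: sobolev_space_def)
  have [measurable]: "A \<in> borel_measurable ?M" "B n \<in> borel_measurable ?M"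
    "A' i \<in> borel_measurable ?M" "B' n i \<in> borel_measurable ?M" for n i
    using AL BL A'(1) B'(1) by (auto simp: Lq_space_def)
  have norm_eq: "sobolev_norm q U (\<lambda>x. B n x - A x) =
      Lq_norm q U (\<lambda>x. B n x - A x) + (\<Sum>i\<in>UNIV. Lq_norm q U (\<lambda>x. B' n i x - A' i x))" for n
    by (rule sobolev_norm_eq[OF U]) (rule has_weak_partial_diff[OF U B'(2) A'(2)])
  have small0: "Lq_norm q U (\<lambda>x. B n x - A x) < (1 / 2) ^ n" for n
    using fast[of n] sum_nonneg[of UNIV "\<lambda>i. Lq_norm q U (\<lambda>x. B' n i x - A' i x)"]
    unfolding norm_eq by (simp add: Lq_norm_nonneg)
  have small: "Lq_norm q U (\<lambda>x. B' n i x - A' i x) < (1 / 2) ^ n" for n i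
  proof -
    have "Lq_norm q U (\<lambda>x. B' n i x - A' i x) \<le> (\<Sum>i\<in>UNIV. Lq_norm q U (\<lambda>x. B' n i x - A' i x))"
      by (rule member_le_sum) (auto simp: Lq_norm_nonneg)
    then show ?thesis
      using fast[of n] Lq_norm_nonneg[of q U "\<lambda>x. B n x - A x"] unfolding norm_eq by linarith
  qed
  have tendsto_0: "(\<lambda>n. h n) \<longlonglongrightarrow> 0" if "summable (\<lambda>n. norm (h n) powr q)" for h :: "nat \<Rightarrow> 'v"
  proof -
    have "(\<lambda>n. (norm (h n) powr q) powr (1 / q)) \<longlonglongrightarrow> 0"
      using summable_LIMSEQ_zero[OF that] q
      by (intro tendsto_zero_powrI[where f = "\<lambda>n. norm (h n) powr q" and g = "\<lambda>_. 1 / q" and b = "1 / q"]) auto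
    then have "(\<lambda>n. norm (h n)) \<longlonglongrightarrow> 0" using q by (simp add: powr_powr)
    then show ?thesis by (rule tendsto_norm_zero_cancel)
  qed
  have intD: "integrable ?M (\<lambda>x. norm (B n x - A x) powr q)" for n
    using Lq_space_diff[OF AL BL q] by (simp add: Lq_space_def)
  have intD': "integrable ?M (\<lambda>x. norm (B' n i x - A' i x) powr q)" for n i
    using Lq_space_diff[OF A'(1) B'(1) q] by (simp add: Lq_space_def)
  have half: "(1 / 2 :: real) ^ n \<le> 1" for n by (simp add: power_le_one)
  \<comment> \<open>Summability of the q-th powers of the errors; almost everywhere convergence
    follows by \<open>tendsto_0\<close>.\<close>
  note sumD = AE_summable_of_integral_geometric[OF intD powr_ge_zero integral_le_of_Lq_norm_less[OF small0 half q]]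
  have sumD': "AE x in ?M. summable (\<lambda>n. norm (B' n i x - A' i x) powr q)"
    "integrable ?M (\<lambda>x. \<Sum>n. norm (B' n i x - A' i x) powr q)" for i
    by (rule AE_summable_of_integral_geometric[OF intD' powr_ge_zero integral_le_of_Lq_norm_less[OF small half q]])+
  have lim_Lq: "(\<lambda>n. Lq_norm q U (h n)) \<longlonglongrightarrow> 0"
    if "(\<lambda>n. LINT x|?M. norm (h n x) powr q) \<longlonglongrightarrow> 0" for h :: "nat \<Rightarrow> _ \<Rightarrow> real^'n"
    unfolding Lq_norm_def using that q
    by (intro tendsto_zero_powrI[where b = "1 / q"]) (auto intro!: always_eventually integral_nonneg_AE)
  have 0: "(\<lambda>n. Lq_norm q U (\<lambda>x. dc (B n x) - dc (A x))) \<longlonglongrightarrow> 0"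
  proof (rule lim_Lq, rule tendsto_sandwich[OF _ _ tendsto_const])
    show "(\<lambda>n. dc_const powr q * (1 / 2) ^ n) \<longlonglongrightarrow> 0"
      by (intro tendsto_mult_right_zero LIMSEQ_power_zero) simp
    show "\<forall>\<^sub>F n in sequentially. (LINT x|?M. norm (dc (B n x) - dc (A x)) powr q) \<le> dc_const powr q * (1 / 2) ^ n"
    proof (intro always_eventually allI)
      fix n
      have "(LINT x|?M. norm (dc (B n x) - dc (A x)) powr q) \<le> (LINT x|?M. dc_const powr q * norm (B n x - A x) powr q)"
      proof (rule integral_mono_AE')
        show "AE x in ?M. norm (dc (B n x) - dc (A x)) powr q \<le> dc_const powr q * norm (B n x - A x) powr q"
        proof (intro AE_I2)
          fix x
          have "norm (dc (B n x) - dc (A x)) powr q \<le> (dc_const * norm (B n x - A x)) powr q"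
            using q dc_lipschitz by (intro powr_mono2) auto
          then show "norm (dc (B n x) - dc (A x)) powr q \<le> dc_const powr q * norm (B n x - A x) powr q"
            using dc_const_nonneg by (simp add: powr_mult)
        qed
      qed (use intD in auto)
      also have "\<dots> \<le> dc_const powr q * (1 / 2) ^ n"
        using integral_le_of_Lq_norm_less[OF small0 half q, of n] by (simp add: mult_left_mono)
      finally show "(LINT x|?M. norm (dc (B n x) - dc (A x)) powr q) \<le> dc_const powr q * (1 / 2) ^ n" .
    qed
  qed (auto intro!: always_eventually integral_nonneg_AE)
  have 1: "(\<lambda>n. Lq_norm q U (\<lambda>x. dc_deriv (B n x) (B' n i x) - dc_deriv (A x) (A' i x))) \<longlonglongrightarrow> 0" for i
  proof (rule lim_Lq)
    let ?h = "\<lambda>n x. dc_deriv (B n x) (B' n i x) - dc_deriv (A x) (A' i x)"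
    \<comment> \<open>Both derivatives are bounded by \<open>dc_const\<close> times \<bar>B'\<bar>
      and \<bar>A'\<bar>, and \<bar>B'\<bar> + \<bar>A'\<bar> \<le> \<bar>B' - A'\<bar> + 2
      \<bar>A'\<bar>. The whole series of errors replaces the n-th one, which makes the bound
      independent of \<open>n\<close>.\<close>
    let ?w = "\<lambda>x. dc_const powr q * (2 powr q * ((\<Sum>n. norm (B' n i x - A' i x) powr q) + 2 powr q * norm (A' i x) powr q))"
    have [measurable]: "?h n \<in> borel_measurable ?M" for n
      by (intro borel_measurable_diff dc_deriv_measurable) measurable
    have "(\<lambda>n. LINT x|?M. norm (?h n x) powr q) \<longlonglongrightarrow> (LINT x|?M. 0)"
    proof (rule integral_dominated_convergence[where w = ?w])
      show "integrable ?M ?w"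
        using sumD'(2)[of i] A'(1)[of i]
        by (intro integrable_mult_right Bochner_Integration.integrable_add) (auto simp: Lq_space_def)
      \<comment> \<open>One null set for each \<open>n\<close>; countably many can be
        united.\<close>
      have "AE x in ?M. \<forall>n. two_sided (B n x) (B' n i x)"
        using has_weak_partial_dc(2)[OF U B'(2)] by (simp add: AE_all_countable)
      with sumD(1) sumD'(1)[of i] has_weak_partial_dc(2)[OF U A'(2)[of i]]
      show "AE x in ?M. (\<lambda>n. norm (?h n x) powr q) \<longlonglongrightarrow> 0"
      proof eventually_elim
        case (elim x)
        have "(\<lambda>n. B n x) \<longlonglongrightarrow> A x" "(\<lambda>n. B' n i x) \<longlonglongrightarrow> A' i x"
          using tendsto_0[OF elim(1)] tendsto_0[OF elim(2)] by (simp_all add: LIM_zero_cancel)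
        then have "(\<lambda>n. dc_deriv (B n x) (B' n i x)) \<longlonglongrightarrow> dc_deriv (A x) (A' i x)"
          using elim by (intro dc_deriv_tendsto) auto
        then have "(\<lambda>n. norm (?h n x)) \<longlonglongrightarrow> 0"
          by (intro tendsto_norm_zero) (simp add: LIM_zero)
        then show ?case using q by (intro tendsto_zero_powrI[where b = q]) auto
      qed
      show "AE x in ?M. norm (norm (?h n x) powr q) \<le> ?w x" for n
        using sumD'(1)[of i]
      proof eventually_elim
        case (elim x)
        have "norm (?h n x) \<le> norm (dc_deriv (B n x) (B' n i x)) + norm (dc_deriv (A x) (A' i x))"
          by (rule norm_triangle_ineq4)
        also have "\<dots> \<le> dc_const * norm (B' n i x) + dc_const * norm (A' i x)"
          by (intro add_mono dc_deriv_bound)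
        also have "\<dots> = dc_const * (norm (B' n i x) + norm (A' i x))" by (simp add: distrib_left)
        also have "\<dots> \<le> dc_const * (norm (B' n i x - A' i x) + 2 * norm (A' i x))"
          using norm_triangle_ineq[of "B' n i x - A' i x" "A' i x"] dc_const_nonneg by (intro mult_left_mono) auto
        finally have "norm (?h n x) powr q \<le> (dc_const * (norm (B' n i x - A' i x) + 2 * norm (A' i x))) powr q"
          using q by (intro powr_mono2) auto
        also have "\<dots> = dc_const powr q * (norm (B' n i x - A' i x) + 2 * norm (A' i x)) powr q"
          using dc_const_nonneg by (simp add: powr_mult)
        also have "\<dots> \<le> dc_const powr q * (2 powr q * (norm (B' n i x - A' i x) powr q + (2 * norm (A' i x)) powr q))"
          using q by (intro mult_left_mono powr_add_le) auto
        also have "\<dots> \<le> ?w x"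
        proof -
          have "norm (B' n i x - A' i x) powr q \<le> (\<Sum>n. norm (B' n i x - A' i x) powr q)"
            using sum_le_suminf[OF elim, of "{n}"] by simp
          then show ?thesis by (intro mult_left_mono add_mono) (auto simp: powr_mult)
        qed
        finally show ?case by simp
      qed
    qed measurable
    then show "(\<lambda>n. LINT x|?M. norm (?h n x) powr q) \<longlonglongrightarrow> 0" by simp
  qed
  have "sobolev_norm q U (\<lambda>x. dc (B n x) - dc (A x)) = Lq_norm q U (\<lambda>x. dc (B n x) - dc (A x)) +
      (\<Sum>i\<in>UNIV. Lq_norm q U (\<lambda>x. dc_deriv (B n x) (B' n i x) - dc_deriv (A x) (A' i x)))" for n
    by (rule sobolev_norm_eq[OF U]) (intro has_weak_partial_diff[OF U] has_weak_partial_dc(1)[OF U] A'(2) B'(2))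
  moreover have "(\<lambda>n. Lq_norm q U (\<lambda>x. dc (B n x) - dc (A x)) +
      (\<Sum>i\<in>UNIV. Lq_norm q U (\<lambda>x. dc_deriv (B n x) (B' n i x) - dc_deriv (A x) (A' i x)))) \<longlonglongrightarrow> 0 + (\<Sum>i\<in>(UNIV :: 'm set). 0)"
    by (intro tendsto_add tendsto_sum 0 1)
  ultimately show ?thesis by simp
qed

end

text \<open>Functions stand for classes modulo null sets, so the middle claim makes the map well
  defined on classes, and continuity is expressed by the seminorm of a difference.\<close>

theorem theorem1p1:
  fixes U :: "(real^'m) set" and q :: real
    and W :: "(real^'m \<Rightarrow> complex^'d::{finite,linorder}^'d::{finite,linorder}) set"
  assumes "1 \<le> q" and "open U" and "bounded U"
    and W: "W = sobolev_space q U Herm"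
  shows "(\<forall>A\<in>W. char_map A \<in> sobolev_space q U UNIV) \<and>
    (\<forall>A\<in>W. \<forall>B\<in>W. (AE x in lebesgue_on U. A x = B x) \<longrightarrow>
      (AE x in lebesgue_on U. char_map A x = char_map B x)) \<and>
    (\<forall>A\<in>W. \<forall>\<epsilon>>0. \<exists>\<delta>>0. \<forall>B\<in>W.
      sobolev_norm q U (\<lambda>x. B x - A x) < \<delta> \<longrightarrow>
      sobolev_norm q U (\<lambda>x. char_map B x - char_map A x) < \<epsilon>)"
proof (intro conjI ballI impI allI)
  interpret difference_of_convex "\<lambda>k :: 'd::{finite,linorder}. neg_trace_sup {..<k}" "\<lambda>k :: 'd::{finite,linorder}. neg_trace_sup {..k}" "real CARD('d) ^ 3"
    by (rule difference_of_convex.intro) (rule convex_lipschitz_neg_trace_sup)+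
  have char_map: "char_map A x = dc (A x)" if "A \<in> W" "x \<in> U" for A x
  proof -
    have "A x \<in> Herm" using that unfolding W sobolev_space_def Lq_space_def by blast
    then show ?thesis by (simp add: char_map_def dc_def eigvals_incr_eq_diff_neg_trace_sup)
  qed
  show "char_map A \<in> sobolev_space q U UNIV" if "A \<in> W" for A
    using dc_sobolev_space[OF assms(2,1), of A Herm] that sobolev_space_cong[of U "char_map A" "\<lambda>x. dc (A x)"]
      char_map W by blast
  show "AE x in lebesgue_on U. char_map A x = char_map B x" if "AE x in lebesgue_on U. A x = B x" for A B
    using that by eventually_elim (simp add: char_map_def)
  fix A and \<epsilon> :: real assume A: "A \<in> W" and \<epsilon>: "0 < \<epsilon>"
  \<comment> \<open>Values are Hermitian only on \<open>U\<close>, so \<open>char_map\<close> and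
    \<open>dc\<close> are compared there and the congruence lemma does the rest.\<close>
  have norm_eq: "sobolev_norm q U (\<lambda>x. char_map B x - char_map A x) = sobolev_norm q U (\<lambda>x. dc (B x) - dc (A x))"
    if "B \<in> W" for B
    by (rule sobolev_norm_cong) (simp add: char_map A that)
  show "\<exists>\<delta>>0. \<forall>B\<in>W. sobolev_norm q U (\<lambda>x. B x - A x) < \<delta> \<longrightarrow>
      sobolev_norm q U (\<lambda>x. char_map B x - char_map A x) < \<epsilon>"
  proof (rule ccontr)
    assume neg: "\<not> ?thesis"
    \<comment> \<open>The negated claim at \<delta> = (1/2)^n supplies the n-th counterexample, so
      the sequence automatically converges geometrically fast.\<close>
    have "\<exists>B. \<forall>n. B n \<in> W \<and> sobolev_norm q U (\<lambda>x. B n x - A x) < (1 / 2) ^ n \<and>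
        \<not> sobolev_norm q U (\<lambda>x. char_map (B n) x - char_map A x) < \<epsilon>"
    proof (rule choice, rule allI)
      fix n
      have "(0 :: real) < (1 / 2) ^ n" by simp
      then show "\<exists>B. B \<in> W \<and> sobolev_norm q U (\<lambda>x. B x - A x) < (1 / 2) ^ n \<and>
        \<not> sobolev_norm q U (\<lambda>x. char_map B x - char_map A x) < \<epsilon>"
        using neg by blast
    qed
    then obtain B where B: "\<And>n. B n \<in> W" "\<And>n. sobolev_norm q U (\<lambda>x. B n x - A x) < (1 / 2) ^ n"
        "\<And>n. \<not> sobolev_norm q U (\<lambda>x. char_map (B n) x - char_map A x) < \<epsilon>"
      by blast
    have "(\<lambda>n. sobolev_norm q U (\<lambda>x. dc (B n x) - dc (A x))) \<longlonglongrightarrow> 0"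
      using A B(1,2) unfolding W by (intro sobolev_norm_dc_tendsto assms)
    from order_tendstoD(2)[OF this \<epsilon>] obtain n where "sobolev_norm q U (\<lambda>x. dc (B n x) - dc (A x)) < \<epsilon>"
      by (auto simp: eventually_sequentially)
    then show False using B(3)[of n] norm_eq[OF B(1)[of n]] by simp
  qed
qed

end
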